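(* Let $2<p<6$, $2<q<4$ and $q<\frac p2+1$. Then (i) there exists a non-compact metric graph $\mathcal{G}^1$, with at least $3$ half-lines and at least one vertex of degree $2$, such that every point of $\mathcal{G}^1$ lies on a trail that contains two half-lines, and such that ground states of $F_{p,q}$ at mass $\mu$ on $\mathcal{G}^1$ exist for every $\mu>0$; (ii) there exist a non-compact metric graph $\mathcal{G}^2$, with at least $3$ half-lines and at least one vertex of degree $2$, such that every point of $\mathcal{G}^2$ lies on a trail that contains two half-lines, and a value $m>0$ such that ground states of $F_{p,q}$ at mass $m$ on $\mathcal{G}^2$ do not exist.
   Context: A metric graph $\mathcal{G}=(V,E)$ is connected, has finite vertex set $V$ and finite edge set $E$ (loops and multiple edges allowed); each bounded edge is identified with a compact interval of positive length, each unbounded edge (half-line) with $[0,+\infty)$, whose origin is a vertex (points at infinity are not vertices). $\mathcal{G}$ is non-compact if it has at least one half-line. The degree of a vertex is the number of edge-ends at it (a loop counts twice). A trail is a connected path in $\mathcal{G}$ in which every edge of the path is run through exactly once. $H^1(\mathcal{G})$ is the space of continuous functions on $\mathcal{G}$ with $\int_{\mathcal G}(|u'|^2+|u|^2)\,dx<\infty$ (weak derivative on each edge), and $H^1_\mu(\mathcal{G})=\{u\in H^1(\mathcal{G}):\|u\|_{L^2(\mathcal{G})}^2=\mu\}$ for $\mu>0$. $F_{p,q}(u,\mathcal{G})=\frac12\int_{\mathcal{G}}|u'|^2dx-\frac1p\int_{\mathcal{G}}|u|^pdx-\frac1q\sum_{v\in V}|u(v)|^q$. A ground state of $F_{p,q}$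 at mass $\mu$ on $\mathcal{G}$ is a function $u\in H^1_\mu(\mathcal{G})$ with $F_{p,q}(u,\mathcal{G})=\inf_{w\in H^1_\mu(\mathcal{G})}F_{p,q}(w,\mathcal{G})$. *)

theory Defs
  imports "HOL-Analysis.Analysis"
begin

section \<open>Metric graphs\<close>

text \<open>
  Edges are labelled by \<open>'e\<close>, so loops and multiple edges are allowed. The orientation from
  \<open>origin\<close> to \<open>terminus\<close> only serves to parametrise an edge. An edge of infinite length is a
  half-line; its \<open>terminus\<close> is meaningless and never used.
\<close>

record ('v, 'e) mgraph =
  vertices :: "'v set"
  edges :: "'e set"
  origin :: "'e \<Rightarrow> 'v"
  terminus :: "'e \<Rightarrow> 'v"
  len :: "'e \<Rightarrow> ereal"

definition half_lines :: "('v, 'e) mgraph \<Rightarrow> 'e set" where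
  "half_lines G = {e \<in> edges G. len G e = \<infinity>}"

definition bounded_edges :: "('v, 'e) mgraph \<Rightarrow> 'e set" where
  "bounded_edges G = {e \<in> edges G. len G e \<noteq> \<infinity>}"

definition adjacency :: "('v, 'e) mgraph \<Rightarrow> ('v \<times> 'v) set" where
  "adjacency G = (\<Union>e \<in> bounded_edges G. {(origin G e, terminus G e), (terminus G e, origin G e)})"

definition metric_graph :: "('v, 'e) mgraph \<Rightarrow> bool" where
  "metric_graph G \<longleftrightarrow>
     finite (vertices G) \<and> vertices G \<noteq> {} \<and> finite (edges G) \<and>
     (\<forall>e \<in> edges G. 0 < len G e \<and> origin G e \<in> vertices G) \<and>
     (\<forall>e \<in> bounded_edges G. terminus G e \<in> vertices G) \<and>
     (\<forall>v \<in> vertices G. \<forall>w \<in> vertices G. (v, w) \<in> (adjacency G)\<^sup>*)"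

definition noncompact :: "('v, 'e) mgraph \<Rightarrow> bool" where
  "noncompact G \<longleftrightarrow> half_lines G \<noteq> {}"

definition vertex_degree :: "('v, 'e) mgraph \<Rightarrow> 'v \<Rightarrow> nat" where
  "vertex_degree G v = card {e \<in> edges G. origin G e = v} + card {e \<in> bounded_edges G. terminus G e = v}"

datatype ('v, 'e) point = Vertex 'v | Inner 'e real

definition edge_interval :: "('v, 'e) mgraph \<Rightarrow> 'e \<Rightarrow> real set" where
  "edge_interval G e = {t. 0 \<le> t \<and> ereal t \<le> len G e}"

definition edge_point :: "('v, 'e) mgraph \<Rightarrow> 'e \<Rightarrow> real \<Rightarrow> ('v, 'e) point" where
  "edge_point G e t =
     (if t = 0 then Vertex (origin G e)
      else if ereal t = len G e then Vertex (terminus G e)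
      else Inner e t)"

definition points :: "('v, 'e) mgraph \<Rightarrow> ('v, 'e) point set" where
  "points G = Vertex ` vertices G \<union> (\<Union>e \<in> edges G. edge_point G e ` edge_interval G e)"


section \<open>Trails\<close>

text \<open>
  A path is a list of directed edges; \<open>(e, True)\<close> runs through \<open>e\<close> along its parametrisation and
  \<open>(e, False)\<close> against it. \<open>None\<close> stands for a point at infinity. As this is not a vertex, no
  path can be continued through it, so a half-line can only be the first or the last edge.
\<close>

definition edge_end :: "('v, 'e) mgraph \<Rightarrow> 'e \<Rightarrow> 'v option" where
  "edge_end G e = (if len G e = \<infinity> then None else Some (terminus G e))"

fun start_of :: "('v, 'e) mgraph \<Rightarrow> 'e \<times> bool \<Rightarrow> 'v option" where
  "start_of G (e, d) = (if d then Some (origin G e) else edge_end G e)"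

fun finish_of :: "('v, 'e) mgraph \<Rightarrow> 'e \<times> bool \<Rightarrow> 'v option" where
  "finish_of G (e, d) = (if d then edge_end G e else Some (origin G e))"

definition trail :: "('v, 'e) mgraph \<Rightarrow> ('e \<times> bool) list \<Rightarrow> bool" where
  "trail G T \<longleftrightarrow>
     T \<noteq> [] \<and> fst ` set T \<subseteq> edges G \<and> distinct (map fst T) \<and>
     (\<forall>i. Suc i < length T \<longrightarrow>
        finish_of G (T ! i) \<noteq> None \<and> finish_of G (T ! i) = start_of G (T ! Suc i))"

definition lies_on :: "('v, 'e) mgraph \<Rightarrow> ('v, 'e) point \<Rightarrow> ('e \<times> bool) list \<Rightarrow> bool" where
  "lies_on G x T \<longleftrightarrow> (\<exists>e \<in> fst ` set T. x \<in> edge_point G e ` edge_interval G e)"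

definition contains_two_half_lines :: "('v, 'e) mgraph \<Rightarrow> ('e \<times> bool) list \<Rightarrow> bool" where
  "contains_two_half_lines G T \<longleftrightarrow>
     (\<exists>h \<in> half_lines G. \<exists>k \<in> half_lines G. h \<noteq> k \<and> h \<in> fst ` set T \<and> k \<in> fst ` set T)"

definition every_point_on_two_half_line_trail :: "('v, 'e) mgraph \<Rightarrow> bool" where
  "every_point_on_two_half_line_trail G \<longleftrightarrow>
     (\<forall>x \<in> points G. \<exists>T. trail G T \<and> contains_two_half_lines G T \<and> lies_on G x T)"


section \<open>Weak derivatives on an open set of reals\<close>

text \<open>Test functions are compactly supported in \<open>I\<close> and continuously differentiable.\<close>

definition test_function :: "real set \<Rightarrow> (real \<Rightarrow> real) \<Rightarrow> bool" where
  "test_function I \<phi> \<longleftrightarrow>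
     (\<forall>x. \<phi> differentiable (at x)) \<and> continuous_on UNIV (deriv \<phi>) \<and>
     (\<exists>K. compact K \<and> K \<subseteq> I \<and> (\<forall>x. x \<notin> K \<longrightarrow> \<phi> x = 0))"

definition locally_integrable_on :: "(real \<Rightarrow> real) \<Rightarrow> real set \<Rightarrow> bool" where
  "locally_integrable_on f I \<longleftrightarrow> (\<forall>K. compact K \<and> K \<subseteq> I \<longrightarrow> set_integrable lborel K f)"

definition has_weak_deriv :: "real set \<Rightarrow> (real \<Rightarrow> real) \<Rightarrow> (real \<Rightarrow> real) \<Rightarrow> bool" where
  "has_weak_deriv I f g \<longleftrightarrow>
     locally_integrable_on f I \<and> locally_integrable_on g I \<and>
     (\<forall>\<phi>. test_function I \<phi> \<longrightarrow>
        (LINT t:I|lborel. f t * deriv \<phi> t) = - (LINT t:I|lborel. g t * \<phi> t))"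

text \<open>The weak derivative is unique up to a null set, so integrals do not depend on the choice.\<close>

definition weak_deriv :: "real set \<Rightarrow> (real \<Rightarrow> real) \<Rightarrow> real \<Rightarrow> real" where
  "weak_deriv I f = (SOME g. has_weak_deriv I f g)"


section \<open>The space \<open>H\<^sup>1\<close>, the energy and its ground states\<close>

text \<open>
  A function on \<open>G\<close> is a real function of the points; values outside \<open>points G\<close> play no role.
  \<open>G\<close> carries the quotient topology of the disjoint union of its edges, so continuity on \<open>G\<close>
  amounts to continuity along every closed edge, matching at the vertices being built into
  \<open>edge_point\<close>. The set \<open>einterval 0 (len G e)\<close> is the interior of the edge.
\<close>

definition along :: "('v, 'e) mgraph \<Rightarrow> (('v, 'e) point \<Rightarrow> real) \<Rightarrow> 'e \<Rightarrow> real \<Rightarrow> real" where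
  "along G u e t = u (edge_point G e t)"

definition along_deriv :: "('v, 'e) mgraph \<Rightarrow> (('v, 'e) point \<Rightarrow> real) \<Rightarrow> 'e \<Rightarrow> real \<Rightarrow> real" where
  "along_deriv G u e = weak_deriv (einterval 0 (len G e)) (along G u e)"

definition graph_integral :: "('v, 'e) mgraph \<Rightarrow> ('e \<Rightarrow> real \<Rightarrow> real) \<Rightarrow> real" where
  "graph_integral G f = (\<Sum>e \<in> edges G. LINT t:einterval 0 (len G e)|lborel. f e t)"

definition H1 :: "('v, 'e) mgraph \<Rightarrow> (('v, 'e) point \<Rightarrow> real) set" where
  "H1 G = {u. \<forall>e \<in> edges G.
     continuous_on (edge_interval G e) (along G u e) \<and>
     (\<exists>g. has_weak_deriv (einterval 0 (len G e)) (along G u e) g) \<and>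
     set_integrable lborel (einterval 0 (len G e))
       (\<lambda>t. \<bar>along_deriv G u e t\<bar>\<^sup>2 + \<bar>along G u e t\<bar>\<^sup>2)}"

definition H1_mass :: "('v, 'e) mgraph \<Rightarrow> real \<Rightarrow> (('v, 'e) point \<Rightarrow> real) set" where
  "H1_mass G \<mu> = {u \<in> H1 G. graph_integral G (\<lambda>e t. \<bar>along G u e t\<bar>\<^sup>2) = \<mu>}"

definition energy :: "real \<Rightarrow> real \<Rightarrow> ('v, 'e) mgraph \<Rightarrow> (('v, 'e) point \<Rightarrow> real) \<Rightarrow> real" where
  "energy p q G u =
     1 / 2 * graph_integral G (\<lambda>e t. \<bar>along_deriv G u e t\<bar>\<^sup>2)
     - 1 / p * graph_integral G (\<lambda>e t. \<bar>along G u e t\<bar> powr p)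
     - 1 / q * (\<Sum>v \<in> vertices G. \<bar>u (Vertex v)\<bar> powr q)"

text \<open>The infimum is taken in the extended reals, so it is meaningful without a lower bound.\<close>

definition ground_state ::
    "real \<Rightarrow> real \<Rightarrow> ('v, 'e) mgraph \<Rightarrow> real \<Rightarrow> (('v, 'e) point \<Rightarrow> real) \<Rightarrow> bool" where
  "ground_state p q G \<mu> u \<longleftrightarrow>
     u \<in> H1_mass G \<mu> \<and> ereal (energy p q G u) = (INF w \<in> H1_mass G \<mu>. ereal (energy p q G w))"

end

theory Submission
  imports Defs "HOL-Complex_Analysis.Great_Picard"
begin

text \<open>
  Put \<open>h(t)\<^sup>2 = (2 / p) (M\<^bsup>p-2\<^esup> t\<^sup>2 - t\<^sup>p)\<close>. If \<open>\<bar>u\<bar> \<le> M\<close>, then adding \<open>(M\<^bsup>p-2\<^esup> / p) \<mu>\<close> to the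
  vertex-free energy turns it into \<open>\<integral> (\<bar>u'\<bar>\<^sup>2 + h(\<bar>u\<bar>)\<^sup>2) / 2 \<ge> \<integral> \<bar>u'\<bar> h(\<bar>u\<bar>)\<close>, which counts the levels of \<open>\<bar>u\<bar>\<close>
  with weight \<open>h\<close>. On a graph covered by trails with two half-lines every level below the maximum is
  attained at least twice, which gives the sharp lower bound by the energy of the line; the soliton of
  the line attains the bound.

  Both graphs consist of \<open>N\<close> half-lines and a loop attached at one vertex, with a vertex of degree 2 in
  the middle of the loop. Minimising sequences converge after passing to a subsequence, and mass that
  escapes along a half-line costs at least its share of the energy of the line. Hence a ground state
  exists as soon as some function has energy below the line. If the loop is long, a soliton
  centred at the vertex of degree 2, with its tails beyond the loop copied to all half-lines, is such a
  function: the surplus of the tails costs less than the vertex term gains, for small masses because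
  \<open>q < p / 2 + 1\<close>, for large ones because the soliton is concentrated.

  If there are many half-lines and the loop is short, there is no ground state. A soliton far out on a
  half-line shows that the infimum is at most the energy of the line. Let \<open>a\<close> be the value at the vertex of
  the half-lines. Each half-line attains all levels below \<open>a\<close>, so that \<open>N - 2\<close> of them contribute an excess that beats
  the vertex terms if \<open>\<bar>u\<bar>\<close> stays below \<open>2 a\<close> on the loop; otherwise \<open>u\<close> oscillates on the short loop, and
  its kinetic energy there beats the vertex terms. Functions with small maximum have energy near zero
  and are no candidates at all.
\<close>

section \<open>Calibration on an interval\<close>

text \<open>The weight h is the first integral of the soliton equation: the soliton of height M
  solves |u'| = h(u), which makes the pointwise inequality an equality. For a general function M is
  its own maximum, so the lower bound is \<open>elin M \<mu>\<close>, and a minimisation over the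
  single variable M recovers the energy of the line. This takes the place of rearrangement, and it
  retains the excess of levels attained more than twice, which the nonexistence part spends against
  the vertex terms. The exponents enter through powers of M: energies on the line scale like
  \<open>M powr (p / 2 + 1)\<close>, vertex terms like \<open>M powr q\<close>. For tall solitons
  \<open>2 < q\<close> decides, since a tail beyond distance l costs at most a multiple of
  \<open>M powr 2 / l\<close>. The derivative in the definition of the energy is picked by a choice
  operator. The analysis is therefore done for primitives of explicit Borel functions
  (\<open>prim_on\<close>) and translated at both ends. Only the square of \<open>g\<close> is
  integrated over all of \<open>S\<close>, as \<open>g\<close> itself need not be integrable on a
  half-line.\<close>

definition prim_on :: "real set \<Rightarrow> (real \<Rightarrow> real) \<Rightarrow> (real \<Rightarrow> real) \<Rightarrow> bool" where
  "prim_on S f g \<longleftrightarrow> g \<in> borel_measurable borel \<and> (\<lambda>t. (g t)\<^sup>2) integrable_on S \<and>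
     (\<forall>a\<in>S. \<forall>b\<in>S. a \<le> b \<longrightarrow> f b - f a = integral {a..b} g)"

text \<open>A gauge integral need not restrict to measurable subsets; that of a nonnegative function
  is absolute, and then it does.\<close>

lemma integrable_on_subset_nonneg:
  fixes f :: "real \<Rightarrow> real"
  assumes "f integrable_on S" "\<And>x. x \<in> S \<Longrightarrow> 0 \<le> f x" "T \<subseteq> S" "T \<in> sets lebesgue"
  shows "f integrable_on T"
  using set_integrable_subset[OF nonnegative_absolutely_integrable_1[OF assms(1,2)] assms(4,3)]
  by (rule set_lebesgue_integral_eq_integral(1))

lemma integrable_on_dominated:
  fixes f w :: "real \<Rightarrow> real"
  assumes "f \<in> borel_measurable borel" "w integrable_on S" "S \<in> sets borel"
    "\<And>x. x \<in> S \<Longrightarrow> \<bar>f x\<bar> \<le> w x"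
  shows "f integrable_on S"
proof (rule measurable_bounded_by_integrable_imp_integrable)
  show "f \<in> borel_measurable (lebesgue_on S)"
    using assms(1) by (simp add: measurable_completion measurable_restrict_space1)
  show "S \<in> sets lebesgue" using assms(3) by auto
qed (use assms in auto)

lemma integrable_on_dominated_continuous:
  fixes f w :: "real \<Rightarrow> real"
  assumes "continuous_on S f" "w integrable_on S" "S \<in> sets borel"
    "\<And>x. x \<in> S \<Longrightarrow> \<bar>f x\<bar> \<le> w x"
  shows "f integrable_on S"
proof (rule measurable_bounded_by_integrable_imp_integrable)
  show "S \<in> sets lebesgue" using assms(3) by auto
  then show "f \<in> borel_measurable (lebesgue_on S)"
    using assms(1) by (rule continuous_imp_measurable_on_sets_lebesgue[rotated])
qed (use assms in auto)

lemma prim_on_subset: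
  assumes "prim_on S f g" "T \<subseteq> S" "T \<in> sets borel"
  shows "prim_on T f g"
proof -
  have "(\<lambda>t. (g t)\<^sup>2) integrable_on T"
    by (rule integrable_on_subset_nonneg) (use assms in \<open>auto simp: prim_on_def\<close>)
  then show ?thesis using assms(1,2) unfolding prim_on_def by blast
qed

lemma prim_on_eq:
  assumes "prim_on S f g" "a \<in> S" "b \<in> S" "a \<le> b"
  shows "f b - f a = integral {a..b} g"
  using assms unfolding prim_on_def by blast

text \<open>\<open>\<bar>g t\<bar> \<le> 1 + (g t)\<^sup>2\<close>, and the constant is integrable
  because the interval is bounded.\<close>

lemma prim_on_abs_integrable:
  assumes "prim_on {a..b} f g"
  shows "g integrable_on {a..b}" "(\<lambda>t. \<bar>g t\<bar>) integrable_on {a..b}" "(\<lambda>t. (g t)\<^sup>2) integrable_on {a..b}"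
proof -
  have g: "g \<in> borel_measurable borel" and g2: "(\<lambda>t. (g t)\<^sup>2) integrable_on {a..b}"
    using assms unfolding prim_on_def by auto
  have w: "(\<lambda>t. 1 + (g t)\<^sup>2) integrable_on {a..b}"
    by (intro integrable_add g2) auto
  have le: "\<bar>g t\<bar> \<le> 1 + (g t)\<^sup>2" for t
  proof -
    have "(\<bar>g t\<bar> - 1)\<^sup>2 = (g t)\<^sup>2 - 2 * \<bar>g t\<bar> + 1" by (simp add: power2_diff)
    then show ?thesis using zero_le_power2[of "\<bar>g t\<bar> - 1"] by linarith
  qed
  show "g integrable_on {a..b}"
    by (rule integrable_on_dominated[OF g w]) (use le in auto)
  show "(\<lambda>t. \<bar>g t\<bar>) integrable_on {a..b}"
    by (rule integrable_on_dominated[OF _ w]) (use le g in auto)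
  show "(\<lambda>t. (g t)\<^sup>2) integrable_on {a..b}" by (rule g2)
qed

lemma prim_on_abs_le:
  assumes "prim_on {a..b} f g" "a \<le> s" "s \<le> t" "t \<le> b"
  shows "\<bar>f t - f s\<bar> \<le> integral {s..t} (\<lambda>x. \<bar>g x\<bar>)"
proof -
  have p: "prim_on {s..t} f g" by (rule prim_on_subset[OF assms(1)]) (use assms in auto)
  have "f t - f s = integral {s..t} g" by (rule prim_on_eq[OF p]) (use assms in auto)
  then show ?thesis
    using integral_norm_bound_integral[OF prim_on_abs_integrable(1,2)[OF p]] by auto
qed

lemma prim_on_continuous_interval:
  assumes "prim_on {a..b} f g"
  shows "continuous_on {a..b} f"
proof -
  have c: "continuous_on {a..b} (\<lambda>x. f a + integral {a..x} g)"
    by (intro continuous_intros indefinite_integral_continuous_1 prim_on_abs_integrable(1)[OF assms])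
  have "f a + integral {a..x} g = f x" if "x \<in> {a..b}" for x
    using prim_on_eq[OF assms, of a x] that by auto
  with c show ?thesis by (rule continuous_on_eq)
qed

lemma prim_on_continuous_half_line:
  assumes "prim_on {a..} f g"
  shows "continuous_on {a..} f"
proof -
  have "continuous (at x within {a..}) f" if "x \<in> {a..}" for x
  proof -
    have "continuous_on {a..x+1} f"
      by (rule prim_on_continuous_interval[OF prim_on_subset[OF assms]]) auto
    then have "continuous (at x within {a..x+1}) f"
      using that by (simp add: continuous_on_eq_continuous_within)
    moreover have "at x within {a..x+1} = at x within {a..}"
      by (rule at_within_nhd[where S = "{x-1<..<x+1}"]) auto
    ultimately show ?thesis by simp
  qed
  then show ?thesis by (simp add: continuous_on_eq_continuous_within)
qed

text \<open>Cauchy-Schwarz, read off from the nonnegative integral of the squared deviation of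
  \<open>g\<close> from its mean \<open>D\<close>.\<close>

lemma prim_on_holder:
  assumes "prim_on {a..b} f g" "a \<le> b"
  shows "(f b - f a)\<^sup>2 \<le> (b - a) * integral {a..b} (\<lambda>t. (g t)\<^sup>2)"
proof (cases "a = b")
  case False
  define K where "K = integral {a..b} (\<lambda>t. (g t)\<^sup>2)"
  define D where "D = (f b - f a) / (b - a)"
  note i = prim_on_abs_integrable[OF assms(1)]
  have "integral {a..b} g = f b - f a" using prim_on_eq[OF assms(1), of a b] assms by simp
  then have gi: "(g has_integral (f b - f a)) {a..b}" using i(1) by (metis integrable_integral)
  have "((\<lambda>t. (g t)\<^sup>2 - 2 * D * g t + D\<^sup>2) has_integral (K - 2 * D * (f b - f a) + (b - a) * D\<^sup>2)) {a..b}"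
    unfolding K_def using has_integral_const_real[of "D\<^sup>2" a b] assms(2)
    by (intro has_integral_add has_integral_diff has_integral_mult_right gi integrable_integral i(3)) auto
  then have "0 \<le> K - 2 * D * (f b - f a) + (b - a) * D\<^sup>2"
  proof (rule has_integral_nonneg)
    fix t
    have "(g t)\<^sup>2 - 2 * D * g t + D\<^sup>2 = (g t - D)\<^sup>2" by (simp add: power2_diff)
    then show "0 \<le> (g t)\<^sup>2 - 2 * D * g t + D\<^sup>2" by simp
  qed
  also have "\<dots> = K - (f b - f a)\<^sup>2 / (b - a)"
  proof -
    have D: "(b - a) * D = f b - f a" using False by (simp add: D_def)
    then have "(b - a) * D\<^sup>2 = D * (f b - f a)" by (simp add: power2_eq_square)
    moreover have "D * (f b - f a) = (f b - f a)\<^sup>2 / (b - a)" by (simp add: D_def power2_eq_square)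
    ultimately show ?thesis by simp
  qed
  finally show ?thesis using False assms(2) by (simp add: K_def pos_divide_le_eq mult.commute)
qed simp

text \<open>The substitute for a chain or product rule: errors that are small relative to the
  increments of a fixed \<open>W\<close> add up to \<open>e * (W b - W a)\<close> along a fine
  partition, and \<open>e\<close> is arbitrary.\<close>

lemma subdivision_le:
  fixes H W :: "real \<Rightarrow> real"
  assumes "a \<le> b"
    and loc: "\<And>e. 0 < e \<Longrightarrow> \<exists>d>0. \<forall>s t. a \<le> s \<longrightarrow> s \<le> t \<longrightarrow> t \<le> b \<longrightarrow> t - s < d \<longrightarrow> H t - H s \<le> e * (W t - W s)"
  shows "H b \<le> H a"
proof -
  have "H b - H a \<le> e * (W b - W a)" if "0 < e" for e
  proof -
    obtain d where d: "0 < d" "\<And>s t. a \<le> s \<Longrightarrow> s \<le> t \<Longrightarrow> t \<le> b \<Longrightarrow> t - s < d \<Longrightarrow> H t - H s \<le> e * (W t - W s)"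
      using loc[OF \<open>0 < e\<close>] by blast
    obtain n :: nat where n: "(b - a) / d < real n" using reals_Archimedean2 by blast
    have "0 \<le> (b - a) / d" using assms d by simp
    then have n0: "0 < real n" using n by linarith
    define x where "x i = a + real i * ((b - a) / real n)" for i
    have st: "(b - a) / real n < d" using n n0 d(1) by (simp add: field_simps)
    have "H (x i) - H a \<le> e * (W (x i) - W a)" if "i \<le> n" for i
      using that
    proof (induction i)
      case 0
      then show ?case by (simp add: x_def)
    next
      case (Suc i)
      have eq: "x (Suc i) - x i = (b - a) / real n" unfolding x_def of_nat_Suc distrib_right by simp
      have "real (Suc i) * ((b - a) / real n) \<le> real n * ((b - a) / real n)"
        using Suc.prems assms n0 by (intro mult_right_mono) auto
      then have "x (Suc i) \<le> b" using n0 by (simp add: x_def)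
      moreover have "a \<le> x i" using assms by (simp add: x_def)
      moreover have "x i \<le> x (Suc i)" using eq assms n0 by (smt (verit) divide_nonneg_pos)
      ultimately have "H (x (Suc i)) - H (x i) \<le> e * (W (x (Suc i)) - W (x i))"
        using d(2) eq st by auto
      then show ?case using Suc by (simp add: algebra_simps)
    qed
    from this[of n] show ?thesis using n0 by (simp add: x_def)
  qed note le = this
  show ?thesis
  proof (rule ccontr)
    assume "\<not> H b \<le> H a"
    then have h: "0 < H b - H a" by simp
    \<comment> \<open>\<open>w\<close> is positive and exceeds \<open>W b - W a\<close>, whatever
      the sign of the latter, so that taking \<open>e = (H b - H a) / w\<close> gives a
      contradiction.\<close>
    define w where "w = \<bar>W b - W a\<bar> + 1"
    have w: "0 < w" "W b - W a < w" by (auto simp: w_def)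
    have "H b - H a \<le> (H b - H a) / w * (W b - W a)" using le[of "(H b - H a) / w"] h w by simp
    also have "\<dots> < (H b - H a) / w * w" using h w by (intro mult_strict_left_mono) auto
    finally show False using w by simp
  qed
qed

text \<open>This is \<open>\<bar>f'\<bar> h(\<bar>f\<bar>) \<le> (f'\<^sup>2 + h(\<bar>f\<bar>)\<^sup>2) / 2\<close>, integrated; passing through a subdivision avoids
  a chain rule for weakly differentiable functions.\<close>

lemma calibration:
  assumes p: "prim_on {a..b} f g" and ab: "a \<le> b"
    and M: "\<And>t. t \<in> {a..b} \<Longrightarrow> \<bar>f t\<bar> \<le> M"
    and h: "continuous_on {0..M} h" "\<And>x. x \<in> {0..M} \<Longrightarrow> 0 \<le> h x"
    and G: "\<And>x. x \<in> {0..M} \<Longrightarrow> (G has_real_derivative h x) (at x within {0..M})"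
  shows "abs (G \<bar>f b\<bar> - G \<bar>f a\<bar>) \<le> integral {a..b} (\<lambda>t. ((g t)\<^sup>2 + (h \<bar>f t\<bar>)\<^sup>2) / 2)"
    and "(\<lambda>t. ((g t)\<^sup>2 + (h \<bar>f t\<bar>)\<^sup>2) / 2) integrable_on {a..b}"
proof -
  note i = prim_on_abs_integrable[OF p]
  have fc: "continuous_on {a..b} f" by (rule prim_on_continuous_interval[OF p])
  have hc: "continuous_on {a..b} (\<lambda>t. h \<bar>f t\<bar>)"
    by (rule continuous_on_compose2[OF h(1)]) (use fc M in \<open>auto intro!: continuous_intros\<close>)
  have hi: "(\<lambda>t. (h \<bar>f t\<bar>)\<^sup>2) integrable_on {a..b}"
    by (intro integrable_continuous_real continuous_intros hc)
  let ?q = "\<lambda>t. ((g t)\<^sup>2 + (h \<bar>f t\<bar>)\<^sup>2) / 2"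
  show qi: "?q integrable_on {a..b}"
    using integrable_on_divide[OF integrable_add[OF i(3) hi], of 2] by simp
  \<comment> \<open>The bound \<open>c\<close> on \<open>h\<close> is asked for only between the two
    points; this locality permits freezing \<open>h\<close> on short intervals.\<close>
  have Glip: "\<bar>G x - G y\<bar> \<le> c * \<bar>x - y\<bar>"
    if "x \<in> {0..M}" "y \<in> {0..M}" "\<And>z. z \<in> {0..M} \<Longrightarrow> min x y \<le> z \<Longrightarrow> z \<le> max x y \<Longrightarrow> h z \<le> c" for x y c
  proof -
    have *: "\<bar>G v - G u\<bar> \<le> c * (v - u)" if "u \<le> v" "0 \<le> u" "v \<le> M" "\<And>z. u \<le> z \<Longrightarrow> z \<le> v \<Longrightarrow> h z \<le> c" for u v
    proof (cases "u = v")
      case False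
      have "\<exists>x\<in>{u<..<v}. G v - G u = (\<lambda>y. h x * y) (v - u)"
      proof (rule mvt_simple)
        fix x assume "u \<le> x" "x \<le> v"
        then have "(G has_real_derivative h x) (at x within {u..v})"
          using G[of x] that by (auto intro: DERIV_subset)
        then show "(G has_derivative (\<lambda>y. h x * y)) (at x within {u..v})"
          by (simp add: has_field_derivative_def)
      qed (use that False in auto)
      then obtain x where x: "x \<in> {u<..<v}" "G v - G u = h x * (v - u)" by auto
      have "0 \<le> h x" "h x \<le> c" using h(2)[of x] that x(1) by auto
      then show ?thesis using x that by (auto simp: abs_mult intro!: mult_right_mono)
    qed simp
    show ?thesis
    proof (cases "x \<le> y")
      case True
      then have "\<bar>G y - G x\<bar> \<le> c * (y - x)" by (intro *) (use that in auto)
      then show ?thesis using True by (simp add: abs_minus_commute)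
    next
      case False
      then have "\<bar>G x - G y\<bar> \<le> c * (x - y)" by (intro *) (use that in auto)
      then show ?thesis using False by simp
    qed
  qed
  \<comment> \<open>Both signs together give the absolute value. \<open>H\<close> measures the
    failure of the claim and \<open>W\<close> is the integral of \<open>\<bar>g\<bar>\<close>,
    against which errors are measured.\<close>
  have main: "sg * (G \<bar>f b\<bar> - G \<bar>f a\<bar>) \<le> integral {a..b} ?q" if sg: "\<bar>sg\<bar> = 1" for sg
  proof -
    define H where "H x = sg * G \<bar>f x\<bar> - integral {a..x} ?q" for x
    define W where "W x = integral {a..x} (\<lambda>t. \<bar>g t\<bar>)" for x
    have "H b \<le> H a"
    proof (rule subdivision_le[OF ab, where W = W])
      fix e :: real assume e: "0 < e"
      have "uniformly_continuous_on {0..M} h" by (rule compact_uniformly_continuous[OF h(1)]) simp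
      then obtain d1 where d1: "0 < d1" "\<And>x y. x \<in> {0..M} \<Longrightarrow> y \<in> {0..M} \<Longrightarrow> \<bar>x - y\<bar> < d1 \<Longrightarrow> \<bar>h x - h y\<bar> < e / 2"
        unfolding uniformly_continuous_on_def dist_real_def using e by (metis half_gt_zero)
      have "uniformly_continuous_on {a..b} f" by (rule compact_uniformly_continuous[OF fc]) simp
      then obtain d where d: "0 < d" "\<And>x y. x \<in> {a..b} \<Longrightarrow> y \<in> {a..b} \<Longrightarrow> \<bar>x - y\<bar> < d \<Longrightarrow> \<bar>f x - f y\<bar> < d1"
        unfolding uniformly_continuous_on_def dist_real_def using d1(1) by metis
      show "\<exists>d>0. \<forall>s t. a \<le> s \<longrightarrow> s \<le> t \<longrightarrow> t \<le> b \<longrightarrow> t - s < d \<longrightarrow> H t - H s \<le> e * (W t - W s)"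
      proof (intro exI[of _ d] conjI allI impI)
        fix s t assume st: "a \<le> s" "s \<le> t" "t \<le> b" "t - s < d"
        \<comment> \<open>Freezing \<open>h\<close> at \<open>\<bar>f s\<bar>\<close> raises the
          upper bound for the increment of \<open>G\<close> and lowers the lower bound for the
          integral, each by \<open>e / 2\<close> times the increment of \<open>W\<close>.\<close>
        define c where "c = h \<bar>f s\<bar>"
        have c0: "0 \<le> c" unfolding c_def using M[of s] st by (intro h(2)) auto
        have sub: "?q integrable_on {s..t}" "(\<lambda>t. \<bar>g t\<bar>) integrable_on {s..t}"
          using integrable_on_subinterval[OF qi, of s t] integrable_on_subinterval[OF i(2), of s t] st by auto
        have near: "\<bar>h z - c\<bar> < e / 2" if "z \<in> {0..M}" "abs (z - \<bar>f s\<bar>) < d1" for z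
          unfolding c_def using d1(2)[of z "\<bar>f s\<bar>"] M[of s] st that by auto
        have fnear: "\<bar>f x - f s\<bar> < d1" if "x \<in> {s..t}" for x using d(2)[of x s] that st by auto
        have "abs (G \<bar>f t\<bar> - G \<bar>f s\<bar>) \<le> (c + e / 2) * abs (\<bar>f t\<bar> - \<bar>f s\<bar>)"
        proof (rule Glip)
          fix z assume z: "z \<in> {0..M}" "min \<bar>f t\<bar> \<bar>f s\<bar> \<le> z" "z \<le> max \<bar>f t\<bar> \<bar>f s\<bar>"
          have "abs (z - \<bar>f s\<bar>) < d1" using fnear[of t] st z by auto
          then show "h z \<le> c + e / 2" using near[OF z(1)] by linarith
        qed (use M[of s] M[of t] st in auto)
        also have "\<dots> \<le> (c + e / 2) * \<bar>f t - f s\<bar>"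
          using c0 e by (intro mult_left_mono) auto
        also have "\<dots> \<le> (c + e / 2) * integral {s..t} (\<lambda>t. \<bar>g t\<bar>)"
          using prim_on_abs_le[OF p, of s t] c0 e st by (intro mult_left_mono) auto
        finally have 1: "abs (G \<bar>f t\<bar> - G \<bar>f s\<bar>) \<le> (c + e / 2) * integral {s..t} (\<lambda>t. \<bar>g t\<bar>)" .
        have 2: "(c - e / 2) * integral {s..t} (\<lambda>t. \<bar>g t\<bar>) \<le> integral {s..t} ?q"
          unfolding integral_mult_right[symmetric]
        proof (rule integral_le)
          show "(\<lambda>x. (c - e / 2) * \<bar>g x\<bar>) integrable_on {s..t}"
            using integrable_on_cmult_left[OF sub(2)] by simp
          fix x assume x: "x \<in> {s..t}"
          have "\<bar>f x\<bar> \<in> {0..M}" using M[of x] x st by auto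
          moreover have "abs (\<bar>f x\<bar> - \<bar>f s\<bar>) < d1" using fnear[OF x] by linarith
          ultimately have "c - e / 2 \<le> h \<bar>f x\<bar>" using near[of "\<bar>f x\<bar>"] by linarith
          then have "(c - e / 2) * \<bar>g x\<bar> \<le> h \<bar>f x\<bar> * \<bar>g x\<bar>" by (intro mult_right_mono) auto
          also have "\<dots> \<le> ?q x"
            using zero_le_power2[of "\<bar>g x\<bar> - h \<bar>f x\<bar>"] by (simp add: power2_diff mult_ac)
          finally show "(c - e / 2) * \<bar>g x\<bar> \<le> ?q x" .
        qed (rule sub(1))
        have cq: "integral {a..t} ?q = integral {a..s} ?q + integral {s..t} ?q"
          by (rule Henstock_Kurzweil_Integration.integral_combine[symmetric]) (use st integrable_on_subinterval[OF qi, of a t] in auto)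
        have cW: "W t = W s + integral {s..t} (\<lambda>t. \<bar>g t\<bar>)" unfolding W_def
          by (rule Henstock_Kurzweil_Integration.integral_combine[symmetric]) (use st integrable_on_subinterval[OF i(2), of a t] in auto)
        have "sg * (G \<bar>f t\<bar> - G \<bar>f s\<bar>) \<le> \<bar>sg * (G \<bar>f t\<bar> - G \<bar>f s\<bar>)\<bar>" by (rule abs_ge_self)
        also have "\<dots> = abs (G \<bar>f t\<bar> - G \<bar>f s\<bar>)" by (simp add: abs_mult sg)
        finally have "sg * (G \<bar>f t\<bar> - G \<bar>f s\<bar>) \<le> abs (G \<bar>f t\<bar> - G \<bar>f s\<bar>)" .
        show "H t - H s \<le> e * (W t - W s)"
          proof -
          define I where "I = integral {s..t} (\<lambda>t. \<bar>g t\<bar>)"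
          define Q where "Q = integral {s..t} ?q"
          have *: "sg * (G \<bar>f t\<bar> - G \<bar>f s\<bar>) \<le> abs (G \<bar>f t\<bar> - G \<bar>f s\<bar>)" by fact
          have "H t - H s = sg * (G \<bar>f t\<bar> - G \<bar>f s\<bar>) - Q"
            unfolding H_def cq Q_def[symmetric] by (simp add: right_diff_distrib)
          moreover have "e * (W t - W s) = e * I" unfolding cW I_def by simp
          moreover have "(c + e / 2) * I - (c - e / 2) * I = e * I"
            by (simp add: left_diff_distrib distrib_right)
          ultimately show ?thesis using 1 2 * unfolding I_def[symmetric] Q_def[symmetric] by linarith
        qed
      qed (rule d(1))
    qed
    then show ?thesis by (simp add: H_def algebra_simps)
  qed
  have "abs X \<le> Q" if "\<And>sg. \<bar>sg\<bar> = 1 \<Longrightarrow> sg * X \<le> Q" for X Q :: real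
    using that[of 1] that[of "- 1"] by simp
  from this[OF main] show "abs (G \<bar>f b\<bar> - G \<bar>f a\<bar>) \<le> integral {a..b} ?q" by blast
qed

section \<open>Limits of primitives of square-integrable functions\<close>

lemma abs_le_if_square_le: "x\<^sup>2 \<le> C * (1/4) ^ k \<Longrightarrow> \<bar>x\<bar> \<le> sqrt C * (1/2) ^ k" for x C :: real
proof -
  assume a: "x\<^sup>2 \<le> C * (1/4) ^ k"
  have "((1/2::real) ^ k)\<^sup>2 = (1/4) ^ k" by (simp add: power2_eq_square power_mult_distrib[symmetric])
  then have "sqrt (C * (1/4) ^ k) = sqrt C * (1/2) ^ k"
    by (simp add: real_sqrt_mult real_sqrt_unique)
  then show ?thesis using real_sqrt_le_mono[OF a] by simp
qed

text \<open>Riesz-Fischer: the increments \<open>D k\<close> of a fast subsequence are so small in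
  norm that even the series \<open>W\<close> weighted by \<open>4 ^ k\<close> has finite integral.
  Where \<open>W\<close> is finite, the increments are dominated by a multiple of
  \<open>(1/2) ^ k\<close>, which gives pointwise limits; Fatou's lemma carries the Cauchy bound
  over to the whole sequence.\<close>

lemma L2_complete:
  fixes G :: "nat \<Rightarrow> real \<Rightarrow> real"
  assumes borel[measurable]: "\<And>n. G n \<in> borel_measurable borel"
    and int: "\<And>n. integrable lborel (\<lambda>t. (G n t)\<^sup>2)"
    and cauchy: "\<And>e. 0 < e \<Longrightarrow> \<exists>N. \<forall>m\<ge>N. \<forall>n\<ge>N. (\<integral>t. (G m t - G n t)\<^sup>2 \<partial>lborel) < e"
  obtains H where "H \<in> borel_measurable borel" "integrable lborel (\<lambda>t. (H t)\<^sup>2)"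
    "\<And>n. integrable lborel (\<lambda>t. (G n t - H t)\<^sup>2)"
    "(\<lambda>n. \<integral>t. (G n t - H t)\<^sup>2 \<partial>lborel) \<longlonglongrightarrow> 0"
proof -
  have sq2: "(x - y)\<^sup>2 \<le> 2 * x\<^sup>2 + 2 * y\<^sup>2" for x y :: real
    using zero_le_power2[of "x + y"] by (simp add: power2_diff power2_sum)
  have intd: "integrable lborel (\<lambda>t. (G m t - G n t)\<^sup>2)" for m n
  proof (rule Bochner_Integration.integrable_bound)
    show "integrable lborel (\<lambda>t. 2 * (G m t)\<^sup>2 + 2 * (G n t)\<^sup>2)" using int by simp
    show "AE t in lborel. norm ((G m t - G n t)\<^sup>2) \<le> norm (2 * (G m t)\<^sup>2 + 2 * (G n t)\<^sup>2)"
      using sq2 by simp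
  qed simp
  have "\<exists>N. \<forall>m\<ge>N. \<forall>n\<ge>N. (\<integral>t. (G m t - G n t)\<^sup>2 \<partial>lborel) < (1/8) ^ k" for k
    using cauchy[of "(1/8) ^ k"] by simp
  then obtain N where N: "\<And>k m n. N k \<le> m \<Longrightarrow> N k \<le> n \<Longrightarrow> (\<integral>t. (G m t - G n t)\<^sup>2 \<partial>lborel) < (1/8) ^ k"
    by metis
  \<comment> \<open>Summing the thresholds makes \<open>r k\<close> dominate every
    \<open>N j\<close> with \<open>j \<le> k\<close>.\<close>
  define r where "r k = (\<Sum>i\<le>k. N i)" for k
  have rk: "N j \<le> r k" if "j \<le> k" for j k
    unfolding r_def by (rule member_le_sum) (use that in auto)
  have rN: "N k \<le> r k" "N k \<le> r (Suc k)" for k by (auto intro: rk)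
  define D where "D k t = G (r (Suc k)) t - G (r k) t" for k t
  have D: "(\<integral>t. (D k t)\<^sup>2 \<partial>lborel) < (1/8) ^ k" for k unfolding D_def by (intro N rN)
  have [measurable]: "D k \<in> borel_measurable borel" for k unfolding D_def by measurable
  have Dn: "(\<integral>\<^sup>+t. ennreal (4 ^ k * (D k t)\<^sup>2) \<partial>lborel) \<le> ennreal ((1/2) ^ k)" for k
  proof -
    have "(\<integral>\<^sup>+t. ennreal (4 ^ k * (D k t)\<^sup>2) \<partial>lborel) = ennreal (\<integral>t. 4 ^ k * (D k t)\<^sup>2 \<partial>lborel)"
      by (rule nn_integral_eq_integral) (use intd in \<open>auto simp: D_def\<close>)
    also have "(\<integral>t. 4 ^ k * (D k t)\<^sup>2 \<partial>lborel) = 4 ^ k * (\<integral>t. (D k t)\<^sup>2 \<partial>lborel)" by simp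
    also have "ennreal \<dots> \<le> ennreal (4 ^ k * (1/8) ^ k)"
      using D[of k] by (intro ennreal_leI mult_left_mono) auto
    also have "(4::real) ^ k * (1/8) ^ k = (1/2) ^ k" by (simp add: power_mult_distrib[symmetric])
    finally show ?thesis .
  qed
  define W where "W t = (\<Sum>k. ennreal (4 ^ k * (D k t)\<^sup>2))" for t
  have [measurable]: "W \<in> borel_measurable borel" unfolding W_def by measurable
  have "(\<integral>\<^sup>+t. W t \<partial>lborel) = (\<Sum>k. \<integral>\<^sup>+t. ennreal (4 ^ k * (D k t)\<^sup>2) \<partial>lborel)"
    unfolding W_def by (rule nn_integral_suminf) auto
  also have "\<dots> \<le> (\<Sum>k. ennreal ((1/2) ^ k))" by (intro suminf_le Dn) auto
  also have "\<dots> = ennreal (\<Sum>k. (1/2) ^ k)" by (rule suminf_ennreal2) auto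
  finally have "(\<integral>\<^sup>+t. W t \<partial>lborel) \<noteq> \<infinity>" by (auto simp: top_unique)
  then have AEW: "AE t in lborel. W t \<noteq> \<infinity>" by (intro nn_integral_PInf_AE) auto
  \<comment> \<open>Where the subsequence diverges \<open>lim\<close> is some unspecified real, yet
    \<open>H\<close> stays measurable.\<close>
  define H where "H t = lim (\<lambda>k. G (r k) t)" for t
  have [measurable]: "H \<in> borel_measurable borel" unfolding H_def by measurable
  have conv: "(\<lambda>k. G (r k) t) \<longlonglongrightarrow> H t" if W: "W t \<noteq> \<infinity>" for t
  proof -
    obtain C where C: "W t = ennreal C" "0 \<le> C" using W by (cases "W t") auto
    have "(D k t)\<^sup>2 \<le> C * (1/4) ^ k" for k
    proof -
      have "(\<Sum>i\<in>{k}. ennreal (4 ^ i * (D i t)\<^sup>2)) \<le> W t"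
        unfolding W_def by (rule sum_le_suminf) auto
      then have "4 ^ k * (D k t)\<^sup>2 \<le> C" using C by simp
      then show ?thesis by (simp add: power_divide field_simps)
    qed
    then have le: "\<bar>D k t\<bar> \<le> sqrt C * (1/2) ^ k" for k by (rule abs_le_if_square_le)
    have "summable (\<lambda>k. sqrt C * (1/2) ^ k)" by (intro summable_mult summable_geometric) simp
    then have "summable (\<lambda>k. D k t)" by (rule summable_comparison_test'[of _ 0]) (use le in simp)
    then have "(\<lambda>n. \<Sum>k<n. D k t) \<longlonglongrightarrow> (\<Sum>k. D k t)" by (rule summable_LIMSEQ)
    moreover have "(\<Sum>k<n. D k t) = G (r n) t - G (r 0) t" for n
      unfolding D_def by (rule sum_lessThan_telescope)
    ultimately have "(\<lambda>n. (G (r n) t - G (r 0) t) + G (r 0) t) \<longlonglongrightarrow> (\<Sum>k. D k t) + G (r 0) t"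
      by (intro tendsto_add tendsto_const) simp
    then have "convergent (\<lambda>k. G (r k) t)" unfolding convergent_def by auto
    then show ?thesis unfolding H_def by (simp add: convergent_LIMSEQ_iff)
  qed
  have fatou: "(\<integral>\<^sup>+t. ennreal ((G n t - H t)\<^sup>2) \<partial>lborel) \<le> ennreal ((1/8) ^ j)" if n: "N j \<le> n" for n j
  proof -
    have "(\<integral>\<^sup>+t. ennreal ((G n t - H t)\<^sup>2) \<partial>lborel)
        = (\<integral>\<^sup>+t. liminf (\<lambda>k. ennreal ((G n t - G (r k) t)\<^sup>2)) \<partial>lborel)"
    proof (rule nn_integral_cong_AE, use AEW in eventually_elim)
      fix t assume "W t \<noteq> \<infinity>"
      then have "(\<lambda>k. ennreal ((G n t - G (r k) t)\<^sup>2)) \<longlonglongrightarrow> ennreal ((G n t - H t)\<^sup>2)"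
        by (intro tendsto_ennrealI tendsto_intros conv)
      then show "ennreal ((G n t - H t)\<^sup>2) = liminf (\<lambda>k. ennreal ((G n t - G (r k) t)\<^sup>2))"
        by (rule lim_imp_Liminf[symmetric, rotated]) simp
    qed
    also have "\<dots> \<le> liminf (\<lambda>k. \<integral>\<^sup>+t. ennreal ((G n t - G (r k) t)\<^sup>2) \<partial>lborel)"
      by (rule nn_integral_liminf) auto
    also have "\<dots> \<le> ennreal ((1/8) ^ j)"
    proof (rule Liminf_le)
      show "\<forall>\<^sub>F k in sequentially. (\<integral>\<^sup>+t. ennreal ((G n t - G (r k) t)\<^sup>2) \<partial>lborel) \<le> ennreal ((1/8) ^ j)"
        using eventually_ge_at_top[of j]
      proof eventually_elim
        case (elim k)
        have "(\<integral>\<^sup>+t. ennreal ((G n t - G (r k) t)\<^sup>2) \<partial>lborel) = ennreal (\<integral>t. (G n t - G (r k) t)\<^sup>2 \<partial>lborel)"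
          by (rule nn_integral_eq_integral) (use intd in auto)
        also have "\<dots> \<le> ennreal ((1/8) ^ j)"
          using N[OF n rk[OF elim]] by (intro ennreal_leI) simp
        finally show ?case .
      qed
    qed simp
    finally show ?thesis .
  qed
  have intGH': "integrable lborel (\<lambda>t. (G (N 0) t - H t)\<^sup>2)"
    using fatou[of 0 "N 0"] by (intro integrableI_nonneg) (auto simp: less_top[symmetric] top_unique)
  have intH: "integrable lborel (\<lambda>t. (H t)\<^sup>2)"
  proof (rule Bochner_Integration.integrable_bound)
    show "integrable lborel (\<lambda>t. 2 * (G (N 0) t)\<^sup>2 + 2 * (G (N 0) t - H t)\<^sup>2)" using int intGH' by simp
    have "norm ((H t)\<^sup>2) \<le> norm (2 * (G (N 0) t)\<^sup>2 + 2 * (G (N 0) t - H t)\<^sup>2)" for t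
      using sq2[of "G (N 0) t" "G (N 0) t - H t"] by simp
    then show "AE t in lborel. norm ((H t)\<^sup>2) \<le> norm (2 * (G (N 0) t)\<^sup>2 + 2 * (G (N 0) t - H t)\<^sup>2)"
      by (intro AE_I2)
  qed simp
  have intGH: "integrable lborel (\<lambda>t. (G n t - H t)\<^sup>2)" for n
  proof (rule Bochner_Integration.integrable_bound)
    show "integrable lborel (\<lambda>t. 2 * (G n t)\<^sup>2 + 2 * (H t)\<^sup>2)" using int intH by simp
    show "AE t in lborel. norm ((G n t - H t)\<^sup>2) \<le> norm (2 * (G n t)\<^sup>2 + 2 * (H t)\<^sup>2)"
      using sq2 by simp
  qed simp
  have le: "(\<integral>t. (G n t - H t)\<^sup>2 \<partial>lborel) \<le> (1/8) ^ j" if "N j \<le> n" for n j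
  proof -
    have "ennreal (\<integral>t. (G n t - H t)\<^sup>2 \<partial>lborel) = (\<integral>\<^sup>+t. ennreal ((G n t - H t)\<^sup>2) \<partial>lborel)"
      by (rule nn_integral_eq_integral[symmetric]) (use intGH in auto)
    also have "\<dots> \<le> ennreal ((1/8) ^ j)" by (rule fatou[OF that])
    finally show ?thesis by simp
  qed
  have "(\<lambda>n. \<integral>t. (G n t - H t)\<^sup>2 \<partial>lborel) \<longlonglongrightarrow> 0"
  proof (rule LIMSEQ_I)
    fix e :: real assume e: "0 < e"
    obtain j where j: "(1/8::real) ^ j < e" using real_arch_pow_inv[OF e, of "1/8"] by auto
    show "\<exists>no. \<forall>n\<ge>no. norm ((\<integral>t. (G n t - H t)\<^sup>2 \<partial>lborel) - 0) < e"
    proof (intro exI[of _ "N j"] allI impI)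
      fix n assume "N j \<le> n"
      then have "(\<integral>t. (G n t - H t)\<^sup>2 \<partial>lborel) < e" using le j by fastforce
      moreover have "0 \<le> (\<integral>t. (G n t - H t)\<^sup>2 \<partial>lborel)" by (rule integral_nonneg_AE) simp
      ultimately show "norm ((\<integral>t. (G n t - H t)\<^sup>2 \<partial>lborel) - 0) < e" by simp
    qed
  qed
  then show thesis using that[of H] intH intGH by simp
qed

lemma prim_on_integral:
  assumes "g \<in> borel_measurable borel" "(\<lambda>t. (g t)\<^sup>2) integrable_on {a..b}"
  shows "prim_on {a..b} (\<lambda>x. integral {a..x} g) g"
proof -
  have w: "(\<lambda>t. 1 + (g t)\<^sup>2) integrable_on {a..b}"
    by (intro integrable_add assms(2)) auto
  have le: "\<bar>g t\<bar> \<le> 1 + (g t)\<^sup>2" for t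
  proof -
    have "(\<bar>g t\<bar> - 1)\<^sup>2 = (g t)\<^sup>2 - 2 * \<bar>g t\<bar> + 1" by (simp add: power2_diff)
    then show ?thesis using zero_le_power2[of "\<bar>g t\<bar> - 1"] by linarith
  qed
  have gi: "g integrable_on {a..b}" by (rule integrable_on_dominated[OF assms(1) w]) (use le in auto)
  have "integral {a..y} g - integral {a..x} g = integral {x..y} g" if "x \<in> {a..b}" "y \<in> {a..b}" "x \<le> y" for x y
    using Henstock_Kurzweil_Integration.integral_combine[of a x y g] integrable_on_subinterval[OF gi, of a y] that
    by auto
  then show ?thesis unfolding prim_on_def using assms by blast
qed


lemma prim_on_lin:
  assumes S: "S \<in> sets borel" "\<And>a b. a \<in> S \<Longrightarrow> b \<in> S \<Longrightarrow> {a..b} \<subseteq> S"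
    and p: "prim_on S f g" and q: "prim_on S f' g'"
  shows "prim_on S (\<lambda>t. c * f t + d * f' t) (\<lambda>t. c * g t + d * g' t)"
  unfolding prim_on_def
proof (intro conjI ballI impI)
  have m: "g \<in> borel_measurable borel" "g' \<in> borel_measurable borel"
    and i: "(\<lambda>t. (g t)\<^sup>2) integrable_on S" "(\<lambda>t. (g' t)\<^sup>2) integrable_on S"
    using p q by (auto simp: prim_on_def)
  show M: "(\<lambda>t. c * g t + d * g' t) \<in> borel_measurable borel" using m by measurable
  have "(\<lambda>t. 2 * c\<^sup>2 * (g t)\<^sup>2 + 2 * d\<^sup>2 * (g' t)\<^sup>2) integrable_on S"
    by (intro integrable_add integrable_on_mult_right i)
  moreover have "(\<lambda>t. (c * g t + d * g' t)\<^sup>2) \<in> borel_measurable borel" using M by measurable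
  moreover have "\<bar>(c * g t + d * g' t)\<^sup>2\<bar> \<le> 2 * c\<^sup>2 * (g t)\<^sup>2 + 2 * d\<^sup>2 * (g' t)\<^sup>2" for t
  proof -
    have "(x + y)\<^sup>2 \<le> 2 * x\<^sup>2 + 2 * y\<^sup>2" for x y :: real
      using zero_le_power2[of "x - y"] by (simp add: power2_diff power2_sum)
    from this[of "c * g t" "d * g' t"] show ?thesis by (simp add: power_mult_distrib)
  qed
  ultimately show "(\<lambda>t. (c * g t + d * g' t)\<^sup>2) integrable_on S"
    using integrable_on_dominated[OF _ _ S(1)] by blast
  fix a b assume ab: "a \<in> S" "b \<in> S" "a \<le> b"
  have pq: "prim_on {a..b} f g" "prim_on {a..b} f' g'"
    using prim_on_subset[OF p S(2)[OF ab(1,2)]] prim_on_subset[OF q S(2)[OF ab(1,2)]] by auto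
  have "integral {a..b} (\<lambda>t. c * g t + d * g' t) = c * integral {a..b} g + d * integral {a..b} g'"
    using prim_on_abs_integrable(1)[OF pq(1)] prim_on_abs_integrable(1)[OF pq(2)]
    by (simp add: Henstock_Kurzweil_Integration.integral_add integrable_on_mult_right)
  then show "c * f b + d * f' b - (c * f a + d * f' a) = integral {a..b} (\<lambda>t. c * g t + d * g' t)"
    using prim_on_eq[OF p ab] prim_on_eq[OF q ab] by (simp add: algebra_simps)
qed

lemma constant_if_constant_on_Rats:
  fixes d :: "real \<Rightarrow> real"
  assumes "continuous_on {a..b} d" "a < b" "\<And>r. r \<in> \<rat> \<Longrightarrow> a < r \<Longrightarrow> r < b \<Longrightarrow> d r = k" "x \<in> {a..b}"
  shows "d x = k"
proof -
  let ?T = "{x \<in> {a..b}. d x = k}"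
  have "closed ?T" by (rule continuous_closed_preimage_constant[OF assms(1)]) simp
  have "{a<..<b} \<subseteq> closure ({a<..<b} \<inter> \<rat>)"
    using open_Int_closure_subset[of "{a<..<b}" \<rat>] by (simp add: Rats_closure_real)
  also have "\<dots> \<subseteq> ?T" using assms(3) by (intro closure_minimal \<open>closed ?T\<close>) auto
  finally have "closure {a<..<b} \<subseteq> ?T" by (intro closure_minimal \<open>closed ?T\<close>)
  then show ?thesis using assms by auto
qed


lemma lborel_integrable_on:
  fixes w :: "real \<Rightarrow> real"
  assumes "w \<in> borel_measurable borel" "w integrable_on S" "S \<in> sets borel" "\<And>x. x \<in> S \<Longrightarrow> 0 \<le> w x"
  shows "integrable lborel (\<lambda>t. indicator S t * w t)" "(\<integral>t. indicator S t * w t \<partial>lborel) = integral S w"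
proof -
  have m: "(\<lambda>t. indicator S t * w t) \<in> borel_measurable lborel" using assms(1,3) by simp
  have "w absolutely_integrable_on S" by (rule nonnegative_absolutely_integrable_1) (use assms in auto)
  then have "integrable lebesgue (\<lambda>t. indicator S t * w t)" by (simp add: set_integrable_def)
  then show i: "integrable lborel (\<lambda>t. indicator S t * w t)" using integrable_completion[OF m] by simp
  then have "set_integrable lborel S w" by (simp add: set_integrable_def)
  from set_borel_integral_eq_integral(2)[OF this]
  show "(\<integral>t. indicator S t * w t \<partial>lborel) = integral S w" by (simp add: set_lebesgue_integral_def)
qed

lemma holder_continuous_on:
  fixes f :: "real \<Rightarrow> real"
  assumes "\<And>x y. x \<in> T \<Longrightarrow> y \<in> T \<Longrightarrow> x \<le> y \<Longrightarrow> (f y - f x)\<^sup>2 \<le> (y - x) * c"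
  shows "continuous_on T f"
  unfolding continuous_on_iff dist_real_def
proof (intro ballI allI impI)
  fix x e :: real assume x: "x \<in> T" and e: "0 < e"
  show "\<exists>d>0. \<forall>y\<in>T. \<bar>y - x\<bar> < d \<longrightarrow> \<bar>f y - f x\<bar> < e"
  \<comment> \<open>The denominator is positive and exceeds \<open>c\<close>, whatever the sign of
    \<open>c\<close>.\<close>
  proof (intro exI[of _ "e\<^sup>2 / (\<bar>c\<bar> + 1)"] conjI ballI impI)
    fix y assume y: "y \<in> T" "\<bar>y - x\<bar> < e\<^sup>2 / (\<bar>c\<bar> + 1)"
    have "(f y - f x)\<^sup>2 \<le> \<bar>y - x\<bar> * c"
      using assms[OF x y(1)] assms[OF y(1) x] by (cases "x \<le> y") (auto simp: power2_commute)
    also have "\<dots> \<le> \<bar>y - x\<bar> * (\<bar>c\<bar> + 1)" by (intro mult_left_mono) auto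
    also have "\<dots> < e\<^sup>2" using y(2) by (simp add: pos_less_divide_eq)
    finally have "\<bar>f y - f x\<bar>\<^sup>2 < e\<^sup>2" by simp
    then show "\<bar>f y - f x\<bar> < e" by (rule power2_less_imp_less) (use e in simp)
  qed (use e in auto)
qed

text \<open>Weak compactness is replaced by minimising the norm over the convex sets of primitives close to \<open>f\<close>
  at finitely many points; by the parallelogram identity the near-minimisers form a Cauchy sequence.\<close>

lemma prim_on_limit:
  fixes S :: "real set"
  assumes S: "S \<in> sets borel" "\<And>a b. a \<in> S \<Longrightarrow> b \<in> S \<Longrightarrow> {a..b} \<subseteq> S"
    and p: "\<And>n. prim_on S (F n) (G n)"
    and lim: "\<And>x. x \<in> S \<Longrightarrow> (\<lambda>n. F n x) \<longlonglongrightarrow> f x"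
    and c: "\<And>n. integral S (\<lambda>t. (G n t)\<^sup>2) \<le> c"
  obtains g where "prim_on S f g" "integral S (\<lambda>t. (g t)\<^sup>2) \<le> c"
proof -
  define x where "x = from_nat_into (\<rat> :: real set)"
  have xr: "range x = \<rat>" unfolding x_def
    by (intro range_from_nat_into) (auto simp: countable_rat intro: Rats_0)
  \<comment> \<open>\<open>C n\<close> is convex in the pair and decreases with \<open>n\<close>.
    Closeness at finitely many points of a dense sequence replaces agreement with \<open>f\<close>,
    which no \<open>F k\<close> need satisfy, whereas \<open>(F k, G k)\<close> lies in
    \<open>C n\<close> for large \<open>k\<close>.\<close>
  define C where "C n = {(\<phi>, h). prim_on S \<phi> h \<and>
      (\<forall>j<n. x j \<in> S \<longrightarrow> \<bar>\<phi> (x j) - f (x j)\<bar> \<le> 1 / (real n + 1))}" for n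
  define A where "A n = (\<lambda>(\<phi>, h). integral S (\<lambda>t. (h t)\<^sup>2)) ` C n" for n
  define d where "d n = Inf (A n)" for n
  have A0: "0 \<le> a" if "a \<in> A n" for a n
    using that unfolding A_def C_def prim_on_def by (auto intro!: Henstock_Kurzweil_Integration.integral_nonneg)
  have bdd: "bdd_below (A n)" for n using A0 by (meson bdd_belowI)
  have ex: "\<exists>a\<in>A n. a \<le> c" for n
  proof -
    have "\<forall>\<^sub>F k in sequentially. x j \<in> S \<longrightarrow> \<bar>F k (x j) - f (x j)\<bar> \<le> 1 / (real n + 1)" for j
    proof (cases "x j \<in> S")
      case True
      have "\<forall>\<^sub>F k in sequentially. dist (F k (x j)) (f (x j)) < 1 / (real n + 1)"
        by (rule tendstoD[OF lim[OF True]]) simp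
      then show ?thesis by eventually_elim (simp add: dist_real_def)
    qed simp
    then have "\<forall>\<^sub>F k in sequentially. \<forall>j\<in>{..<n}. x j \<in> S \<longrightarrow> \<bar>F k (x j) - f (x j)\<bar> \<le> 1 / (real n + 1)"
      by (intro eventually_ball_finite) auto
    from eventually_happens'[OF sequentially_bot this] obtain k
      where "\<forall>j\<in>{..<n}. x j \<in> S \<longrightarrow> \<bar>F k (x j) - f (x j)\<bar> \<le> 1 / (real n + 1)" by blast
    then have "(F k, G k) \<in> C n" unfolding C_def using p by auto
    then show ?thesis unfolding A_def using c by force
  qed
  have dc: "d n \<le> c" for n
    using ex[of n] cInf_lower[OF _ bdd] unfolding d_def by (meson order_trans)
  have dle: "d n \<le> integral S (\<lambda>t. (h t)\<^sup>2)" if "(\<phi>, h) \<in> C n" for n \<phi> h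
    unfolding d_def using that by (intro cInf_lower bdd) (force simp: A_def)
  have Cmono: "C m \<subseteq> C n" if "n \<le> m" for m n
  proof -
    have "1 / (real m + 1) \<le> 1 / (real n + 1)" using that by (simp add: frac_le)
    then show ?thesis using that by (clarsimp simp: C_def) (meson order_trans order_less_le_trans)
  qed
  have dmono: "d n \<le> d m" if "n \<le> m" for m n
    unfolding d_def
  proof (rule cInf_superset_mono[OF _ bdd])
    show "A m \<noteq> {}" using ex by blast
    show "A m \<subseteq> A n" unfolding A_def using Cmono[OF that] by blast
  qed
  have "incseq d" by (rule incseq_SucI) (simp add: dmono)
  then obtain L where L: "d \<longlonglongrightarrow> L" "\<And>n. d n \<le> L" using incseq_convergent[of d c] dc by blast
  have "\<exists>\<phi> h. (\<phi>, h) \<in> C n \<and> integral S (\<lambda>t. (h t)\<^sup>2) < d n + 1 / (real n + 1)" for n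
  proof -
    have "Inf (A n) < d n + 1 / (real n + 1)" by (simp add: d_def)
    moreover have "A n \<noteq> {}" using ex by blast
    ultimately obtain a where "a \<in> A n" "a < d n + 1 / (real n + 1)" using cInf_lessD by blast
    then show ?thesis unfolding A_def by auto
  qed
  then obtain \<phi> h where ph: "\<And>n. (\<phi> n, h n) \<in> C n"
    "\<And>n. integral S (\<lambda>t. (h n t)\<^sup>2) < d n + 1 / (real n + 1)" by metis
  have ph1: "prim_on S (\<phi> n) (h n)" for n using ph(1)[of n] by (simp add: C_def)
  have hb[measurable]: "h n \<in> borel_measurable borel" for n using ph1[of n] by (simp add: prim_on_def)
  have hi: "(\<lambda>t. (h n t)\<^sup>2) integrable_on S" for n using ph1[of n] by (simp add: prim_on_def)
  have lin: "prim_on S (\<lambda>t. a * \<phi> n t + b * \<phi> m t) (\<lambda>t. a * h n t + b * h m t)" for a b n m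
    by (rule prim_on_lin[OF S ph1 ph1])
  have li: "(\<lambda>t. (a * h n t + b * h m t)\<^sup>2) integrable_on S" for a b n m
    using lin[of a n b m] by (simp add: prim_on_def)
  \<comment> \<open>Parallelogram identity: the midpoint of two members of \<open>C N\<close> is
    again in \<open>C N\<close>, so its squared norm is at least \<open>d N\<close>.\<close>
  have par: "integral S (\<lambda>t. (h n t - h m t)\<^sup>2) \<le> 4 * (L - d N) + 4 / (real N + 1)"
    if "N \<le> n" "N \<le> m" for n m N
  proof -
    have mid: "(\<lambda>t. 1/2 * \<phi> n t + 1/2 * \<phi> m t, \<lambda>t. 1/2 * h n t + 1/2 * h m t) \<in> C N"
    proof -
      have "(\<phi> n, h n) \<in> C N" "(\<phi> m, h m) \<in> C N" using ph(1) Cmono that by blast+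
      then have near: "\<bar>\<phi> n (x j) - f (x j)\<bar> \<le> 1 / (real N + 1)" "\<bar>\<phi> m (x j) - f (x j)\<bar> \<le> 1 / (real N + 1)"
        if "j < N" "x j \<in> S" for j using that by (auto simp: C_def)
      have "\<bar>(1/2 * \<phi> n (x j) + 1/2 * \<phi> m (x j)) - f (x j)\<bar> \<le> 1 / (real N + 1)"
        if "j < N" "x j \<in> S" for j
        using near[OF that] by linarith
      then show ?thesis unfolding C_def using lin[of "1/2" n "1/2" m] by auto
    qed
    have "(\<lambda>t. (h n t - h m t)\<^sup>2) = (\<lambda>t. 2 * (h n t)\<^sup>2 + 2 * (h m t)\<^sup>2 - 4 * (1/2 * h n t + 1/2 * h m t)\<^sup>2)"
      by (auto simp: fun_eq_iff power2_eq_square field_simps)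
    then have "integral S (\<lambda>t. (h n t - h m t)\<^sup>2) = 2 * integral S (\<lambda>t. (h n t)\<^sup>2)
        + 2 * integral S (\<lambda>t. (h m t)\<^sup>2) - 4 * integral S (\<lambda>t. (1/2 * h n t + 1/2 * h m t)\<^sup>2)"
      using hi[of n] hi[of m] li[of "1/2" n "1/2" m]
      by (simp add: Henstock_Kurzweil_Integration.integral_add Henstock_Kurzweil_Integration.integral_diff
          integrable_on_mult_right integrable_add)
    also have "\<dots> \<le> 2 * (d n + 1 / (real n + 1)) + 2 * (d m + 1 / (real m + 1)) - 4 * d N"
      using ph(2)[of n] ph(2)[of m] dle[OF mid] by (intro diff_mono add_mono mult_left_mono) auto
    also have "\<dots> \<le> 4 * (L - d N) + 4 / (real N + 1)"
    proof -
      have le: "1 / (real n + 1) \<le> 1 / (real N + 1)" "1 / (real m + 1) \<le> 1 / (real N + 1)"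
        using that by (auto simp: frac_le)
      have "2 * (dn + x) + 2 * (dm + y) - 4 * dN \<le> 4 * (L - dN) + 4 * w"
        if "x \<le> w" "y \<le> w" "dn \<le> L" "dm \<le> L" for x y w dn dm dN :: real using that by argo
      from this[OF le L(2)[of n] L(2)[of m], of "d N"] show ?thesis by simp
    qed
    finally show ?thesis .
  qed
  \<comment> \<open>Extension by zero turns functions on \<open>S\<close> into functions on the
    line, to which \<open>L2_complete\<close> applies.\<close>
  define Q where "Q n t = indicator S t * h n t" for n t
  have Qb[measurable]: "Q n \<in> borel_measurable borel" for n
    unfolding Q_def using S(1) by measurable
  have Q2: "(Q n t)\<^sup>2 = indicator S t * (h n t)\<^sup>2" "(Q n t - Q m t)\<^sup>2 = indicator S t * (h n t - h m t)\<^sup>2" for n m t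
    unfolding Q_def by (auto simp: indicator_def)
  have Qi: "integrable lborel (\<lambda>t. (Q n t)\<^sup>2)" for n
    unfolding Q2 using lborel_integrable_on(1)[OF _ hi[of n] S(1)] by simp
  have Qd: "(\<integral>t. (Q m t - Q n t)\<^sup>2 \<partial>lborel) = integral S (\<lambda>t. (h m t - h n t)\<^sup>2)" for m n
    unfolding Q2 using li[of 1 m "-1" n] S(1) by (intro lborel_integrable_on(2)) auto
  have "\<exists>N. \<forall>m\<ge>N. \<forall>n\<ge>N. (\<integral>t. (Q m t - Q n t)\<^sup>2 \<partial>lborel) < e" if e: "0 < e" for e
  proof -
    have "(\<lambda>N. 4 * (L - d N) + 4 * inverse (real N + 1)) \<longlonglongrightarrow> 4 * (L - L) + 4 * 0"
      by (intro tendsto_intros L(1)) (use LIMSEQ_inverse_real_of_nat in \<open>simp add: add.commute\<close>)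
    then have "\<forall>\<^sub>F N in sequentially. 4 * (L - d N) + 4 * inverse (real N + 1) < e"
      by (rule order_tendstoD(2)) (use e in simp)
    from eventually_happens'[OF sequentially_bot this]
    obtain N where "4 * (L - d N) + 4 * inverse (real N + 1) < e" by blast
    then show ?thesis unfolding Qd using par[of N]
      by (intro exI[of _ N] allI impI) (meson le_less_trans divide_inverse[THEN eq_refl] order_trans add_left_mono)
  qed
  from L2_complete[OF Qb Qi this] obtain H where Hb[measurable]: "H \<in> borel_measurable borel"
    and Hi: "integrable lborel (\<lambda>t. (H t)\<^sup>2)" and QHi: "\<And>n. integrable lborel (\<lambda>t. (Q n t - H t)\<^sup>2)"
    and QH: "(\<lambda>n. \<integral>t. (Q n t - H t)\<^sup>2 \<partial>lborel) \<longlonglongrightarrow> 0" by blast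
  have HS: "(\<lambda>t. (H t)\<^sup>2) integrable_on T" if "T \<in> sets borel" for T
    by (rule integrable_on_subset_nonneg[OF integrable_on_lborel[OF Hi]]) (use that in auto)
  have hHi: "(\<lambda>t. (h n t - H t)\<^sup>2) integrable_on T"
    and hHle: "integral T (\<lambda>t. (h n t - H t)\<^sup>2) \<le> (\<integral>t. (Q n t - H t)\<^sup>2 \<partial>lborel)"
    if T: "T \<in> sets borel" "T \<subseteq> S" for T n
  proof -
    have 1: "(\<lambda>t. (Q n t - H t)\<^sup>2) integrable_on UNIV" by (rule integrable_on_lborel[OF QHi])
    have 2: "(\<lambda>t. (Q n t - H t)\<^sup>2) integrable_on T"
      by (rule integrable_on_subset_nonneg[OF 1]) (use T in auto)
    have 3: "(h n t - H t)\<^sup>2 = (Q n t - H t)\<^sup>2" if "t \<in> T" for t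
      using that T(2) by (auto simp: Q_def indicator_def)
    show "(\<lambda>t. (h n t - H t)\<^sup>2) integrable_on T"
      by (rule integrable_eq[OF 2]) (simp add: 3)
    have "integral T (\<lambda>t. (h n t - H t)\<^sup>2) = integral T (\<lambda>t. (Q n t - H t)\<^sup>2)"
      by (rule Henstock_Kurzweil_Integration.integral_cong) (simp add: 3)
    also have "\<dots> \<le> integral UNIV (\<lambda>t. (Q n t - H t)\<^sup>2)"
      by (rule integral_subset_le) (use 1 2 in auto)
    also have "\<dots> = (\<integral>t. (Q n t - H t)\<^sup>2 \<partial>lborel)" by (rule integral_lborel[OF QHi])
    finally show "integral T (\<lambda>t. (h n t - H t)\<^sup>2) \<le> (\<integral>t. (Q n t - H t)\<^sup>2 \<partial>lborel)" .
  qed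
  \<comment> \<open>The Hoelder bound survives the pointwise limit, so \<open>f\<close> is
    continuous before it is known to be a primitive; this extends the identity from rational end
    points to all.\<close>
  have fh: "(f t - f s)\<^sup>2 \<le> (t - s) * c" if st: "s \<in> S" "t \<in> S" "s \<le> t" for s t
  proof (rule LIMSEQ_le_const2)
    show "(\<lambda>n. (F n t - F n s)\<^sup>2) \<longlonglongrightarrow> (f t - f s)\<^sup>2" by (intro tendsto_intros lim st)
    have "(F n t - F n s)\<^sup>2 \<le> (t - s) * c" for n
    proof -
      have sub: "{s..t} \<subseteq> S" by (rule S(2)[OF st(1,2)])
      have pst: "prim_on {s..t} (F n) (G n)" by (rule prim_on_subset[OF p sub]) simp
      have "(F n t - F n s)\<^sup>2 \<le> (t - s) * integral {s..t} (\<lambda>t. (G n t)\<^sup>2)"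
        by (rule prim_on_holder[OF pst st(3)])
      also have "\<dots> \<le> (t - s) * c"
      proof (intro mult_left_mono)
        have "integral {s..t} (\<lambda>t. (G n t)\<^sup>2) \<le> integral S (\<lambda>t. (G n t)\<^sup>2)"
          by (rule integral_subset_le[OF sub]) (use p[of n] pst in \<open>auto simp: prim_on_def\<close>)
        then show "integral {s..t} (\<lambda>t. (G n t)\<^sup>2) \<le> c" using c[of n] by simp
      qed (use st in simp)
      finally show ?thesis .
    qed
    then show "\<exists>N. \<forall>n\<ge>N. (F n t - F n s)\<^sup>2 \<le> (t - s) * c" by blast
  qed
  have phl: "(\<lambda>n. \<phi> n r) \<longlonglongrightarrow> f r" if r: "r \<in> \<rat>" "r \<in> S" for r
  proof -
    obtain j where j: "r = x j" using r(1) xr by (metis imageE)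
    have "(\<lambda>n. \<phi> n r - f r) \<longlonglongrightarrow> 0"
    proof (rule Lim_null_comparison)
      show "\<forall>\<^sub>F n in sequentially. norm (\<phi> n r - f r) \<le> inverse (real n + 1)"
        using eventually_gt_at_top[of j]
        by eventually_elim (use ph(1) r j in \<open>auto simp: C_def inverse_eq_divide\<close>)
      show "(\<lambda>n. inverse (real n + 1)) \<longlonglongrightarrow> 0"
        using LIMSEQ_inverse_real_of_nat by (simp add: add.commute)
    qed
    then show ?thesis by (simp add: LIM_zero_iff)
  qed
  have rat: "f s - f r = integral {r..s} H" if rs: "r \<in> \<rat>" "r \<in> S" "s \<in> \<rat>" "s \<in> S" "r \<le> s" for r s
  proof -
    have sub: "{r..s} \<subseteq> S" by (rule S(2)[OF rs(2,4)])
    define E where "E n = integral {r..s} (\<lambda>t. h n t - H t)" for n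
    have pE: "prim_on {r..s} (\<lambda>x. integral {r..x} (\<lambda>t. h n t - H t)) (\<lambda>t. h n t - H t)" for n
      by (rule prim_on_integral) (use hHi[OF _ sub] in auto)
    have pH: "prim_on {r..s} (\<lambda>x. integral {r..x} H) H"
      by (rule prim_on_integral) (use HS in auto)
    have Eeq: "E n = \<phi> n s - \<phi> n r - integral {r..s} H" for n
    proof -
      have "prim_on {r..s} (\<phi> n) (h n)" by (rule prim_on_subset[OF ph1 sub]) simp
      then have "E n = integral {r..s} (h n) - integral {r..s} H" unfolding E_def
        using prim_on_abs_integrable(1)[OF pH] prim_on_abs_integrable(1)
        by (intro Henstock_Kurzweil_Integration.integral_diff) auto
      then show ?thesis using prim_on_eq[OF ph1[of n] rs(2,4,5)] by simp
    qed
    have "(\<lambda>n. (E n)\<^sup>2) \<longlonglongrightarrow> 0"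
    proof (rule Lim_null_comparison)
      show "(\<lambda>n. (s - r) * (\<integral>t. (Q n t - H t)\<^sup>2 \<partial>lborel)) \<longlonglongrightarrow> 0"
        using tendsto_mult_left[OF QH, of "s - r"] by simp
      have "(E n)\<^sup>2 \<le> (s - r) * (\<integral>t. (Q n t - H t)\<^sup>2 \<partial>lborel)" for n
      proof -
        have "(E n)\<^sup>2 \<le> (s - r) * integral {r..s} (\<lambda>t. (h n t - H t)\<^sup>2)"
          using prim_on_holder[OF pE[of n] rs(5)] by (simp add: E_def)
        also have "\<dots> \<le> (s - r) * (\<integral>t. (Q n t - H t)\<^sup>2 \<partial>lborel)"
          using rs hHle[OF _ sub, of n] by (intro mult_left_mono) auto
        finally show ?thesis .
      qed
      then show "\<forall>\<^sub>F n in sequentially. norm ((E n)\<^sup>2) \<le> (s - r) * (\<integral>t. (Q n t - H t)\<^sup>2 \<partial>lborel)"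
        by simp
    qed
    from tendsto_real_sqrt[OF this] have "E \<longlonglongrightarrow> 0" by (simp add: tendsto_rabs_zero_iff)
    moreover have "E \<longlonglongrightarrow> f s - f r - integral {r..s} H"
      unfolding Eeq[abs_def] by (intro tendsto_intros phl rs)
    ultimately show ?thesis using LIMSEQ_unique by fastforce
  qed
  have prim: "prim_on S f H"
    unfolding prim_on_def
  proof (intro conjI ballI impI)
    fix a b assume ab: "a \<in> S" "b \<in> S" "a \<le> b"
    show "f b - f a = integral {a..b} H"
    proof (cases "a = b")
      case False
      then have ab': "a < b" using ab by simp
      have sub: "{a..b} \<subseteq> S" by (rule S(2)[OF ab(1,2)])
      have pH: "prim_on {a..b} (\<lambda>x. integral {a..x} H) H"
        by (rule prim_on_integral) (use HS in auto)
      let ?d = "\<lambda>x. f x - integral {a..x} H"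
      have "continuous_on {a..b} f" by (rule holder_continuous_on[of _ _ c]) (use sub in \<open>auto intro!: fh\<close>)
      then have dc: "continuous_on {a..b} ?d"
        by (intro continuous_intros prim_on_continuous_interval[OF pH])
      obtain r0 where r0: "r0 \<in> \<rat>" "a < r0" "r0 < b" using Rats_dense_in_real[OF ab'] by auto
      have le: "?d r = ?d s" if "r \<in> \<rat>" "s \<in> \<rat>" "a < r" "r \<le> s" "s < b" for r s
      proof -
        have "r \<in> {a..b}" "s \<in> {a..b}" "r \<in> S" "s \<in> S" using that sub by auto
        then show ?thesis using rat[of r s] prim_on_eq[OF pH, of r s] that by simp
      qed
      have "?d r = ?d r0" if "r \<in> \<rat>" "a < r" "r < b" for r
        
      proof (cases "r \<le> r0")
        case True
        show ?thesis by (rule le) (use that r0 True in auto)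
      next
        case False
        show ?thesis by (rule le[symmetric]) (use that r0 False in auto)
      qed
      then have "?d y = ?d r0" if "y \<in> {a..b}" for y
        using constant_if_constant_on_Rats[OF dc ab' _ that] by blast
      from this[of a] this[of b] show ?thesis using ab' by simp
    qed simp
  qed (use HS[OF S(1)] in auto)
  have "integral S (\<lambda>t. (H t)\<^sup>2) \<le> c + e" if e: "0 < e" for e
  proof -
    have c0: "0 \<le> c" using ex[of 0] A0 by fastforce
    \<comment> \<open>The parameter of Young's inequality in \<open>pw\<close>: the bound
      \<open>c\<close> is spoiled by at most \<open>u * c \<le> e\<close>, while the large factor
      \<open>1 + 1/u\<close> meets a norm that tends to zero.\<close>
    define u where "u = e / (c + 1)"
    have u: "0 < u" "u * c \<le> e" using e c0 by (auto simp: u_def field_simps)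
    have le: "integral S (\<lambda>t. (H t)\<^sup>2) \<le> (1 + u) * c + (1 + u) * inverse (real n + 1) + (1 + 1/u) * (\<integral>t. (Q n t - H t)\<^sup>2 \<partial>lborel)" for n
    proof -
      have pw: "y\<^sup>2 \<le> (1 + u) * x\<^sup>2 + (1 + 1/u) * (x - y)\<^sup>2" for x y
      proof -
        have "0 \<le> (u * x - (y - x))\<^sup>2 / u" using u by simp
        also have "\<dots> = u * x\<^sup>2 - 2 * x * (y - x) + (y - x)\<^sup>2 / u"
          using u by (simp add: field_simps power2_eq_square)
        finally have "0 \<le> u * x\<^sup>2 - 2 * x * (y - x) + (y - x)\<^sup>2 / u" .
        moreover define Z where "Z = (y - x)\<^sup>2 / u"
        have "(1 + 1/u) * (x - y)\<^sup>2 = (x - y)\<^sup>2 + Z"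
          by (simp add: Z_def distrib_right power2_commute)
        ultimately show ?thesis
          unfolding Z_def[symmetric] by (simp add: algebra_simps power2_eq_square)
      qed
      have i2: "(\<lambda>t. (h n t - H t)\<^sup>2) integrable_on S" by (rule hHi[OF S(1)]) simp
      have "integral S (\<lambda>t. (H t)\<^sup>2) \<le> integral S (\<lambda>t. (1 + u) * (h n t)\<^sup>2 + (1 + 1/u) * (h n t - H t)\<^sup>2)"
        by (intro integral_le HS S(1) integrable_add integrable_on_mult_right hi i2 pw)
      also have "\<dots> = (1 + u) * integral S (\<lambda>t. (h n t)\<^sup>2) + (1 + 1/u) * integral S (\<lambda>t. (h n t - H t)\<^sup>2)"
        using hi[of n] i2 by (simp add: Henstock_Kurzweil_Integration.integral_add integrable_on_mult_right)
      also have "\<dots> \<le> (1 + u) * (c + inverse (real n + 1)) + (1 + 1/u) * (\<integral>t. (Q n t - H t)\<^sup>2 \<partial>lborel)"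
      proof (intro add_mono mult_left_mono)
        show "integral S (\<lambda>t. (h n t)\<^sup>2) \<le> c + inverse (real n + 1)"
          using ph(2)[of n] dc[of n] by (simp add: inverse_eq_divide)
      qed (use u hHle[OF S(1), of n] in auto)
      finally show ?thesis by (simp add: algebra_simps)
    qed
    have "(\<lambda>n. (1 + u) * c + (1 + u) * inverse (real n + 1) + (1 + 1/u) * (\<integral>t. (Q n t - H t)\<^sup>2 \<partial>lborel))
        \<longlonglongrightarrow> (1 + u) * c + (1 + u) * 0 + (1 + 1/u) * 0"
      by (intro tendsto_intros QH) (use LIMSEQ_inverse_real_of_nat in \<open>simp add: add.commute\<close>)
    then have "integral S (\<lambda>t. (H t)\<^sup>2) \<le> (1 + u) * c + (1 + u) * 0 + (1 + 1/u) * 0"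
      by (rule LIMSEQ_le_const) (use le in blast)
    also have "\<dots> \<le> c + e" using u by (simp add: algebra_simps)
    finally show ?thesis .
  qed
  then have "integral S (\<lambda>t. (H t)\<^sup>2) \<le> c" by (rule field_le_epsilon)
  with prim show thesis by (rule that)
qed

section \<open>Weak derivatives\<close>

text \<open>On a short interval both factors are nearly constant, so the formula fails there by at
  most \<open>e\<close> times the increment of \<open>W\<close>, for either sign;
  \<open>subdivision_le\<close> removes the error.\<close>

lemma integral_by_parts_primitive:
  fixes f g \<phi> \<phi>' :: "real \<Rightarrow> real"
  assumes ab: "a \<le> b"
    and g: "g integrable_on {a..b}" "(\<lambda>x. \<bar>g x\<bar>) integrable_on {a..b}" "(\<lambda>x. g x * \<phi> x) integrable_on {a..b}"
    and f: "\<And>s t. a \<le> s \<Longrightarrow> s \<le> t \<Longrightarrow> t \<le> b \<Longrightarrow> f t - f s = integral {s..t} g"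
    and fc: "continuous_on {a..b} f"
    and \<phi>: "\<And>x. (\<phi> has_real_derivative \<phi>' x) (at x)" "continuous_on UNIV \<phi>'"
  shows "f b * \<phi> b - f a * \<phi> a = integral {a..b} (\<lambda>x. f x * \<phi>' x + g x * \<phi> x)"
proof -
  let ?q = "\<lambda>x. f x * \<phi>' x + g x * \<phi> x"
  have \<phi>c: "continuous_on {a..b} \<phi>" using \<phi>(1) by (meson DERIV_continuous_on has_field_derivative_at_within)
  have \<phi>'c: "continuous_on {a..b} \<phi>'" by (rule continuous_on_subset[OF \<phi>(2)]) simp
  have qi: "?q integrable_on {a..b}"
    by (intro integrable_add g(3) integrable_continuous_real continuous_intros fc \<phi>'c)
  have wi: "(\<lambda>x. \<bar>g x\<bar> + \<bar>\<phi>' x\<bar>) integrable_on {a..b}"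
    by (intro integrable_add g(2) integrable_continuous_real continuous_intros \<phi>'c)
  have main: "sg * (f b * \<phi> b - f a * \<phi> a - integral {a..b} ?q) \<le> 0" if sg: "\<bar>sg\<bar> = 1" for sg
  proof -
    define H where "H x = sg * (f x * \<phi> x - integral {a..x} ?q)" for x
    define W where "W x = integral {a..x} (\<lambda>x. \<bar>g x\<bar> + \<bar>\<phi>' x\<bar>)" for x
    have "H b \<le> H a"
    proof (rule subdivision_le[OF ab, where W = W])
      fix e :: real assume e: "0 < e"
      have "uniformly_continuous_on {a..b} \<phi>" by (rule compact_uniformly_continuous[OF \<phi>c]) simp
      then obtain d1 where d1: "0 < d1" "\<And>x y. x \<in> {a..b} \<Longrightarrow> y \<in> {a..b} \<Longrightarrow> \<bar>x - y\<bar> < d1 \<Longrightarrow> \<bar>\<phi> x - \<phi> y\<bar> < e"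
        unfolding uniformly_continuous_on_def dist_real_def using e by metis
      have "uniformly_continuous_on {a..b} f" by (rule compact_uniformly_continuous[OF fc]) simp
      then obtain d2 where d2: "0 < d2" "\<And>x y. x \<in> {a..b} \<Longrightarrow> y \<in> {a..b} \<Longrightarrow> \<bar>x - y\<bar> < d2 \<Longrightarrow> \<bar>f x - f y\<bar> < e"
        unfolding uniformly_continuous_on_def dist_real_def using e by metis
      show "\<exists>d>0. \<forall>s t. a \<le> s \<longrightarrow> s \<le> t \<longrightarrow> t \<le> b \<longrightarrow> t - s < d \<longrightarrow> H t - H s \<le> e * (W t - W s)"
      proof (intro exI[of _ "min d1 d2"] conjI allI impI)
        fix s t assume st: "a \<le> s" "s \<le> t" "t \<le> b" "t - s < min d1 d2"
        have sub: "{s..t} \<subseteq> {a..b}" using st by auto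
        have qs: "?q integrable_on {s..t}" by (rule integrable_on_subinterval[OF qi sub])
        have ws: "(\<lambda>x. \<bar>g x\<bar> + \<bar>\<phi>' x\<bar>) integrable_on {s..t}" by (rule integrable_on_subinterval[OF wi sub])
        have gh: "(g has_integral (f t - f s)) {s..t}"
          using integrable_on_subinterval[OF g(1) sub] f[OF st(1-3)] by (simp add: has_integral_iff)
        have ph: "(\<phi>' has_integral (\<phi> t - \<phi> s)) {s..t}"
          by (rule fundamental_theorem_of_calculus[OF st(2)])
            (use \<phi>(1) in \<open>auto simp: has_real_derivative_iff_has_vector_derivative[symmetric] intro: has_field_derivative_at_within\<close>)
        define D where "D = f t * \<phi> t - f s * \<phi> s - integral {s..t} ?q"
        \<comment> \<open>With one factor frozen at the right end and the other at the left end, the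
          difference of products is exact.\<close>
        have "((\<lambda>x. g x * \<phi> t + \<phi>' x * f s - ?q x) has_integral
            ((f t - f s) * \<phi> t + (\<phi> t - \<phi> s) * f s - integral {s..t} ?q)) {s..t}"
          by (intro has_integral_diff has_integral_add has_integral_mult_left gh ph integrable_integral qs)
        moreover have "(f t - f s) * \<phi> t + (\<phi> t - \<phi> s) * f s - integral {s..t} ?q = D"
          by (simp add: D_def algebra_simps)
        ultimately have Dh: "((\<lambda>x. g x * \<phi> t + \<phi>' x * f s - ?q x) has_integral D) {s..t}" by simp
        have "norm (integral {s..t} (\<lambda>x. g x * \<phi> t + \<phi>' x * f s - ?q x))
            \<le> integral {s..t} (\<lambda>x. e * (\<bar>g x\<bar> + \<bar>\<phi>' x\<bar>))"
        proof (rule integral_norm_bound_integral)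
          show "(\<lambda>x. g x * \<phi> t + \<phi>' x * f s - ?q x) integrable_on {s..t}" using Dh by blast
          show "(\<lambda>x. e * (\<bar>g x\<bar> + \<bar>\<phi>' x\<bar>)) integrable_on {s..t}" by (intro integrable_on_mult_right ws)
          fix x assume x: "x \<in> {s..t}"
          have "\<bar>\<phi> t - \<phi> x\<bar> < e" by (rule d1(2)) (use x st in auto)
          moreover have "\<bar>f s - f x\<bar> < e" by (rule d2(2)) (use x st in auto)
          ultimately have "\<bar>g x\<bar> * \<bar>\<phi> t - \<phi> x\<bar> + \<bar>\<phi>' x\<bar> * \<bar>f s - f x\<bar> \<le> \<bar>g x\<bar> * e + \<bar>\<phi>' x\<bar> * e"
            by (intro add_mono mult_left_mono) auto
          moreover have "g x * \<phi> t + \<phi>' x * f s - ?q x = g x * (\<phi> t - \<phi> x) + \<phi>' x * (f s - f x)"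
            by (simp add: algebra_simps)
          moreover have "\<bar>g x * (\<phi> t - \<phi> x) + \<phi>' x * (f s - f x)\<bar> \<le> \<bar>g x\<bar> * \<bar>\<phi> t - \<phi> x\<bar> + \<bar>\<phi>' x\<bar> * \<bar>f s - f x\<bar>"
            using abs_triangle_ineq[of "g x * (\<phi> t - \<phi> x)" "\<phi>' x * (f s - f x)"] by (simp add: abs_mult)
          ultimately show "norm (g x * \<phi> t + \<phi>' x * f s - ?q x) \<le> e * (\<bar>g x\<bar> + \<bar>\<phi>' x\<bar>)"
            by (simp add: algebra_simps)
        qed
        then have "\<bar>D\<bar> \<le> e * integral {s..t} (\<lambda>x. \<bar>g x\<bar> + \<bar>\<phi>' x\<bar>)"
          using integral_unique[OF Dh] by simp
        moreover have "sg * D \<le> \<bar>D\<bar>" using sg abs_ge_self[of "sg * D"] by (simp add: abs_mult)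
        moreover have "integral {a..t} ?q = integral {a..s} ?q + integral {s..t} ?q"
          by (rule Henstock_Kurzweil_Integration.integral_combine[symmetric])
            (use st integrable_on_subinterval[OF qi, of a t] in auto)
        then have "H t - H s = sg * D" unfolding H_def D_def by (simp add: algebra_simps)
        moreover have "W t = W s + integral {s..t} (\<lambda>x. \<bar>g x\<bar> + \<bar>\<phi>' x\<bar>)"
          unfolding W_def by (rule Henstock_Kurzweil_Integration.integral_combine[symmetric])
            (use st integrable_on_subinterval[OF wi, of a t] in auto)
        ultimately show "H t - H s \<le> e * (W t - W s)" by simp
      qed (use d1 d2 in simp)
    qed
    then show ?thesis by (simp add: H_def right_diff_distrib)
  qed
  have "X = 0" if "\<And>sg. \<bar>sg\<bar> = 1 \<Longrightarrow> sg * X \<le> 0" for X :: real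
    using that[of 1] that[of "- 1"] by simp
  from this[OF main] show ?thesis by simp
qed

text \<open>The sets over which the integral vanishes are closed under disjoint countable unions
  and, as the total integral vanishes, under complements; intervals generate the Borel sets.\<close>

lemma AE_zero_if_interval_integrals_zero:
  fixes h :: "real \<Rightarrow> real"
  assumes h: "integrable lborel h" and 0: "(\<integral>t. h t \<partial>lborel) = 0"
    and int: "\<And>c d. c \<le> d \<Longrightarrow> (LINT t:{c..d}|lborel. h t) = 0"
  shows "AE t in lborel. h t = 0"
proof (rule density_unique_real[OF h, of "\<lambda>_. 0"])
  show "integrable lborel (\<lambda>_. 0 :: real)" by simp
  have si: "set_integrable lborel A h" if "A \<in> sets borel" for A
    using h that unfolding set_integrable_def by (intro integrable_mult_indicator) auto
  fix A :: "real set" assume "A \<in> sets lborel"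
  then have "A \<in> sets borel" by simp
  then have "(LINT t:A|lborel. h t) = 0"
  proof (induction A rule: borel_set_induct)
    case (compl A)
    have "(LINT t:A \<union> -A|lborel. h t) = (LINT t:A|lborel. h t) + (LINT t:-A|lborel. h t)"
      by (rule set_integral_Un) (use compl si in auto)
    then show ?case using compl 0 by (simp add: set_lebesgue_integral_def)
  next
    case (union A)
    have "(LINT t:(\<Union>i. A i)|lborel. h t) = (\<Sum>i. LINT t:A i|lborel. h t)"
      by (rule lebesgue_integral_countable_add) (use union si in \<open>auto simp: disjoint_family_on_def\<close>)
    then show ?case using union by simp
  qed (use int in \<open>auto simp: set_lebesgue_integral_def\<close>)
  then show "(LINT t:A|lborel. h t) = (LINT t:A|lborel. 0)" by (simp add: set_lebesgue_integral_def)
qed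

text \<open>A quadratic spline that rises from 0 to 1 on the unit interval; \<open>ramp'\<close> is
  the hat function of height 2. As test functions are only asked to be continuously differentiable,
  this can serve as a cut-off.\<close>

definition ramp :: "real \<Rightarrow> real" where
  "ramp x = 2 * ((max 0 x)\<^sup>2 - 2 * (max 0 (x - 1/2))\<^sup>2 + (max 0 (x - 1))\<^sup>2)"

definition ramp' :: "real \<Rightarrow> real" where
  "ramp' x = 4 * (max 0 x - 2 * max 0 (x - 1/2) + max 0 (x - 1))"

lemma DERIV_max_square: "((\<lambda>x. (max 0 x)\<^sup>2) has_real_derivative 2 * max 0 x) (at x)" for x :: real
proof -
  consider "x < 0" | "x = 0" | "0 < x" by linarith
  then show ?thesis
  proof cases
    case 1
    have "((\<lambda>x. 0 :: real) has_real_derivative 2 * max 0 x) (at x)" using 1 by simp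
    then show ?thesis
      by (rule has_field_derivative_transform_within_open[of _ _ _ "{..<0}"]) (use 1 in auto)
  next
    case 2
    have lim: "((\<lambda>h::real. max 0 h) \<longlongrightarrow> max 0 0) (at 0)" by (intro tendsto_intros)
    have eq: "((max 0 (0 + h))\<^sup>2 - (max 0 0)\<^sup>2) / h = max 0 h" for h :: real
      by (auto simp: max_def power2_eq_square)
    show ?thesis using 2 lim unfolding DERIV_def 2 eq by simp
  next
    case 3
    have "((\<lambda>x. x\<^sup>2) has_real_derivative 2 * max 0 x) (at x)"
      using 3 by (auto intro!: derivative_eq_intros)
    then show ?thesis
      by (rule has_field_derivative_transform_within_open[of _ _ _ "{0<..}"]) (use 3 in auto)
  qed
qed

lemma DERIV_ramp: "(ramp has_real_derivative ramp' x) (at x)"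
proof -
  have "((\<lambda>x. (max 0 (x - c))\<^sup>2) has_real_derivative 2 * max 0 (x - c)) (at x)" for c
  proof -
    have "((\<lambda>x. x - c) has_real_derivative 1) (at x)" by (auto intro!: derivative_eq_intros)
    from DERIV_chain2[OF DERIV_max_square this] show ?thesis by simp
  qed
  note d = this[of 0] this[of "1/2"] this[of 1]
  show ?thesis unfolding ramp_def[abs_def] ramp'_def
    using DERIV_cmult[OF DERIV_add[OF DERIV_diff[OF d(1) DERIV_cmult[OF d(2), of 2]] d(3)], of 2] by simp
qed

lemma ramp_simps: "x \<le> 0 \<Longrightarrow> ramp x = 0" "1 \<le> x \<Longrightarrow> ramp x = 1"
  "x \<le> 0 \<Longrightarrow> ramp' x = 0" "1 \<le> x \<Longrightarrow> ramp' x = 0" "0 \<le> ramp' x"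
  by (auto simp: ramp_def ramp'_def max_def power2_eq_square algebra_simps)

lemma continuous_ramp': "continuous_on UNIV ramp'"
  unfolding ramp'_def[abs_def] by (intro continuous_intros)


text \<open>Weak derivatives live on the interior \<open>I\<close>, continuity on the closed edge
  \<open>S\<close>; the two differ by finitely many points, which integrals do not see.\<close>

definition edge_domain :: "real set \<Rightarrow> real set \<Rightarrow> bool" where
  "edge_domain I S \<longleftrightarrow> (\<exists>l>0. I = {0<..<l} \<and> S = {0..l}) \<or> (I = {0<..} \<and> S = {0..})"

lemma edge_domainD:
  assumes "edge_domain I S"
  shows "open I" "closed S" "I \<subseteq> S" "S \<in> sets borel" "I \<in> sets borel" "finite (S - I)"
    "\<And>a b. a \<in> I \<Longrightarrow> b \<in> I \<Longrightarrow> {a..b} \<subseteq> I" "\<And>a b. a \<in> S \<Longrightarrow> b \<in> S \<Longrightarrow> {a..b} \<subseteq> S"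
    "\<And>a b. a \<in> S \<Longrightarrow> b \<in> S \<Longrightarrow> {a<..<b} \<subseteq> I"
proof -
  consider l where "0 < l" "I = {0<..<l}" "S = {0..l}" | "I = {0<..}" "S = {0..}"
    using assms unfolding edge_domain_def by blast
  note c = this
  show "open I" using c by cases auto
  show "closed S" using c by cases auto
  show "I \<subseteq> S" using c by cases auto
  show "S \<in> sets borel" using c by cases auto
  show "I \<in> sets borel" using c by cases auto
  show "finite (S - I)"
  proof (rule finite_subset)
    show "S - I \<subseteq> {0, Sup S}" using c by cases auto
  qed simp
  show "\<And>a b. a \<in> I \<Longrightarrow> b \<in> I \<Longrightarrow> {a..b} \<subseteq> I" using c by cases auto
  show "\<And>a b. a \<in> S \<Longrightarrow> b \<in> S \<Longrightarrow> {a..b} \<subseteq> S" using c by cases auto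
  show "\<And>a b. a \<in> S \<Longrightarrow> b \<in> S \<Longrightarrow> {a<..<b} \<subseteq> I" using c by cases auto
qed

lemma edge_domain_compact_subset:
  assumes "edge_domain I S" "compact K" "K \<subseteq> I"
  obtains a b where "a \<in> I" "b \<in> I" "a < b" "K \<subseteq> {a<..<b}"
proof -
  note D = edge_domainD[OF assms(1)]
  obtain z where z: "z \<in> I"
  proof -
    consider l where "0 < l" "I = {0<..<l}" | "I = {0<..}"
      using assms(1) unfolding edge_domain_def by blast
    then show ?thesis
    proof cases
      case (1 l)
      then show ?thesis using that[of "l / 2"] by auto
    next
      case 2
      then show ?thesis using that[of 1] by auto
    qed
  qed
  obtain y where y: "y \<in> I" "z < y"
  proof -
    obtain e where "0 < e" "ball z e \<subseteq> I" using D(1) z openE by blast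
    then have "z + e / 2 \<in> I" by (auto simp: dist_real_def subset_iff)
    then show ?thesis using that[of "z + e / 2"] \<open>0 < e\<close> by simp
  qed
  define K' where "K' = insert z (insert y K)"
  have K': "compact K'" "K' \<noteq> {}" "K' \<subseteq> I" using assms z y by (auto simp: K'_def)
  obtain a where a: "a \<in> K'" "\<And>t. t \<in> K' \<Longrightarrow> a \<le> t" using compact_attains_inf[OF K'(1,2)] by blast
  obtain b where b: "b \<in> K'" "\<And>t. t \<in> K' \<Longrightarrow> t \<le> b" using compact_attains_sup[OF K'(1,2)] by blast
  have "a \<in> I" "b \<in> I" using a(1) b(1) K'(3) by auto
  then obtain d e where d: "0 < d" "ball a d \<subseteq> I" and e: "0 < e" "ball b e \<subseteq> I"
    using D(1) openE by meson
  show thesis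
  proof (rule that)
    show "a - d / 2 \<in> I" "b + e / 2 \<in> I" using d e by (auto simp: dist_real_def subset_iff)
    show "a - d / 2 < b + e / 2" using a(2)[of z] b(2)[of y] y d e by (auto simp: K'_def)
    show "K \<subseteq> {a - d / 2<..<b + e / 2}"
    proof
      fix t assume "t \<in> K"
      then have "a \<le> t" "t \<le> b" using a(2) b(2) by (auto simp: K'_def)
      then show "t \<in> {a - d / 2<..<b + e / 2}" using d e by auto
    qed
  qed
qed

lemma edge_domain_exhaustion:
  assumes "edge_domain I S"
  obtains a b :: "nat \<Rightarrow> real" where "\<And>n. {a n..b n} \<subseteq> I" "\<And>t. t \<in> I \<Longrightarrow> \<forall>\<^sub>F n in sequentially. t \<in> {a n..b n}"
proof -
  define u where "u n = inverse (real (Suc n))" for n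
  have inv: "u \<longlonglongrightarrow> 0" unfolding u_def by (rule LIMSEQ_inverse_real_of_nat)
  have u: "0 < u n" for n by (simp add: u_def)
  consider l where "0 < l" "I = {0<..<l}" | "I = {0<..}"
    using assms unfolding edge_domain_def by blast
  then show thesis
  proof cases
    case 1
    show thesis
    proof (rule that)
      show "{u n..l - u n} \<subseteq> I" for n
        unfolding 1(2) using u[of n] by (auto simp del: atLeastatMost_subset_iff)
      fix t assume t: "t \<in> I"
      have "\<forall>\<^sub>F n in sequentially. u n < min t (l - t)"
        by (rule order_tendstoD(2)[OF inv]) (use t 1 in auto)
      then show "\<forall>\<^sub>F n in sequentially. t \<in> {u n..l - u n}"
        by eventually_elim auto
    qed
  next
    case 2
    show thesis
    proof (rule that)
      show "{u n..real n} \<subseteq> I" for n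
        unfolding 2 using u[of n] by auto
      fix t assume t: "t \<in> I"
      have "\<forall>\<^sub>F n in sequentially. u n < t"
        by (rule order_tendstoD(2)[OF inv]) (use t 2 in auto)
      moreover have "\<forall>\<^sub>F n in sequentially. t \<le> real n"
        by (rule eventually_sequentiallyI[of "nat \<lceil>t\<rceil>"]) linarith
      ultimately show "\<forall>\<^sub>F n in sequentially. t \<in> {u n..real n}"
        by eventually_elim auto
    qed
  qed
qed

text \<open>Local integrability gives measurability on compact pieces only; the cut-off functions
  along an exhaustion converge pointwise.\<close>

lemma weak_deriv_measurable:
  assumes "edge_domain I S" "locally_integrable_on g I"
  shows "(\<lambda>t. indicator I t * g t) \<in> borel_measurable borel"
proof -
  obtain a b where ab: "\<And>n. {a n..b n} \<subseteq> I" "\<And>t. t \<in> I \<Longrightarrow> \<forall>\<^sub>F n in sequentially. t \<in> {a n..b n}"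
    using edge_domain_exhaustion[OF assms(1)] by metis
  have "set_integrable lborel {a n..b n} g" for n
    using assms(2) ab(1) unfolding locally_integrable_on_def by simp
  then have "(\<lambda>t. indicator {a n..b n} t * g t) \<in> borel_measurable lborel" for n
    unfolding set_integrable_def using borel_measurable_integrable by (metis (no_types, lifting) real_scaleR_def measurable_cong)
  then have m: "(\<lambda>t. indicator {a n..b n} t * g t) \<in> borel_measurable borel" for n by simp
  show ?thesis
  proof (rule borel_measurable_LIMSEQ_real)
    show "(\<lambda>t. indicator {a n..b n} t * g t) \<in> borel_measurable borel" for n by (rule m)
    fix t :: real
    show "(\<lambda>n. indicator {a n..b n} t * g t) \<longlonglongrightarrow> indicator I t * g t"
    proof (cases "t \<in> I")
      case True
      have "\<forall>\<^sub>F n in sequentially. indicator {a n..b n} t * g t = indicator I t * g t"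
        using ab(2)[OF True] by eventually_elim (use True in auto)
      then show ?thesis by (rule tendsto_eventually)
    next
      case False
      then have "t \<notin> {a n..b n}" for n using ab(1)[of n] by blast
      with False show ?thesis by (simp del: atLeastAtMost_iff)
    qed
  qed
qed

section \<open>Weak derivatives and primitives on an edge\<close>

lemma set_integrable_mult_continuous:
  fixes g \<phi> :: "real \<Rightarrow> real"
  assumes g: "set_integrable lborel K g" and K: "compact K" and \<phi>: "continuous_on UNIV \<phi>"
  shows "set_integrable lborel K (\<lambda>t. g t * \<phi> t)"
proof -
  have "compact (\<phi> ` K)" by (rule compact_continuous_image[OF continuous_on_subset[OF \<phi>] K]) simp
  then obtain B where B: "\<And>t. t \<in> K \<Longrightarrow> \<bar>\<phi> t\<bar> \<le> B" using compact_imp_bounded bounded_real by fastforce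
  have gi: "integrable lborel (\<lambda>t. indicator K t * g t)" using g by (simp add: set_integrable_def)
  have [measurable]: "\<phi> \<in> borel_measurable borel" using \<phi> by (rule borel_measurable_continuous_onI)
  have [measurable]: "(\<lambda>t. indicator K t * g t) \<in> borel_measurable borel"
    using borel_measurable_integrable[OF gi] by simp
  have "integrable lborel (\<lambda>t. (indicator K t * g t) * \<phi> t)"
  proof (rule Bochner_Integration.integrable_bound)
    show "integrable lborel (\<lambda>t. B * (indicator K t * g t))" using gi by simp
    have "\<bar>(indicator K t * g t) * \<phi> t\<bar> \<le> \<bar>B * (indicator K t * g t)\<bar>" for t
      using B[of t] by (auto simp: indicator_def abs_mult mult.commute intro!: mult_right_mono)
    then show "AE t in lborel. norm ((indicator K t * g t) * \<phi> t) \<le> norm (B * (indicator K t * g t))"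
      by simp
  qed simp
  then show ?thesis by (simp add: set_integrable_def mult.assoc)
qed

lemma test_function_outside:
  assumes "test_function I \<phi>"
  obtains K where "compact K" "K \<subseteq> I" "\<And>x. x \<notin> K \<Longrightarrow> \<phi> x = 0" "\<And>x. x \<notin> K \<Longrightarrow> deriv \<phi> x = 0"
proof -
  obtain K where K: "compact K" "K \<subseteq> I" "\<And>x. x \<notin> K \<Longrightarrow> \<phi> x = 0"
    using assms unfolding test_function_def by blast
  have "deriv \<phi> x = 0" if "x \<notin> K" for x
  proof (rule DERIV_imp_deriv)
    have "open (- K)" using K(1) by (simp add: compact_imp_closed open_Compl)
    show "(\<phi> has_real_derivative 0) (at x)"
      by (rule has_field_derivative_transform_within_open[of "\<lambda>_. 0", OF _ \<open>open (- K)\<close>]) (use that K in auto)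
  qed
  with K show thesis by (rule that)
qed

lemma LINT_eq_integral_support:
  fixes F :: "real \<Rightarrow> real"
  assumes "{a..b} \<subseteq> I" "\<And>t. t \<notin> {a..b} \<Longrightarrow> F t = 0" "set_integrable lborel {a..b} F"
  shows "(LINT t:I|lborel. F t) = integral {a..b} F"
proof -
  have "indicator I t *\<^sub>R F t = indicator {a..b} t *\<^sub>R F t" for t
    using assms(1) assms(2)[of t] by (cases "t \<in> {a..b}") (auto simp: indicator_def)
  then have "(LINT t:I|lborel. F t) = (LINT t:{a..b}|lborel. F t)"
    unfolding set_lebesgue_integral_def by (simp only:)
  also have "\<dots> = integral {a..b} F" by (rule set_borel_integral_eq_integral(2)[OF assms(3)])
  finally show ?thesis .
qed


text \<open>The lemma of du Bois-Reymond. The difference of two steep ramps approximates the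
  indicator of the interval from \<open>a\<close> to \<open>b\<close>. Testing with it shows that
  \<open>w\<close>, the difference of \<open>f\<close> and a primitive of \<open>g\<close>, has
  equal weighted means next to \<open>a\<close> and next to \<open>b\<close>; continuity gives
  \<open>w a = w b\<close>.\<close>

lemma weak_deriv_primitive:
  assumes D: "edge_domain I S" and fc: "continuous_on I f" and wd: "has_weak_deriv I f g"
    and ab: "a \<in> I" "b \<in> I" "a \<le> b"
  shows "f b - f a = integral {a..b} g"
proof (cases "a = b")
  case False
  then have lt: "a < b" using ab by simp
  note ed = edge_domainD[OF D]
  \<comment> \<open>\<open>c\<close> leaves room inside \<open>I\<close> for the second ramp, which
    starts at \<open>b\<close>.\<close>
  obtain c where c: "c \<in> I" "b < c"
  proof -
    obtain e where "0 < e" "ball b e \<subseteq> I" using ed(1) ab(2) openE by blast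
    then have "b + e / 2 \<in> I" by (auto simp: dist_real_def subset_iff)
    then show ?thesis using that[of "b + e / 2"] \<open>0 < e\<close> by simp
  qed
  have sub: "{a..c} \<subseteq> I" by (rule ed(7)[OF ab(1) c(1)])
  have gs: "set_integrable lborel {a..c} g"
    using wd sub unfolding has_weak_deriv_def locally_integrable_on_def by simp
  have gi: "g integrable_on {a..c}" by (rule set_borel_integral_eq_integral(1)[OF gs])
  have gai: "(\<lambda>x. \<bar>g x\<bar>) integrable_on {a..c}"
    by (rule set_borel_integral_eq_integral(1)[OF set_integrable_abs[OF gs]])
  have fac: "continuous_on {a..c} f" by (rule continuous_on_subset[OF fc sub])
  define P where "P x = integral {a..x} g" for x
  define w where "w x = f x - P x" for x
  have Pc: "continuous_on {a..c} P" unfolding P_def by (rule indefinite_integral_continuous_1[OF gi])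
  have wc: "continuous_on {a..c} w" unfolding w_def by (intro continuous_intros fac Pc)
  have Pd: "P t - P s = integral {s..t} g" if "a \<le> s" "s \<le> t" "t \<le> c" for s t
    using Henstock_Kurzweil_Integration.integral_combine[of a s t g] integrable_on_subinterval[OF gi, of a t] that
    by (auto simp: P_def)
  have key: "\<bar>w a - w b\<bar> \<le> e" if e: "0 < e" for e
  proof -
    have "uniformly_continuous_on {a..c} w" by (rule compact_uniformly_continuous[OF wc]) simp
    then obtain d where d: "0 < d" "\<And>x y. x \<in> {a..c} \<Longrightarrow> y \<in> {a..c} \<Longrightarrow> \<bar>x - y\<bar> < d \<Longrightarrow> \<bar>w x - w y\<bar> < e / 2"
      unfolding uniformly_continuous_on_def dist_real_def using e by (metis half_gt_zero)
    \<comment> \<open>Being at most \<open>c - b\<close>, the width lets the second ramp end by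
      \<open>c\<close>; being less than \<open>d\<close>, it keeps the variation of \<open>w\<close>
      along either ramp below \<open>e / 2\<close>.\<close>
    define \<delta> where "\<delta> = min (d / 2) (c - b)"
    have \<delta>: "0 < \<delta>" "\<delta> < d" "\<delta> \<le> c - b" using d c by (auto simp: \<delta>_def)
    define r where "r y x = ramp ((x - y) / \<delta>)" for y x
    define r' where "r' y x = ramp' ((x - y) / \<delta>) / \<delta>" for y x
    have dr: "(r y has_real_derivative r' y x) (at x)" for y x
    proof -
      have "((\<lambda>x. (x - y) / \<delta>) has_real_derivative 1 / \<delta>) (at x)"
        using \<delta> by (auto intro!: derivative_eq_intros)
      from DERIV_chain2[OF DERIV_ramp this] show ?thesis by (simp add: r_def[abs_def] r'_def)
    qed
    have r'c: "continuous_on UNIV (r' y)" for y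
      unfolding r'_def[abs_def] using \<delta>(1)
      by (intro continuous_intros continuous_on_compose2[OF continuous_ramp']) auto
    have r0: "r y x = 0" "r' y x = 0" if "x \<le> y" for x y
      using that \<delta>(1) by (auto simp: r_def r'_def divide_nonpos_pos ramp_simps)
    have r1: "r y x = 1" "r' y x = 0" if "y + \<delta> \<le> x" for x y
      using that \<delta>(1) by (auto simp: r_def r'_def le_divide_eq ramp_simps)
    have rn: "0 \<le> r' y x" for y x using \<delta>(1) by (simp add: r'_def ramp_simps)
    define \<phi> where "\<phi> x = r a x - r b x" for x
    define \<phi>' where "\<phi>' x = r' a x - r' b x" for x
    have d\<phi>: "(\<phi> has_real_derivative \<phi>' x) (at x)" for x
      unfolding \<phi>_def[abs_def] \<phi>'_def by (intro DERIV_diff dr)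
    have \<phi>'c: "continuous_on UNIV \<phi>'" unfolding \<phi>'_def[abs_def] by (intro continuous_intros r'c)
    have \<phi>c: "continuous_on UNIV \<phi>" using d\<phi> by (meson DERIV_continuous_on has_field_derivative_at_within)
    have der: "deriv \<phi> = \<phi>'" by (rule ext) (rule DERIV_imp_deriv[OF d\<phi>])
    have out: "\<phi> x = 0" "\<phi>' x = 0" if "x \<notin> {a..c}" for x
      using that r0[of x a] r0[of x b] r1[of a x] r1[of b x] lt c \<delta> by (auto simp: \<phi>_def \<phi>'_def)
    have bd: "\<phi> a = 0" "\<phi> c = 0"
      using r0[of a a] r0[of a b] r1[of a c] r1[of b c] lt c \<delta> by (auto simp: \<phi>_def)
    have "test_function I \<phi>" unfolding test_function_def der
      using d\<phi> \<phi>'c sub out(1) by (intro conjI exI[of _ "{a..c}"]) (auto simp: real_differentiable_def)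
    then have "(LINT t:I|lborel. f t * \<phi>' t) = - (LINT t:I|lborel. g t * \<phi> t)"
      using wd unfolding has_weak_deriv_def der[symmetric] by blast
    moreover have "(LINT t:I|lborel. f t * \<phi>' t) = integral {a..c} (\<lambda>t. f t * \<phi>' t)"
    proof (rule LINT_eq_integral_support[OF sub])
      have "continuous_on {a..c} (\<lambda>t. f t * \<phi>' t)"
        by (intro continuous_intros fac continuous_on_subset[OF \<phi>'c]) simp
      then show "set_integrable lborel {a..c} (\<lambda>t. f t * \<phi>' t)"
        unfolding set_integrable_def by (intro borel_integrable_compact) auto
    qed (use out in simp)
    moreover have gp: "set_integrable lborel {a..c} (\<lambda>t. g t * \<phi> t)"
      by (rule set_integrable_mult_continuous[OF gs _ \<phi>c]) simp
    then have "(LINT t:I|lborel. g t * \<phi> t) = integral {a..c} (\<lambda>t. g t * \<phi> t)"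
      by (intro LINT_eq_integral_support[OF sub]) (use out in auto)
    ultimately have A: "integral {a..c} (\<lambda>t. f t * \<phi>' t) = - integral {a..c} (\<lambda>t. g t * \<phi> t)" by simp
    have gpi: "(\<lambda>t. g t * \<phi> t) integrable_on {a..c}" by (rule set_borel_integral_eq_integral(1)[OF gp])
    have fpi: "(\<lambda>t. f t * \<phi>' t) integrable_on {a..c}" "(\<lambda>t. P t * \<phi>' t) integrable_on {a..c}"
      by (intro integrable_continuous_real continuous_intros fac Pc continuous_on_subset[OF \<phi>'c]; simp)+
    \<comment> \<open>The same test integral for the primitive \<open>P\<close>; subtracting the two
      leaves that of \<open>w\<close>, which therefore vanishes.\<close>
    have "P c * \<phi> c - P a * \<phi> a = integral {a..c} (\<lambda>x. P x * \<phi>' x + g x * \<phi> x)"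
      by (rule integral_by_parts_primitive[OF _ gi gai gpi Pd Pc d\<phi> \<phi>'c]) (use lt c in auto)
    also have "\<dots> = integral {a..c} (\<lambda>x. P x * \<phi>' x) + integral {a..c} (\<lambda>t. g t * \<phi> t)"
      by (rule Henstock_Kurzweil_Integration.integral_add[OF fpi(2) gpi])
    finally have "integral {a..c} (\<lambda>t. f t * \<phi>' t) = integral {a..c} (\<lambda>x. P x * \<phi>' x)" using A bd by simp
    then have "integral {a..c} (\<lambda>t. f t * \<phi>' t - P t * \<phi>' t) = 0"
      using Henstock_Kurzweil_Integration.integral_diff[OF fpi] by simp
    then have W0: "((\<lambda>t. w t * \<phi>' t) has_integral 0) {a..c}"
      using integrable_diff[OF fpi] by (simp add: w_def left_diff_distrib has_integral_iff)
    have rI: "(r' y has_integral 1) {a..c}" if y: "a \<le> y" "y \<le> b" for y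
    proof -
      have "(r' y has_integral (r y c - r y a)) {a..c}"
        by (rule fundamental_theorem_of_calculus)
          (use dr lt c in \<open>auto simp: has_real_derivative_iff_has_vector_derivative[symmetric] intro: has_field_derivative_at_within\<close>)
      then show ?thesis using r0[of a y] r1[of y c] y \<delta> by simp
    qed
    have ra: "(r' a has_integral 1) {a..c}" and rb: "(r' b has_integral 1) {a..c}" using rI lt by auto
    have diff: "((\<lambda>t. w a * r' a t - w b * r' b t - w t * \<phi>' t) has_integral (w a * 1 - w b * 1 - 0)) {a..c}"
      by (intro has_integral_diff has_integral_mult_right ra rb W0)
    have dom: "((\<lambda>t. e / 2 * r' a t + e / 2 * r' b t) has_integral (e / 2 * 1 + e / 2 * 1)) {a..c}"
      by (intro has_integral_add has_integral_mult_right ra rb)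
    have "norm (integral {a..c} (\<lambda>t. w a * r' a t - w b * r' b t - w t * \<phi>' t))
        \<le> integral {a..c} (\<lambda>t. e / 2 * r' a t + e / 2 * r' b t)"
    proof (rule integral_norm_bound_integral)
      fix t assume t: "t \<in> {a..c}"
      have near: "\<bar>w y - w t\<bar> * r' y t \<le> e / 2 * r' y t" if y: "y \<in> {a..c}" for y
      proof (cases "y \<le> t \<and> t \<le> y + \<delta>")
        case True
        then have "\<bar>w y - w t\<bar> < e / 2" using \<delta> by (intro d(2) y t) auto
        then show ?thesis by (intro mult_right_mono rn) simp
      next
        case False
        then show ?thesis using r0[of t y] r1[of y t] by auto
      qed
      have "w a * r' a t - w b * r' b t - w t * \<phi>' t = (w a - w t) * r' a t - (w b - w t) * r' b t"
        by (simp add: \<phi>'_def algebra_simps)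
      also have "norm \<dots> \<le> \<bar>w a - w t\<bar> * r' a t + \<bar>w b - w t\<bar> * r' b t"
        using abs_triangle_ineq4[of "(w a - w t) * r' a t" "(w b - w t) * r' b t"]
          rn[of a t] rn[of b t] by (simp add: abs_mult)
      also have "\<dots> \<le> e / 2 * r' a t + e / 2 * r' b t"
        using lt c by (intro add_mono near) auto
      finally show "norm (w a * r' a t - w b * r' b t - w t * \<phi>' t) \<le> e / 2 * r' a t + e / 2 * r' b t" .
    qed (use diff dom in blast)+
    then show ?thesis unfolding integral_unique[OF diff] integral_unique[OF dom] by simp
  qed
  have "\<bar>w a - w b\<bar> \<le> 0" by (rule field_le_epsilon) (use key in simp)
  then show ?thesis using Pd[of a b] lt c by (simp add: w_def)
qed simp


lemma integral_edge_domain: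
  fixes F :: "real \<Rightarrow> real"
  assumes "edge_domain I S"
  shows "F integrable_on I \<longleftrightarrow> F integrable_on S" "integral I F = integral S F"
proof -
  have n: "negligible {x \<in> S - I. F x \<noteq> 0}"
    by (rule negligible_finite, rule finite_subset[OF _ edge_domainD(6)[OF assms]]) auto
  have "{x \<in> I - S. F x \<noteq> 0} = {}" using edge_domainD(3)[OF assms] by auto
  then have e: "negligible {x \<in> I - S. F x \<noteq> 0}" by (metis negligible_empty)
  show "F integrable_on I \<longleftrightarrow> F integrable_on S"
    using integrable_spike_set[OF _ e n] integrable_spike_set[OF _ n e] by blast
  show "integral I F = integral S F" by (rule integral_spike_set[OF e n])
qed

text \<open>The definitions on the graph use Lebesgue integrals over the interior of an edge, the
  estimates use gauge integrals over the closed edge; nonnegativity makes the two agree.\<close>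

lemma set_integrable_edge_domain:
  fixes F :: "real \<Rightarrow> real"
  assumes D: "edge_domain I S" and m: "(\<lambda>t. indicator I t * F t) \<in> borel_measurable borel"
    and F: "F integrable_on S" "\<And>t. t \<in> S \<Longrightarrow> 0 \<le> F t"
  shows "set_integrable lborel I F" "(LINT t:I|lborel. F t) = integral S F"
proof -
  let ?w = "\<lambda>t. indicator I t * F t"
  have "F integrable_on I" using F(1) integral_edge_domain(1)[OF D] by blast
  then have "?w integrable_on I" by (rule integrable_eq) simp
  then have "integrable lborel (\<lambda>t. indicator I t * ?w t)"
    by (rule lborel_integrable_on(1)[OF m]) (use F(2) edge_domainD[OF D] in auto)
  moreover have "indicator I t * ?w t = indicator I t *\<^sub>R F t" for t by (simp add: indicator_def)
  ultimately show si: "set_integrable lborel I F" unfolding set_integrable_def by simp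
  show "(LINT t:I|lborel. F t) = integral S F"
    using set_borel_integral_eq_integral(2)[OF si] integral_edge_domain(2)[OF D] by metis
qed

lemma continuous_edge_domain_measurable:
  fixes F :: "real \<Rightarrow> real"
  assumes "edge_domain I S" "continuous_on S F"
  shows "(\<lambda>t. indicator I t * F t) \<in> borel_measurable borel"
  using borel_measurable_continuous_on_indicator[of I F] edge_domainD(3,5)[OF assms(1)]
    continuous_on_subset[OF assms(2)] by simp

text \<open>Extension by zero makes the derivative Borel on the whole line. The primitive identity
  holds between interior points by \<open>weak_deriv_primitive\<close> and reaches the ends of the
  edge by continuity of both sides.\<close>

lemma weak_deriv_prim_on:
  assumes D: "edge_domain I S" and fc: "continuous_on S f" and wd: "has_weak_deriv I f g"
    and int: "set_integrable lborel I (\<lambda>t. \<bar>g t\<bar>\<^sup>2 + \<bar>f t\<bar>\<^sup>2)"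
  shows "prim_on S f (\<lambda>t. indicator I t * g t)" "(\<lambda>t. (f t)\<^sup>2) integrable_on S"
    "(LINT t:I|lborel. \<bar>g t\<bar>\<^sup>2) = integral S (\<lambda>t. (indicator I t * g t)\<^sup>2)"
proof -
  note ed = edge_domainD[OF D]
  define g' where "g' t = indicator I t * g t" for t
  have g'm[measurable]: "g' \<in> borel_measurable borel" unfolding g'_def
    by (rule weak_deriv_measurable[OF D]) (use wd in \<open>simp add: has_weak_deriv_def\<close>)
  have [measurable]: "I \<in> sets borel" by (rule ed(5))
  define F where "F t = (g' t)\<^sup>2 + (f t)\<^sup>2" for t
  have "(\<lambda>t. \<bar>g t\<bar>\<^sup>2 + \<bar>f t\<bar>\<^sup>2) integrable_on I" by (rule set_borel_integral_eq_integral(1)[OF int])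
  then have "F integrable_on I" by (rule integrable_eq) (simp add: F_def g'_def)
  then have Fi: "F integrable_on S" using integral_edge_domain(1)[OF D] by blast
  have g2: "(\<lambda>t. (g' t)\<^sup>2) integrable_on S"
    by (rule integrable_on_dominated[OF _ Fi ed(4)]) (auto simp: F_def)
  show "(\<lambda>t. (f t)\<^sup>2) integrable_on S"
    by (rule integrable_on_dominated_continuous[OF _ Fi ed(4)])
      (use fc in \<open>auto simp: F_def intro!: continuous_intros\<close>)
  have "(LINT t:I|lborel. \<bar>g t\<bar>\<^sup>2) = (LINT t:I|lborel. (g' t)\<^sup>2)"
    unfolding set_lebesgue_integral_def g'_def by (intro Bochner_Integration.integral_cong) (auto simp: indicator_def)
  also have "\<dots> = integral S (\<lambda>t. (g' t)\<^sup>2)"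
    by (rule set_integrable_edge_domain(2)[OF D _ g2]) simp_all
  finally show "(LINT t:I|lborel. \<bar>g t\<bar>\<^sup>2) = integral S (\<lambda>t. (indicator I t * g t)\<^sup>2)"
    by (simp add: g'_def)
  have "prim_on S f g'" unfolding prim_on_def
  proof (intro conjI ballI impI g2 g'm)
    fix a b assume ab: "a \<in> S" "b \<in> S" "a \<le> b"
    show "f b - f a = integral {a..b} g'"
    proof (cases "a = b")
      case False
      then have lt: "a < b" using ab by simp
      have sub: "{a..b} \<subseteq> S" "{a<..<b} \<subseteq> I" using ed(8,9)[OF ab(1,2)] by auto
      have "(\<lambda>t. (g' t)\<^sup>2) integrable_on {a..b}"
        by (rule integrable_on_subset_nonneg[OF g2 _ sub(1)]) auto
      then have pP: "prim_on {a..b} (\<lambda>x. integral {a..x} g') g'" by (rule prim_on_integral[OF g'm])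
      let ?d = "\<lambda>x. f x - integral {a..x} g'"
      have dc: "continuous_on {a..b} ?d"
        by (intro continuous_intros prim_on_continuous_interval[OF pP] continuous_on_subset[OF fc sub(1)])
      have le: "?d x = ?d y" if "a < x" "x \<le> y" "y < b" for x y
      proof -
        have xy: "x \<in> I" "y \<in> I" using that sub(2) by auto
        have "f y - f x = integral {x..y} g"
          by (rule weak_deriv_primitive[OF D continuous_on_subset[OF fc ed(3)] wd xy that(2)])
        also have "\<dots> = integral {x..y} g'"
          by (rule Henstock_Kurzweil_Integration.integral_cong) (use ed(7)[OF xy] in \<open>auto simp: g'_def indicator_def\<close>)
        also have "\<dots> = integral {a..y} g' - integral {a..x} g'"
          using prim_on_eq[OF pP, of x y] that by simp
        finally show ?thesis by simp
      qed
      define m where "m = (a + b) / 2"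
      have m: "a < m" "m < b" using lt by (auto simp: m_def)
      have "?d x = ?d m" if "a < x" "x < b" for x
      proof (cases "x \<le> m")
        case True
        show ?thesis by (rule le) (use that m True in auto)
      next
        case False
        show ?thesis by (rule le[symmetric]) (use that m False in auto)
      qed
      then have "?d x = ?d m" if "x \<in> {a..b}" for x
        using constant_if_constant_on_Rats[OF dc lt _ that] by blast
      from this[of a] this[of b] show ?thesis using lt by simp
    qed simp
  qed
  then show "prim_on S f (\<lambda>t. indicator I t * g t)" by (simp add: g'_def[abs_def])
qed

text \<open>Integration by parts between two points of \<open>I\<close> that enclose the support of
  the test function, where the boundary terms vanish.\<close>

lemma prim_on_weak_deriv:
  assumes D: "edge_domain I S" and fc: "continuous_on S f" and p: "prim_on S f g"
  shows "has_weak_deriv I f g"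
proof -
  note ed = edge_domainD[OF D]
  have fI: "continuous_on I f" by (rule continuous_on_subset[OF fc ed(3)])
  have gab: "set_integrable lborel {a..b} g" if ab: "{a..b} \<subseteq> I" for a b
  proof -
    have pab: "prim_on {a..b} f g" by (rule prim_on_subset[OF p]) (use ab ed(3) in auto)
    then have gm[measurable]: "g \<in> borel_measurable borel" by (simp add: prim_on_def)
    have "integrable lborel (\<lambda>t. indicator {a..b} t * \<bar>g t\<bar>)"
      by (rule lborel_integrable_on(1)) (use prim_on_abs_integrable(2)[OF pab] in auto)
    then have "integrable lborel (\<lambda>t. norm (indicator {a..b} t * g t))" by (simp add: abs_mult)
    then show ?thesis unfolding set_integrable_def by (subst (asm) integrable_norm_iff) auto
  qed
  have lf: "locally_integrable_on f I" unfolding locally_integrable_on_def set_integrable_def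
  proof (intro allI impI)
    fix K assume "compact K \<and> K \<subseteq> I"
    then show "integrable lborel (\<lambda>t. indicator K t *\<^sub>R f t)"
      using continuous_on_subset[OF fI, of K] by (intro borel_integrable_compact) blast+
  qed
  have lg: "locally_integrable_on g I" unfolding locally_integrable_on_def
  proof (intro allI impI)
    fix K assume K: "compact K \<and> K \<subseteq> I"
    then obtain a b where ab: "a \<in> I" "b \<in> I" "K \<subseteq> {a<..<b}" using edge_domain_compact_subset[OF D] by metis
    show "set_integrable lborel K g"
      by (rule set_integrable_subset[OF gab[OF ed(7)[OF ab(1,2)]]])
        (use K ab in \<open>auto intro: borel_compact\<close>)
  qed
  have "(LINT t:I|lborel. f t * deriv \<phi> t) = - (LINT t:I|lborel. g t * \<phi> t)" if T: "test_function I \<phi>" for \<phi>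
  proof -
    obtain K where K: "compact K" "K \<subseteq> I" "\<And>x. x \<notin> K \<Longrightarrow> \<phi> x = 0" "\<And>x. x \<notin> K \<Longrightarrow> deriv \<phi> x = 0"
      using test_function_outside[OF T] by metis
    obtain a b where ab: "a \<in> I" "b \<in> I" "a < b" "K \<subseteq> {a<..<b}"
      using edge_domain_compact_subset[OF D K(1,2)] by metis
    have sub: "{a..b} \<subseteq> I" by (rule ed(7)[OF ab(1,2)])
    have pab: "prim_on {a..b} f g" by (rule prim_on_subset[OF p]) (use sub ed(3) in auto)
    have d: "(\<phi> has_real_derivative deriv \<phi> x) (at x)" for x
      using T by (simp add: test_function_def DERIV_deriv_iff_real_differentiable)
    have \<phi>'c: "continuous_on UNIV (deriv \<phi>)" using T by (simp add: test_function_def)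
    have \<phi>c: "continuous_on UNIV \<phi>" using d by (meson DERIV_continuous_on has_field_derivative_at_within)
    have z: "\<phi> t = 0" "deriv \<phi> t = 0" if "t \<notin> {a<..<b}" for t
    proof -
      have "t \<notin> K" using that ab(4) by blast
      then show "\<phi> t = 0" "deriv \<phi> t = 0" using K(3,4) by auto
    qed
    have "continuous_on {a..b} (\<lambda>t. f t * deriv \<phi> t)"
      by (intro continuous_intros continuous_on_subset[OF fI sub] continuous_on_subset[OF \<phi>'c]) simp
    then have s1: "set_integrable lborel {a..b} (\<lambda>t. f t * deriv \<phi> t)"
      unfolding set_integrable_def by (intro borel_integrable_compact) auto
    have s2: "set_integrable lborel {a..b} (\<lambda>t. g t * \<phi> t)"
      by (rule set_integrable_mult_continuous[OF gab[OF sub] _ \<phi>c]) simp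
    have L1: "(LINT t:I|lborel. f t * deriv \<phi> t) = integral {a..b} (\<lambda>t. f t * deriv \<phi> t)"
      by (rule LINT_eq_integral_support[OF sub _ s1]) (use z in auto)
    have L2: "(LINT t:I|lborel. g t * \<phi> t) = integral {a..b} (\<lambda>t. g t * \<phi> t)"
      by (rule LINT_eq_integral_support[OF sub _ s2]) (use z in auto)
    note i1 = set_borel_integral_eq_integral(1)[OF s1] and i2 = set_borel_integral_eq_integral(1)[OF s2]
    have "f b * \<phi> b - f a * \<phi> a = integral {a..b} (\<lambda>x. f x * deriv \<phi> x + g x * \<phi> x)"
      by (rule integral_by_parts_primitive[OF _ prim_on_abs_integrable(1,2)[OF pab] i2 _
            prim_on_continuous_interval[OF pab] d \<phi>'c])
        (use ab(3) prim_on_eq[OF pab] in auto)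
    also have "\<dots> = integral {a..b} (\<lambda>t. f t * deriv \<phi> t) + integral {a..b} (\<lambda>t. g t * \<phi> t)"
      by (rule Henstock_Kurzweil_Integration.integral_add[OF i1 i2])
    finally show ?thesis unfolding L1 L2 using z[of a] z[of b] by simp
  qed
  then show ?thesis unfolding has_weak_deriv_def using lf lg by blast
qed

text \<open>Both derivatives have the increments of \<open>f\<close> as integrals over compact
  intervals inside \<open>I\<close>. This makes the arbitrary choice in \<open>weak_deriv\<close>
  harmless for the kinetic energy.\<close>

lemma weak_deriv_unique:
  assumes D: "edge_domain I S" and fc: "continuous_on I f"
    and w: "has_weak_deriv I f g" "has_weak_deriv I f h"
  shows "AE t in lborel. indicator I t * g t = indicator I t * h t"
proof -
  note ed = edge_domainD[OF D]
  obtain a b where ab: "\<And>n. {a n..b n} \<subseteq> I" "\<And>t. t \<in> I \<Longrightarrow> \<forall>\<^sub>F n in sequentially. t \<in> {a n..b n}"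
    using edge_domain_exhaustion[OF D] by metis
  have "AE t in lborel. indicator {a n..b n} t * (g t - h t) = 0" for n
  proof -
    have si: "set_integrable lborel {a n..b n} g" "set_integrable lborel {a n..b n} h"
      using w ab(1) unfolding has_weak_deriv_def locally_integrable_on_def by auto
    define k where "k t = indicator {a n..b n} t * (g t - h t)" for t
    have s: "set_integrable lborel {a n..b n} (\<lambda>t. g t - h t)" by (rule set_integral_diff(1)[OF si])
    then have ki: "integrable lborel k" by (simp add: set_integrable_def k_def[abs_def])
    have zero: "integral {c..d} (\<lambda>t. g t - h t) = 0" if "{c..d} \<subseteq> {a n..b n}" for c d
    proof (cases "c \<le> d")
      case True
      then have cd: "c \<in> I" "d \<in> I" using that ab(1)[of n] by auto
      have i: "g integrable_on {c..d}" "h integrable_on {c..d}"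
        using set_borel_integral_eq_integral(1)[OF si(1)] set_borel_integral_eq_integral(1)[OF si(2)]
          integrable_on_subinterval that by blast+
      have "integral {c..d} (\<lambda>t. g t - h t) = integral {c..d} g - integral {c..d} h"
        by (rule Henstock_Kurzweil_Integration.integral_diff[OF i])
      then show ?thesis
        using weak_deriv_primitive[OF D fc w(1) cd True] weak_deriv_primitive[OF D fc w(2) cd True] by simp
    qed simp
    have zl: "(LINT t:{c..d}|lborel. k t) = 0" for c d
    proof -
      have "indicator {c..d} t *\<^sub>R k t = indicator {max c (a n)..min d (b n)} t *\<^sub>R (g t - h t)" for t
        by (auto simp: k_def indicator_def)
      then have "(LINT t:{c..d}|lborel. k t) = (LINT t:{max c (a n)..min d (b n)}|lborel. g t - h t)"
        unfolding set_lebesgue_integral_def by (simp only:)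
      also have "\<dots> = integral {max c (a n)..min d (b n)} (\<lambda>t. g t - h t)"
        by (rule set_borel_integral_eq_integral(2), rule set_integrable_subset[OF s]) auto
      also have "\<dots> = 0" by (rule zero) auto
      finally show ?thesis .
    qed
    have "(\<integral>t. k t \<partial>lborel) = (LINT t:{a n..b n}|lborel. k t)"
      unfolding set_lebesgue_integral_def by (rule Bochner_Integration.integral_cong) (auto simp: k_def indicator_def)
    then have "(\<integral>t. k t \<partial>lborel) = 0" using zl by simp
    then have "AE t in lborel. k t = 0" by (rule AE_zero_if_interval_integrals_zero[OF ki]) (rule zl)
    then show ?thesis by (simp add: k_def)
  qed
  then have "AE t in lborel. \<forall>n. indicator {a n..b n} t * (g t - h t) = 0" by (simp only: AE_all_countable) blast
  then show ?thesis
  proof eventually_elim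
    case (elim t)
    show ?case
    proof (cases "t \<in> I")
      case True
      from eventually_happens'[OF sequentially_bot ab(2)[OF True]] obtain n where "t \<in> {a n..b n}" by blast
      then show ?thesis using elim[rule_format, of n] by simp
    qed simp
  qed
qed

lemma weak_deriv_of_prim_on:
  assumes D: "edge_domain I S" and fc: "continuous_on S f" and p: "prim_on S f g"
    and f2: "(\<lambda>t. (f t)\<^sup>2) integrable_on S"
  shows "has_weak_deriv I f (weak_deriv I f)"
    "set_integrable lborel I (\<lambda>t. \<bar>weak_deriv I f t\<bar>\<^sup>2 + \<bar>f t\<bar>\<^sup>2)"
    "(LINT t:I|lborel. \<bar>weak_deriv I f t\<bar>\<^sup>2) = integral S (\<lambda>t. (g t)\<^sup>2)"
proof -
  note ed = edge_domainD[OF D]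
  have wg: "has_weak_deriv I f g" by (rule prim_on_weak_deriv[OF D fc p])
  then show ww: "has_weak_deriv I f (weak_deriv I f)" unfolding weak_deriv_def by (rule someI[of "has_weak_deriv I f"])
  have gm[measurable]: "g \<in> borel_measurable borel" and g2: "(\<lambda>t. (g t)\<^sup>2) integrable_on S"
    using p by (auto simp: prim_on_def)
  have [measurable]: "I \<in> sets borel" by (rule ed(5))
  have wm[measurable]: "(\<lambda>t. indicator I t * weak_deriv I f t) \<in> borel_measurable borel"
    by (rule weak_deriv_measurable[OF D]) (use ww in \<open>simp add: has_weak_deriv_def\<close>)
  have AE: "AE t in lborel. indicator I t * weak_deriv I f t = indicator I t * g t"
    by (rule weak_deriv_unique[OF D continuous_on_subset[OF fc ed(3)] ww wg])
  have sg: "set_integrable lborel I (\<lambda>t. (g t)\<^sup>2)" "(LINT t:I|lborel. (g t)\<^sup>2) = integral S (\<lambda>t. (g t)\<^sup>2)"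
    by (rule set_integrable_edge_domain[OF D _ g2]; simp)+
  have sf: "set_integrable lborel I (\<lambda>t. (f t)\<^sup>2)"
    by (rule set_integrable_edge_domain(1)[OF D continuous_edge_domain_measurable[OF D] f2])
      (use fc in \<open>auto intro!: continuous_intros\<close>)
  have sq: "indicator I t *\<^sub>R (x t)\<^sup>2 = (indicator I t * x t)\<^sup>2" for x :: "real \<Rightarrow> real" and t
    by (simp add: indicator_def)
  have wi: "set_integrable lborel I (\<lambda>t. \<bar>weak_deriv I f t\<bar>\<^sup>2)"
    using sg(1) unfolding set_integrable_def power2_abs sq
  proof (rule integrable_cong_AE_imp)
    show "AE t in lborel. (indicator I t * g t)\<^sup>2 = (indicator I t * weak_deriv I f t)\<^sup>2"
      using AE by eventually_elim (simp only:)
  qed simp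
  show "set_integrable lborel I (\<lambda>t. \<bar>weak_deriv I f t\<bar>\<^sup>2 + \<bar>f t\<bar>\<^sup>2)"
    using set_integral_add(1)[OF wi sf] by simp
  have "(LINT t:I|lborel. \<bar>weak_deriv I f t\<bar>\<^sup>2) = (LINT t:I|lborel. (g t)\<^sup>2)"
    unfolding set_lebesgue_integral_def power2_abs sq
  proof (rule integral_cong_AE)
    show "AE t in lborel. (indicator I t * weak_deriv I f t)\<^sup>2 = (indicator I t * g t)\<^sup>2"
      using AE by eventually_elim (simp only:)
  qed simp_all
  then show "(LINT t:I|lborel. \<bar>weak_deriv I f t\<bar>\<^sup>2) = integral S (\<lambda>t. (g t)\<^sup>2)" using sg(2) by simp
qed

section \<open>The energy on a half-line\<close>

lemma integral_half_line_split:
  fixes F :: "real \<Rightarrow> real"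
  assumes "F integrable_on {a..}" "\<And>t. a \<le> t \<Longrightarrow> 0 \<le> F t" "a \<le> b"
  shows "integral {a..} F = integral {a..b} F + integral {b..} F" "F integrable_on {a..b}" "F integrable_on {b..}"
proof -
  show i: "F integrable_on {a..b}" "F integrable_on {b..}"
    using integrable_on_subset_nonneg[OF assms(1,2), of "{a..b}"] integrable_on_subset_nonneg[OF assms(1,2), of "{b..}"] assms(3)
    by auto
  have "{a..b} \<inter> {b..} \<subseteq> {b}" by auto
  then have "negligible ({a..b} \<inter> {b..})" by (rule negligible_subset[OF negligible_sing])
  then have "integral ({a..b} \<union> {b..}) F = integral {a..b} F + integral {b..} F"
    using i by (intro Henstock_Kurzweil_Integration.integral_Un)
  moreover have "{a..b} \<union> {b..} = {a..}" using assms(3) by auto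
  ultimately show "integral {a..} F = integral {a..b} F + integral {b..} F" by simp
qed

lemma tendsto_integral_at_top:
  fixes F :: "real \<Rightarrow> real"
  assumes "F integrable_on {a..}" "\<And>t. a \<le> t \<Longrightarrow> 0 \<le> F t"
  shows "((\<lambda>b. integral {a..b} F) \<longlongrightarrow> integral {a..} F) at_top"
proof -
  have ai: "F absolutely_integrable_on {a..}"
    by (rule nonnegative_absolutely_integrable_1) (use assms in auto)
  have "((\<lambda>b. LINT x:{a..b}|lebesgue. F x) \<longlongrightarrow> (LINT x:{a..}|lebesgue. F x)) at_top"
    by (rule tendsto_set_lebesgue_integral_at_top[OF _ ai]) auto
  moreover have "(LINT x:{a..}|lebesgue. F x) = integral {a..} F"
    by (rule set_lebesgue_integral_eq_integral(2)[OF ai])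
  moreover have "(LINT x:{a..b}|lebesgue. F x) = integral {a..b} F" for b
    by (rule set_lebesgue_integral_eq_integral(2), rule set_integrable_subset[OF ai]) auto
  ultimately show ?thesis by simp
qed

text \<open>Were \<open>\<bar>f\<bar>\<close> at least \<open>e\<close> throughout, an interval of
  length \<open>(\<bar>I\<bar> + 1) / e\<^sup>2\<close> would already carry more than the integral
  \<open>I\<close>.\<close>

lemma half_line_small_value:
  fixes f :: "real \<Rightarrow> real"
  assumes f2: "(\<lambda>t. (f t)\<^sup>2) integrable_on {a..}" and e: "0 < e"
  obtains y where "a \<le> y" "\<bar>f y\<bar> < (e::real)"
proof -
  have "\<exists>y\<ge>a. \<bar>f y\<bar> < e"
  proof (rule ccontr)
    assume "\<not> ?thesis"
    then have big: "e \<le> \<bar>f y\<bar>" if "a \<le> y" for y using that by force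
    define I where "I = integral {a..} (\<lambda>t. (f t)\<^sup>2)"
    have "e\<^sup>2 * x \<le> I" if x: "0 < x" for x
    proof -
      have "integral {a..a+x} (\<lambda>t. e\<^sup>2) \<le> integral {a..a+x} (\<lambda>t. (f t)\<^sup>2)"
      proof (rule integral_le)
        show "(\<lambda>t. (f t)\<^sup>2) integrable_on {a..a+x}"
          by (rule integrable_on_subset_nonneg[OF f2]) auto
        show "e\<^sup>2 \<le> (f t)\<^sup>2" if "t \<in> {a..a+x}" for t
          using power_mono[OF big[of t], of 2] that e by simp
      qed auto
      also have "\<dots> \<le> I" unfolding I_def
        by (rule integral_subset_le) (use f2 integrable_on_subset_nonneg[OF f2, of "{a..a+x}"] in auto)
      finally show ?thesis using x by (simp add: mult.commute)
    qed
    from this[of "(\<bar>I\<bar> + 1) / e\<^sup>2"] have "e\<^sup>2 * ((\<bar>I\<bar> + 1) / e\<^sup>2) \<le> I" using e by simp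
    moreover have "e\<^sup>2 * ((\<bar>I\<bar> + 1) / e\<^sup>2) = \<bar>I\<bar> + 1" using e by simp
    ultimately show False by linarith
  qed
  then show thesis using that by blast
qed

lemma bounded_on_interval:
  fixes f :: "real \<Rightarrow> real"
  assumes "continuous_on {a..b} f"
  obtains M where "0 < M" "\<And>t. t \<in> {a..b} \<Longrightarrow> \<bar>f t\<bar> \<le> M"
proof -
  have "bounded (f ` {a..b})" by (rule compact_imp_bounded[OF compact_continuous_image[OF assms]]) simp
  then show thesis using that unfolding bounded_pos by auto
qed

text \<open>The calibration with the identity as weight, whose primitive is half the square.\<close>

lemma prim_on_square_diff:
  assumes p: "prim_on {a..b} f g" and ab: "a \<le> b"
  shows "abs ((f b)\<^sup>2 - (f a)\<^sup>2) \<le> integral {a..b} (\<lambda>t. (g t)\<^sup>2) + integral {a..b} (\<lambda>t. (f t)\<^sup>2)"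
proof -
  have fc: "continuous_on {a..b} f" by (rule prim_on_continuous_interval[OF p])
  obtain M where M: "0 < M" "\<And>t. t \<in> {a..b} \<Longrightarrow> \<bar>f t\<bar> \<le> M" using bounded_on_interval[OF fc] by metis
  have "abs (\<bar>f b\<bar>\<^sup>2 / 2 - \<bar>f a\<bar>\<^sup>2 / 2) \<le> integral {a..b} (\<lambda>t. ((g t)\<^sup>2 + \<bar>f t\<bar>\<^sup>2) / 2)"
    by (rule calibration(1)[OF p ab M(2), where h = "\<lambda>t. t" and G = "\<lambda>t. t\<^sup>2 / 2"])
      (auto intro!: derivative_eq_intros continuous_intros)
  moreover have "integral {a..b} (\<lambda>t. ((g t)\<^sup>2 + \<bar>f t\<bar>\<^sup>2) / 2)
     = (integral {a..b} (\<lambda>t. (g t)\<^sup>2) + integral {a..b} (\<lambda>t. (f t)\<^sup>2)) / 2"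
    using prim_on_abs_integrable(3)[OF p] fc
    by (simp add: Henstock_Kurzweil_Integration.integral_add integrable_continuous_real continuous_intros)
  moreover have "abs (x / 2 - y / 2) = abs (x - y) / 2" for x y :: real by (simp add: diff_divide_distrib[symmetric])
  ultimately show ?thesis by simp
qed

text \<open>The square at \<open>x\<close> is compared with the square at a farther point where
  \<open>f\<close> is small.\<close>

lemma half_line_square_le:
  assumes p: "prim_on {a..} f g" and f2: "(\<lambda>t. (f t)\<^sup>2) integrable_on {a..}" and x: "a \<le> x"
  shows "(f x)\<^sup>2 \<le> integral {x..} (\<lambda>t. (g t)\<^sup>2) + integral {x..} (\<lambda>t. (f t)\<^sup>2)"
proof (rule field_le_epsilon)
  fix e :: real assume e: "0 < e"
  have px: "prim_on {x..} f g" by (rule prim_on_subset[OF p]) (use x in auto)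
  have f2x: "(\<lambda>t. (f t)\<^sup>2) integrable_on {x..}" by (rule integrable_on_subset_nonneg[OF f2]) (use x in auto)
  have g2x: "(\<lambda>t. (g t)\<^sup>2) integrable_on {x..}" using px by (simp add: prim_on_def)
  obtain y where y: "x \<le> y" "\<bar>f y\<bar> < sqrt e"
    using half_line_small_value[OF f2x, of "sqrt e"] e by auto
  have "(f y)\<^sup>2 \<le> e" using y(2) e by (metis less_imp_le real_sqrt_le_iff real_sqrt_abs)
  moreover have pxy: "prim_on {x..y} f g" by (rule prim_on_subset[OF px]) auto
  have "(f x)\<^sup>2 - (f y)\<^sup>2 \<le> integral {x..y} (\<lambda>t. (g t)\<^sup>2) + integral {x..y} (\<lambda>t. (f t)\<^sup>2)"
    using prim_on_square_diff[OF pxy y(1)] by linarith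
  moreover have "integral {x..y} (\<lambda>t. (g t)\<^sup>2) \<le> integral {x..} (\<lambda>t. (g t)\<^sup>2)"
    by (rule integral_subset_le) (use g2x integrable_on_subset_nonneg[OF g2x, of "{x..y}"] in auto)
  moreover have "integral {x..y} (\<lambda>t. (f t)\<^sup>2) \<le> integral {x..} (\<lambda>t. (f t)\<^sup>2)"
    by (rule integral_subset_le) (use f2x integrable_on_subset_nonneg[OF f2x, of "{x..y}"] in auto)
  ultimately show "(f x)\<^sup>2 \<le> integral {x..} (\<lambda>t. (g t)\<^sup>2) + integral {x..} (\<lambda>t. (f t)\<^sup>2) + e" by linarith
qed

lemma half_line_tendsto_0:
  assumes p: "prim_on {a..} f g" and f2: "(\<lambda>t. (f t)\<^sup>2) integrable_on {a..}"
  shows "(f \<longlongrightarrow> 0) at_top"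
proof -
  have g2: "(\<lambda>t. (g t)\<^sup>2) integrable_on {a..}" using p by (simp add: prim_on_def)
  have tail: "((\<lambda>x. integral {x..} F) \<longlongrightarrow> 0) at_top" if "F integrable_on {a..}" "\<And>t. 0 \<le> F t" for F :: "real \<Rightarrow> real"
  proof -
    have "((\<lambda>b. integral {a..} F - integral {a..b} F) \<longlongrightarrow> integral {a..} F - integral {a..} F) at_top"
      by (intro tendsto_intros tendsto_integral_at_top that)
    moreover have "\<forall>\<^sub>F b in at_top. integral {a..} F - integral {a..b} F = integral {b..} F"
      using eventually_ge_at_top[of a] by eventually_elim (use integral_half_line_split(1)[OF that] in auto)
    ultimately show ?thesis by (simp add: tendsto_cong)
  qed
  have lim: "((\<lambda>x. integral {x..} (\<lambda>t. (g t)\<^sup>2) + integral {x..} (\<lambda>t. (f t)\<^sup>2)) \<longlongrightarrow> 0 + 0) at_top"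
    by (intro tendsto_add tail g2 f2) auto
  have le: "\<forall>\<^sub>F x in at_top. norm ((f x)\<^sup>2) \<le> integral {x..} (\<lambda>t. (g t)\<^sup>2) + integral {x..} (\<lambda>t. (f t)\<^sup>2)"
    using eventually_ge_at_top[of a] by eventually_elim (use half_line_square_le[OF p f2] in auto)
  have "((\<lambda>x. (f x)\<^sup>2) \<longlongrightarrow> 0) at_top"
    by (rule Lim_null_comparison[OF le]) (use lim in simp)
  from tendsto_real_sqrt[OF this] show ?thesis by (simp add: tendsto_rabs_zero_iff)
qed

text \<open>Decay at infinity confines the values that can compete with a nonzero one to a bounded
  interval.\<close>

lemma half_line_attains_max:
  assumes p: "prim_on {a..} f g" and f2: "(\<lambda>t. (f t)\<^sup>2) integrable_on {a..}"
  obtains x where "a \<le> x" "\<And>t. a \<le> t \<Longrightarrow> \<bar>f t\<bar> \<le> \<bar>f x\<bar>"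
proof (cases "\<forall>t\<ge>a. f t = 0")
  case True
  then show thesis using that[of a] by auto
next
  case False
  then obtain x0 where x0: "a \<le> x0" "f x0 \<noteq> 0" by blast
  have "((\<lambda>t. \<bar>f t\<bar>) \<longlongrightarrow> 0) at_top" using half_line_tendsto_0[OF p f2] by (rule tendsto_rabs_zero)
  then have "\<forall>\<^sub>F t in at_top. \<bar>f t\<bar> < \<bar>f x0\<bar>" by (rule order_tendstoD(2)) (use x0 in simp)
  then obtain X where X: "\<And>t. X \<le> t \<Longrightarrow> \<bar>f t\<bar> < \<bar>f x0\<bar>" unfolding eventually_at_top_linorder by blast
  have x0X: "x0 < X" using X[of x0] by force
  have "continuous_on {a..X} (\<lambda>t. \<bar>f t\<bar>)"
    by (intro continuous_intros continuous_on_subset[OF prim_on_continuous_half_line[OF p]]) auto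
  moreover have "{a..X} \<noteq> {}" using x0 x0X by auto
  ultimately obtain x where x: "x \<in> {a..X}" "\<And>t. t \<in> {a..X} \<Longrightarrow> \<bar>f t\<bar> \<le> \<bar>f x\<bar>"
    using continuous_attains_sup[of "{a..X}" "\<lambda>t. \<bar>f t\<bar>"] by auto
  show thesis
  proof (rule that[of x])
    fix t assume t: "a \<le> t"
    show "\<bar>f t\<bar> \<le> \<bar>f x\<bar>"
    proof (cases "t \<le> X")
      case False
      then have "\<bar>f t\<bar> < \<bar>f x0\<bar>" using X by simp
      also have "\<dots> \<le> \<bar>f x\<bar>" using x(2)[of x0] x0 x0X by simp
      finally show ?thesis by simp
    qed (use x t in auto)
  qed (use x in auto)
qed

section \<open>The calibrating weight and its primitive\<close>

locale exponents =
  fixes p q :: real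
  assumes p2: "2 < p" and p6: "p < 6" and q2: "2 < q" and q4: "q < 4" and qp: "q < p / 2 + 1"
begin

text \<open>The weight h for maximum 1. For maximum \<open>M\<close> it is
  \<open>M powr (p / 2) * calib (t / M)\<close>, see \<open>calib_scaled\<close>, so a single
  function \<open>Psi\<close> yields the primitives \<open>G M\<close> for all maxima.\<close>

definition calib :: "real \<Rightarrow> real" where
  "calib s = sqrt (2 / p * (s\<^sup>2 - s powr p))"

definition Psi :: "real \<Rightarrow> real" where
  "Psi x = integral {0..x} calib"

definition G :: "real \<Rightarrow> real \<Rightarrow> real" where
  "G M t = M powr (p / 2 + 1) * Psi (t / M)"

lemma powr_le_square: "0 \<le> s \<Longrightarrow> s \<le> 1 \<Longrightarrow> s powr p \<le> s\<^sup>2" for s :: real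
proof (cases "s = 0")
  case False
  assume s: "0 \<le> s" "s \<le> 1"
  then have "s powr p \<le> s powr 2" using p2 False by (intro powr_mono') auto
  then show ?thesis using s False by simp
qed simp

lemma calib_nonneg: "0 \<le> s \<Longrightarrow> s \<le> 1 \<Longrightarrow> 0 \<le> calib s"
  unfolding calib_def using powr_le_square[of s] p2 by simp

lemma calib_square: "0 \<le> s \<Longrightarrow> s \<le> 1 \<Longrightarrow> (calib s)\<^sup>2 = 2 / p * (s\<^sup>2 - s powr p)"
  unfolding calib_def using powr_le_square[of s] p2 by (intro real_sqrt_pow2) simp

lemma calib_le: "0 \<le> s \<Longrightarrow> s \<le> 1 \<Longrightarrow> calib s \<le> s"
proof -
  assume s: "0 \<le> s" "s \<le> 1"
  have "2 / p * (s\<^sup>2 - s powr p) \<le> 1 * s\<^sup>2"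
    using p2 powr_le_square[OF s] by (intro mult_mono) auto
  then have "calib s \<le> sqrt (s\<^sup>2)" unfolding calib_def by (intro real_sqrt_le_mono) simp
  then show ?thesis using s by simp
qed

lemma calib_continuous: "continuous_on {0..1} calib"
  unfolding calib_def[abs_def] using p2
  by (intro continuous_intros continuous_on_powr') auto

lemma calib_integrable: "0 \<le> x \<Longrightarrow> x \<le> 1 \<Longrightarrow> calib integrable_on {0..x}"
  by (intro integrable_continuous_real continuous_on_subset[OF calib_continuous]) auto

lemma Psi_deriv: "x \<in> {0..1} \<Longrightarrow> (Psi has_real_derivative calib x) (at x within {0..1})"
  unfolding Psi_def[abs_def] by (rule integral_has_real_derivative[OF calib_continuous])

lemma Psi_0 [simp]: "Psi 0 = 0"
  by (simp add: Psi_def)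

lemma Psi_nonneg: "0 \<le> x \<Longrightarrow> x \<le> 1 \<Longrightarrow> 0 \<le> Psi x"
  unfolding Psi_def by (rule Henstock_Kurzweil_Integration.integral_nonneg[OF calib_integrable]) (auto intro!: calib_nonneg)

lemma Psi_le: "0 \<le> x \<Longrightarrow> x \<le> 1 \<Longrightarrow> Psi x \<le> x"
proof -
  assume x: "0 \<le> x" "x \<le> 1"
  have "Psi x \<le> integral {0..x} (\<lambda>_. 1)" unfolding Psi_def
  proof (rule integral_le[OF calib_integrable[OF x]])
    fix s assume "s \<in> {0..x}"
    then show "calib s \<le> 1" using calib_le[of s] x by simp
  qed auto
  then show ?thesis using x by simp
qed

text \<open>Since \<open>(x * t) powr p \<le> x\<^sup>2 * t powr p\<close> for
  \<open>x \<le> 1\<close>, one has \<open>x * calib t \<le> calib (x * t)\<close>, and substitution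
  in the integral contributes a second factor \<open>x\<close>. The resulting quadratic lower bound
  for \<open>G\<close> is what lets the half-lines beat the vertex terms.\<close>

lemma Psi_scale: "0 \<le> x \<Longrightarrow> x \<le> 1 \<Longrightarrow> x\<^sup>2 * Psi 1 \<le> Psi x"
proof (cases "x = 0")
  case False
  assume "0 \<le> x" "x \<le> 1"
  with False have x: "0 < x" "x \<le> 1" by auto
  have mem: "x * t \<in> {0..1}" if "t \<in> {0..1}" for t
    using that x mult_mono[of x 1 t 1] by auto
  have "((\<lambda>t. calib (x * t) * x) has_integral (Psi (x * 1) - Psi (x * 0))) {0..1}"
  proof (rule fundamental_theorem_of_calculus)
    fix t :: real assume t: "t \<in> {0..1}"
    have "(Psi has_real_derivative calib (x * t)) (at (x * t) within (\<lambda>t. x * t) ` {0..1})"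
      by (rule DERIV_subset[OF Psi_deriv[OF mem[OF t]]]) (use mem in auto)
    moreover have "((\<lambda>t. x * t) has_real_derivative x) (at t within {0..1})"
      by (auto intro!: derivative_eq_intros)
    ultimately have "((Psi \<circ> (\<lambda>t. x * t)) has_real_derivative calib (x * t) * x) (at t within {0..1})"
      by (rule DERIV_image_chain)
    then show "((\<lambda>t. Psi (x * t)) has_vector_derivative calib (x * t) * x) (at t within {0..1})"
      by (simp add: has_real_derivative_iff_has_vector_derivative o_def)
  qed simp
  then have I: "((\<lambda>t. calib (x * t) * x) has_integral Psi x) {0..1}" by simp
  have "(calib has_integral Psi 1) {0..1}"
    unfolding Psi_def by (rule integrable_integral[OF calib_integrable]) auto
  then have "((\<lambda>t. calib t * x\<^sup>2) has_integral Psi 1 * x\<^sup>2) {0..1}" by (rule has_integral_mult_left)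
  then have "Psi 1 * x\<^sup>2 \<le> Psi x"
  proof (rule has_integral_le[OF _ I])
    fix t :: real assume t: "t \<in> {0..1}"
    have "x\<^sup>2 * (2 / p * (t\<^sup>2 - t powr p)) \<le> 2 / p * ((x * t)\<^sup>2 - (x * t) powr p)"
    proof -
      have "x powr p * t powr p \<le> x\<^sup>2 * t powr p" using powr_le_square[of x] x by (intro mult_right_mono) auto
      then have "x\<^sup>2 * (t\<^sup>2 - t powr p) \<le> (x * t)\<^sup>2 - (x * t) powr p"
        using x t by (simp add: powr_mult power_mult_distrib right_diff_distrib)
      then have "2 / p * (x\<^sup>2 * (t\<^sup>2 - t powr p)) \<le> 2 / p * ((x * t)\<^sup>2 - (x * t) powr p)"
        using p2 by (intro mult_left_mono) auto
      then show ?thesis by (simp add: mult_ac)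
    qed
    then have "sqrt (x\<^sup>2 * (2 / p * (t\<^sup>2 - t powr p))) \<le> calib (x * t)"
      unfolding calib_def by (rule real_sqrt_le_mono)
    moreover have "sqrt (x\<^sup>2 * Z) = x * sqrt Z" for Z using x by (simp add: real_sqrt_mult)
    ultimately have "x * calib t \<le> calib (x * t)" unfolding calib_def[of t] by metis
    then have "x * (x * calib t) \<le> x * calib (x * t)" using x by (intro mult_left_mono) auto
    then show "calib t * x\<^sup>2 \<le> calib (x * t) * x" by (simp add: power2_eq_square mult_ac)
  qed
  then show ?thesis by (simp add: mult.commute)
qed simp

lemma Psi_1_pos: "0 < Psi 1"
proof -
  have "0 < calib (1/2)"
  proof -
    have "(1/2::real) powr p < (1/2) powr 2" using p2 by (intro powr_less_mono') auto
    then show ?thesis using p2 by (simp add: calib_def power2_eq_square)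
  qed
  show ?thesis
  proof (rule ccontr)
    assume "\<not> 0 < Psi 1"
    then have "integral {0..1} calib = 0" using Psi_nonneg[of 1] by (simp add: Psi_def)
    then have "\<forall>x\<in>{0..1}. calib x = 0"
      using integral_eq_0_iff[OF calib_continuous] calib_nonneg by auto
    with \<open>0 < calib (1/2)\<close> show False by auto
  qed
qed

lemma G_nonneg: "0 \<le> t \<Longrightarrow> t \<le> M \<Longrightarrow> 0 \<le> G M t"
  unfolding G_def by (cases "M = 0") (auto intro!: mult_nonneg_nonneg Psi_nonneg simp: divide_simps)

lemma G_self: "0 < M \<Longrightarrow> G M M = M powr (p / 2 + 1) * Psi 1"
  by (simp add: G_def)

lemma G_le: "0 \<le> t \<Longrightarrow> t \<le> M \<Longrightarrow> 0 < M \<Longrightarrow> G M t \<le> M powr (p / 2) * t"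
proof -
  assume t: "0 \<le> t" "t \<le> M" "0 < M"
  have "G M t \<le> M powr (p / 2 + 1) * (t / M)" unfolding G_def
    using t by (intro mult_left_mono Psi_le) auto
  also have "\<dots> = M powr (p / 2) * t" using t by (simp add: powr_add)
  finally show ?thesis .
qed

lemma G_ge: "0 \<le> t \<Longrightarrow> t \<le> M \<Longrightarrow> 0 < M \<Longrightarrow> M powr (p / 2 - 1) * Psi 1 * t\<^sup>2 \<le> G M t"
proof -
  assume t: "0 \<le> t" "t \<le> M" "0 < M"
  have "M powr (p / 2 + 1) * ((t / M)\<^sup>2 * Psi 1) \<le> G M t" unfolding G_def
    using t by (intro mult_left_mono Psi_scale) auto
  moreover have "M powr (p / 2 + 1) = M powr (p / 2 - 1) * M\<^sup>2"
    using t powr_add[of M "p / 2 - 1" 2] by (simp add: add.commute)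
  ultimately show ?thesis using t by (simp add: power_divide mult_ac)
qed

text \<open>The energy density of an edge plus the multiple of the mass density that makes it
  nonnegative up to level \<open>M\<close>; by \<open>calib_scaled\<close> it is the integrand on
  the right of the calibration inequality.\<close>

definition dens :: "real \<Rightarrow> (real \<Rightarrow> real) \<Rightarrow> (real \<Rightarrow> real) \<Rightarrow> real \<Rightarrow> real" where
  "dens M f g t = (g t)\<^sup>2 / 2 + (M powr (p - 2) * (f t)\<^sup>2 - \<bar>f t\<bar> powr p) / p"

lemma powr_abs_le: "\<bar>x\<bar> \<le> M \<Longrightarrow> \<bar>x\<bar> powr p \<le> M powr (p - 2) * x\<^sup>2" for x M :: real
proof (cases "x = 0")
  case False
  assume x: "\<bar>x\<bar> \<le> M"
  have "\<bar>x\<bar> powr p = \<bar>x\<bar> powr (p - 2) * \<bar>x\<bar> powr 2"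
    using powr_add[of "\<bar>x\<bar>" "p - 2" 2] by simp
  also have "\<bar>x\<bar> powr 2 = x\<^sup>2" using False by simp
  also have "\<bar>x\<bar> powr (p - 2) * x\<^sup>2 \<le> M powr (p - 2) * x\<^sup>2"
    using x p2 by (intro mult_right_mono powr_mono2) auto
  finally show ?thesis .
qed simp

lemma dens_nonneg: "\<bar>f t\<bar> \<le> M \<Longrightarrow> 0 \<le> dens M f g t"
  unfolding dens_def using powr_abs_le[of "f t" M] p2 by simp

lemma DERIV_G:
  assumes M: "0 < M" and t: "t \<in> {0..M}"
  shows "(G M has_real_derivative M powr (p / 2) * calib (t / M)) (at t within {0..M})"
proof -
  have mem: "t / M \<in> {0..1}" if "t \<in> {0..M}" for t using that M by auto
  have "(Psi has_real_derivative calib (t / M)) (at (t / M) within (\<lambda>t. t / M) ` {0..M})"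
    by (rule DERIV_subset[OF Psi_deriv[OF mem[OF t]]]) (use mem in auto)
  moreover have "((\<lambda>t. t / M) has_real_derivative 1 / M) (at t within {0..M})"
    using M by (auto intro!: derivative_eq_intros)
  ultimately have "((Psi \<circ> (\<lambda>t. t / M)) has_real_derivative calib (t / M) * (1 / M)) (at t within {0..M})"
    by (rule DERIV_image_chain)
  from DERIV_cmult[OF this, of "M powr (p / 2 + 1)"]
  show ?thesis using M by (simp add: G_def[abs_def] o_def powr_add)
qed

lemma calib_scaled:
  assumes M: "0 < M"
  shows "continuous_on {0..M} (\<lambda>t. M powr (p / 2) * calib (t / M))"
    "\<And>t. t \<in> {0..M} \<Longrightarrow> 0 \<le> M powr (p / 2) * calib (t / M)"
    "\<And>t. t \<in> {0..M} \<Longrightarrow> M powr (p / 2) * calib (t / M) \<le> M powr (p / 2 - 1) * t"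
    "\<And>f g t. \<bar>f t\<bar> \<le> M \<Longrightarrow> ((g t)\<^sup>2 + (M powr (p / 2) * calib (\<bar>f t\<bar> / M))\<^sup>2) / 2 = dens M f g t"
proof -
  have mem: "t / M \<in> {0..1}" if "t \<in> {0..M}" for t using that M by auto
  show "continuous_on {0..M} (\<lambda>t. M powr (p / 2) * calib (t / M))"
    by (intro continuous_intros continuous_on_compose2[OF calib_continuous]) (use M mem in auto)
  show "\<And>t. t \<in> {0..M} \<Longrightarrow> 0 \<le> M powr (p / 2) * calib (t / M)"
    using mem by (auto intro!: mult_nonneg_nonneg calib_nonneg)
  show "M powr (p / 2) * calib (t / M) \<le> M powr (p / 2 - 1) * t" if t: "t \<in> {0..M}" for t
  proof -
    have "M powr (p / 2) * calib (t / M) \<le> M powr (p / 2) * (t / M)"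
      using mem[OF t] by (intro mult_left_mono calib_le) auto
    then show ?thesis using M by (simp add: powr_diff)
  qed
  fix f g :: "real \<Rightarrow> real" and t :: real assume f: "\<bar>f t\<bar> \<le> M"
  have m: "\<bar>f t\<bar> / M \<in> {0..1}" using f by (intro mem) auto
  have "(M powr (p / 2) * calib (\<bar>f t\<bar> / M))\<^sup>2 = (M powr (p / 2))\<^sup>2 * (2 / p * ((\<bar>f t\<bar> / M)\<^sup>2 - (\<bar>f t\<bar> / M) powr p))"
    unfolding power_mult_distrib using calib_square m by simp
  also have "(M powr (p / 2))\<^sup>2 = M powr p" by (simp add: power2_eq_square flip: powr_add)
  also have "M powr p * (2 / p * ((\<bar>f t\<bar> / M)\<^sup>2 - (\<bar>f t\<bar> / M) powr p))
      = 2 / p * (M powr p / M\<^sup>2 * (f t)\<^sup>2 - \<bar>f t\<bar> powr p)"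
    using M by (simp add: powr_divide power_divide right_diff_distrib field_simps)
  also have "M powr p / M\<^sup>2 = M powr (p - 2)" using M by (simp add: powr_diff)
  finally show "((g t)\<^sup>2 + (M powr (p / 2) * calib (\<bar>f t\<bar> / M))\<^sup>2) / 2 = dens M f g t"
    by (simp add: dens_def add_divide_distrib diff_divide_distrib)
qed

lemma calibrated_interval:
  assumes pr: "prim_on {a..b} f g" and ab: "a \<le> b" and M: "0 < M" "\<And>t. t \<in> {a..b} \<Longrightarrow> \<bar>f t\<bar> \<le> M"
  shows "abs (G M \<bar>f b\<bar> - G M \<bar>f a\<bar>) \<le> integral {a..b} (dens M f g)" "dens M f g integrable_on {a..b}"
proof -
  define h where "h t = M powr (p / 2) * calib (t / M)" for t
  have hc: "continuous_on {0..M} h" unfolding h_def[abs_def] by (rule calib_scaled(1)[OF M(1)])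
  have hn: "0 \<le> h t" if "t \<in> {0..M}" for t unfolding h_def by (rule calib_scaled(2)[OF M(1) that])
  have hG: "(G M has_real_derivative h t) (at t within {0..M})" if "t \<in> {0..M}" for t
    unfolding h_def by (rule DERIV_G[OF M(1) that])
  have eq: "((g t)\<^sup>2 + (h \<bar>f t\<bar>)\<^sup>2) / 2 = dens M f g t" if "t \<in> {a..b}" for t
    unfolding h_def by (rule calib_scaled(4)[OF M(1), where f = f and g = g, OF M(2)[OF that]])
  have c: "abs (G M \<bar>f b\<bar> - G M \<bar>f a\<bar>) \<le> integral {a..b} (\<lambda>t. ((g t)\<^sup>2 + (h \<bar>f t\<bar>)\<^sup>2) / 2)"
    "(\<lambda>t. ((g t)\<^sup>2 + (h \<bar>f t\<bar>)\<^sup>2) / 2) integrable_on {a..b}"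
    by (rule calibration[OF pr ab M(2) hc hn hG]; assumption)+
  show "dens M f g integrable_on {a..b}" by (rule integrable_eq[OF c(2)]) (rule eq)
  have "integral {a..b} (\<lambda>t. ((g t)\<^sup>2 + (h \<bar>f t\<bar>)\<^sup>2) / 2) = integral {a..b} (dens M f g)"
    by (rule Henstock_Kurzweil_Integration.integral_cong) (rule eq)
  then show "abs (G M \<bar>f b\<bar> - G M \<bar>f a\<bar>) \<le> integral {a..b} (dens M f g)" using c(1) by simp
qed

definition J :: "real set \<Rightarrow> (real \<Rightarrow> real) \<Rightarrow> (real \<Rightarrow> real) \<Rightarrow> real" where
  "J S f g = integral S (\<lambda>t. (g t)\<^sup>2) / 2 - integral S (\<lambda>t. \<bar>f t\<bar> powr p) / p"

lemma powr_integrable: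
  fixes f :: "real \<Rightarrow> real"
  assumes "continuous_on S f" "(\<lambda>t. (f t)\<^sup>2) integrable_on S" "S \<in> sets borel" "\<And>t. t \<in> S \<Longrightarrow> \<bar>f t\<bar> \<le> M"
  shows "(\<lambda>t. \<bar>f t\<bar> powr p) integrable_on S"
proof (rule integrable_on_dominated_continuous[OF _ _ assms(3)])
  show "continuous_on S (\<lambda>t. \<bar>f t\<bar> powr p)"
    using p2 assms(1) by (intro continuous_on_powr' continuous_intros) auto
  show "(\<lambda>t. M powr (p - 2) * (f t)\<^sup>2) integrable_on S" by (rule integrable_on_mult_right[OF assms(2)])
  show "\<bar>\<bar>f t\<bar> powr p\<bar> \<le> M powr (p - 2) * (f t)\<^sup>2" if "t \<in> S" for t
    using powr_abs_le[OF assms(4)[OF that]] by simp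
qed

lemma dens_integral:
  assumes "prim_on S f g" "continuous_on S f" "(\<lambda>t. (f t)\<^sup>2) integrable_on S" "S \<in> sets borel"
    "\<And>t. t \<in> S \<Longrightarrow> \<bar>f t\<bar> \<le> M"
  shows "dens M f g integrable_on S"
    "integral S (dens M f g) = J S f g + M powr (p - 2) / p * integral S (\<lambda>t. (f t)\<^sup>2)"
proof -
  have g: "((\<lambda>t. (g t)\<^sup>2) has_integral integral S (\<lambda>t. (g t)\<^sup>2)) S"
    using assms(1) by (simp add: prim_on_def has_integral_iff)
  have f: "((\<lambda>t. (f t)\<^sup>2) has_integral integral S (\<lambda>t. (f t)\<^sup>2)) S" using assms(3) by (simp add: has_integral_iff)
  have P: "((\<lambda>t. \<bar>f t\<bar> powr p) has_integral integral S (\<lambda>t. \<bar>f t\<bar> powr p)) S"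
    using powr_integrable[OF assms(2-5)] by (simp add: has_integral_iff)
  have "(dens M f g has_integral (integral S (\<lambda>t. (g t)\<^sup>2) / 2
     + (M powr (p - 2) * integral S (\<lambda>t. (f t)\<^sup>2) - integral S (\<lambda>t. \<bar>f t\<bar> powr p)) / p)) S"
    unfolding dens_def[abs_def]
    by (intro has_integral_add has_integral_divide has_integral_diff has_integral_mult_right g f P)
  then show "dens M f g integrable_on S"
    "integral S (dens M f g) = J S f g + M powr (p - 2) / p * integral S (\<lambda>t. (f t)\<^sup>2)"
    by (auto simp: has_integral_iff J_def diff_divide_distrib)
qed

text \<open>All levels below \<open>\<bar>f b\<bar>\<close> are crossed on the way to infinity; a
  point where \<open>f\<close> is small stands in for infinity.\<close>

lemma half_line_calibrated:
  assumes pr: "prim_on {b..} f g" and f2: "(\<lambda>t. (f t)\<^sup>2) integrable_on {b..}"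
    and M: "0 < M" "\<And>t. b \<le> t \<Longrightarrow> \<bar>f t\<bar> \<le> M"
  shows "G M \<bar>f b\<bar> \<le> integral {b..} (dens M f g)"
proof (rule field_le_epsilon)
  fix e :: real assume e: "0 < e"
  have fc: "continuous_on {b..} f" by (rule prim_on_continuous_half_line[OF pr])
  obtain y where y: "b \<le> y" "\<bar>f y\<bar> < e / M powr (p / 2)"
    using half_line_small_value[OF f2, of "e / M powr (p / 2)"] e M by auto
  have di: "dens M f g integrable_on {b..}" by (rule dens_integral(1)[OF pr fc f2]) (use M in auto)
  have "G M \<bar>f y\<bar> \<le> M powr (p / 2) * \<bar>f y\<bar>" by (rule G_le) (use M y in auto)
  also have "\<dots> \<le> e" using y(2) M(1) by (simp add: pos_less_divide_eq mult.commute)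
  finally have 1: "G M \<bar>f y\<bar> \<le> e" .
  have pby: "prim_on {b..y} f g" by (rule prim_on_subset[OF pr]) auto
  have c: "abs (G M \<bar>f y\<bar> - G M \<bar>f b\<bar>) \<le> integral {b..y} (dens M f g)" "dens M f g integrable_on {b..y}"
    by (rule calibrated_interval[OF pby y(1) M(1)]; use M in simp)+
  have "integral {b..y} (dens M f g) \<le> integral {b..} (dens M f g)"
    by (rule integral_subset_le) (use c di M in \<open>auto intro!: dens_nonneg\<close>)
  then show "G M \<bar>f b\<bar> \<le> integral {b..} (dens M f g) + e" using 1 c(1) by linarith
qed

text \<open>Levels between \<open>\<bar>f b\<bar>\<close> and \<open>M\<close> are crossed on the
  way up and on the way down, those below \<open>\<bar>f b\<bar>\<close> at least on the way
  down.\<close>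

lemma half_line_calibrated_max:
  assumes pr: "prim_on {b..} f g" and f2: "(\<lambda>t. (f t)\<^sup>2) integrable_on {b..}"
    and M: "0 < M" "\<And>t. b \<le> t \<Longrightarrow> \<bar>f t\<bar> \<le> M" and x: "b \<le> x" "\<bar>f x\<bar> = M"
  shows "2 * G M M - G M \<bar>f b\<bar> \<le> integral {b..} (dens M f g)"
proof -
  have fc: "continuous_on {b..} f" by (rule prim_on_continuous_half_line[OF pr])
  have di: "dens M f g integrable_on {b..}" by (rule dens_integral(1)[OF pr fc f2]) (use M in auto)
  have pbx: "prim_on {b..x} f g" and px: "prim_on {x..} f g"
    using prim_on_subset[OF pr, of "{b..x}"] prim_on_subset[OF pr, of "{x..}"] x by auto
  have "abs (G M \<bar>f x\<bar> - G M \<bar>f b\<bar>) \<le> integral {b..x} (dens M f g)"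
    by (rule calibrated_interval(1)[OF pbx x(1) M(1)]) (use M in simp)
  moreover have "G M \<bar>f x\<bar> \<le> integral {x..} (dens M f g)"
    by (rule half_line_calibrated[OF px _ M(1)]) (use f2 x M integrable_on_subset_nonneg[OF f2, of "{x..}"] in auto)
  moreover have "integral {b..} (dens M f g) = integral {b..x} (dens M f g) + integral {x..} (dens M f g)"
    by (rule integral_half_line_split(1)[OF di _ x(1)]) (use M in \<open>auto intro: dens_nonneg\<close>)
  ultimately show ?thesis unfolding x(2) by linarith
qed

text \<open>Lower bound for the energy on the line of a function with mass \<open>\<mu>\<close> and
  maximum \<open>M\<close>: an ascent and a descent at the price \<open>G M M\<close> each, minus
  the mass term that \<open>dens\<close> has added. At the height of the soliton of mass
  \<open>\<mu>\<close> it is the energy of the line, see \<open>elin_min\<close> and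
  \<open>elin_sol\<close>.\<close>

definition elin :: "real \<Rightarrow> real \<Rightarrow> real" where
  "elin M \<mu> = 2 * Psi 1 * M powr (p / 2 + 1) - M powr (p - 2) * \<mu> / p"

text \<open>Mass escaping along a half-line costs at least its share of the energy of the line.\<close>

lemma half_line_far:
  assumes pr: "prim_on {b..} f g" and f2: "(\<lambda>t. (f t)\<^sup>2) integrable_on {b..}"
    and A: "\<And>t. b \<le> t \<Longrightarrow> \<bar>f t\<bar> \<le> A"
    and mu: "integral {b..} (\<lambda>t. (f t)\<^sup>2) \<le> \<mu>"
    and L: "\<And>M \<nu>. 0 < M \<Longrightarrow> 0 \<le> \<nu> \<Longrightarrow> \<nu> \<le> \<mu> \<Longrightarrow> - L * \<nu> \<le> elin M \<nu>"
  shows "- (A powr (p / 2) * \<bar>f b\<bar>) \<le> J {b..} f g + L * integral {b..} (\<lambda>t. (f t)\<^sup>2)"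
proof -
  have fc: "continuous_on {b..} f" by (rule prim_on_continuous_half_line[OF pr])
  obtain x where x: "b \<le> x" "\<And>t. b \<le> t \<Longrightarrow> \<bar>f t\<bar> \<le> \<bar>f x\<bar>" using half_line_attains_max[OF pr f2] by metis
  define M where "M = \<bar>f x\<bar>"
  define \<nu> where "\<nu> = integral {b..} (\<lambda>t. (f t)\<^sup>2)"
  show ?thesis
  proof (cases "M = 0")
    case True
    then have z: "f t = 0" if "b \<le> t" for t using x(2)[OF that] by (simp add: M_def)
    have "integral {b..} (\<lambda>t. \<bar>f t\<bar> powr p) = integral {b..} (\<lambda>t. 0)" "integral {b..} (\<lambda>t. (f t)\<^sup>2) = integral {b..} (\<lambda>t. 0)"
      by (rule Henstock_Kurzweil_Integration.integral_cong; simp add: z)+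
    moreover have "0 \<le> integral {b..} (\<lambda>t. (g t)\<^sup>2)"
      using pr by (auto simp: prim_on_def intro: Henstock_Kurzweil_Integration.integral_nonneg)
    ultimately show ?thesis by (simp add: J_def z)
  next
    case False
    then have M: "0 < M" by (simp add: M_def)
    have nu: "0 \<le> \<nu>" unfolding \<nu>_def by (rule Henstock_Kurzweil_Integration.integral_nonneg[OF f2]) simp
    have "2 * G M M - G M \<bar>f b\<bar> \<le> integral {b..} (dens M f g)"
      by (rule half_line_calibrated_max[OF pr f2 M _ x(1)]) (use x(2) in \<open>auto simp: M_def\<close>)
    also have "\<dots> = J {b..} f g + M powr (p - 2) / p * \<nu>"
      unfolding \<nu>_def by (rule dens_integral(2)[OF pr fc f2]) (use x(2) in \<open>auto simp: M_def\<close>)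
    finally have 1: "elin M \<nu> - G M \<bar>f b\<bar> \<le> J {b..} f g"
      using G_self[OF M] by (simp add: elin_def algebra_simps)
    have "G M \<bar>f b\<bar> \<le> M powr (p / 2) * \<bar>f b\<bar>" by (rule G_le) (use x(2)[of b] M in \<open>auto simp: M_def\<close>)
    also have "\<dots> \<le> A powr (p / 2) * \<bar>f b\<bar>"
      using A[OF x(1)] M p2 by (intro mult_right_mono powr_mono2) (auto simp: M_def)
    finally show ?thesis using 1 L[OF M nu] mu unfolding \<nu>_def by linarith
  qed
qed

section \<open>Lower semicontinuity of the energy along an edge\<close>

lemma kinetic_unique:
  assumes "prim_on {0..b} f g" "prim_on {0..b} f h" "0 < b"
  shows "integral {0..b} (\<lambda>t. (g t)\<^sup>2) = integral {0..b} (\<lambda>t. (h t)\<^sup>2)"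
proof -
  have D: "edge_domain {0<..<b} {0..b}" using assms(3) unfolding edge_domain_def by blast
  have fc: "continuous_on {0..b} f" by (rule prim_on_continuous_interval[OF assms(1)])
  have f2: "(\<lambda>t. (f t)\<^sup>2) integrable_on {0..b}" by (intro integrable_continuous_real continuous_intros fc)
  show ?thesis
    using weak_deriv_of_prim_on(3)[OF D fc assms(1) f2] weak_deriv_of_prim_on(3)[OF D fc assms(2) f2] by simp
qed

text \<open>A subsequence with less kinetic energy would, by \<open>prim_on_limit\<close>, provide
  \<open>F\<close> with a derivative of smaller norm than \<open>H\<close>; but by
  \<open>kinetic_unique\<close> all derivatives of \<open>F\<close> have the same norm.\<close>

lemma kinetic_lsc:
  assumes pr: "\<And>n. prim_on {0..b} (f n) (g n)" and lim: "\<And>t. t \<in> {0..b} \<Longrightarrow> (\<lambda>n. f n t) \<longlonglongrightarrow> F t"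
    and F: "prim_on {0..b} F H" and b: "0 < b" and e: "0 < e"
  shows "\<forall>\<^sub>F n in sequentially. integral {0..b} (\<lambda>t. (H t)\<^sup>2) - e \<le> integral {0..b} (\<lambda>t. (g n t)\<^sup>2)"
proof (rule ccontr)
  assume "\<not> ?thesis"
  then obtain r :: "nat \<Rightarrow> nat" where r: "strict_mono r"
    "\<And>n. \<not> integral {0..b} (\<lambda>t. (H t)\<^sup>2) - e \<le> integral {0..b} (\<lambda>t. (g (r n) t)\<^sup>2)"
    using not_eventually_sequentiallyD by blast
  obtain h where h: "prim_on {0..b} F h" "integral {0..b} (\<lambda>t. (h t)\<^sup>2) \<le> integral {0..b} (\<lambda>t. (H t)\<^sup>2) - e"
  proof (rule prim_on_limit[of "{0..b}" "\<lambda>n. f (r n)" "\<lambda>n. g (r n)" F "integral {0..b} (\<lambda>t. (H t)\<^sup>2) - e"])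
    show "(\<lambda>n. f (r n) t) \<longlonglongrightarrow> F t" if "t \<in> {0..b}" for t
      using LIMSEQ_subseq_LIMSEQ[OF lim[OF that] r(1)] by (simp add: o_def)
    show "integral {0..b} (\<lambda>t. (g (r n) t)\<^sup>2) \<le> integral {0..b} (\<lambda>t. (H t)\<^sup>2) - e" for n
      using r(2)[of n] by simp
  qed (use pr in auto)
  show False using kinetic_unique[OF F h(1) b] h(2) e by simp
qed

lemma lsc_interval:
  assumes pr: "\<And>n. prim_on {0..b} (f n) (g n)" and lim: "\<And>t. t \<in> {0..b} \<Longrightarrow> (\<lambda>n. f n t) \<longlonglongrightarrow> F t"
    and F: "prim_on {0..b} F H" and b: "0 < b" and e: "0 < e"
    and A: "\<And>n t. t \<in> {0..b} \<Longrightarrow> \<bar>f n t\<bar> \<le> A"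
  shows "\<forall>\<^sub>F n in sequentially. J {0..b} F H + L * integral {0..b} (\<lambda>t. (F t)\<^sup>2) - e
    \<le> J {0..b} (f n) (g n) + L * integral {0..b} (\<lambda>t. (f n t)\<^sup>2)"
proof -
  have c: "continuous_on {0..b} (f n)" for n by (rule prim_on_continuous_interval[OF pr])
  have "(\<lambda>n. integral {0..b} (\<lambda>t. (f n t)\<^sup>2)) \<longlonglongrightarrow> integral {0..b} (\<lambda>t. (F t)\<^sup>2)"
  proof (rule dominated_convergence(2)[where h = "\<lambda>_. A\<^sup>2"])
    show "norm ((f n t)\<^sup>2) \<le> A\<^sup>2" if "t \<in> {0..b}" for n t
      using power_mono[OF A[OF that], of n 2] by simp
  qed (use c lim in \<open>auto intro!: integrable_continuous_real continuous_intros tendsto_intros\<close>)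
  moreover have "(\<lambda>n. integral {0..b} (\<lambda>t. \<bar>f n t\<bar> powr p)) \<longlonglongrightarrow> integral {0..b} (\<lambda>t. \<bar>F t\<bar> powr p)"
  proof (rule dominated_convergence(2)[where h = "\<lambda>_. A powr p"])
    show "norm (\<bar>f n t\<bar> powr p) \<le> A powr p" if "t \<in> {0..b}" for n t
      using powr_mono2[OF _ _ A[OF that], of p] p2 by simp
    show "(\<lambda>t. \<bar>f n t\<bar> powr p) integrable_on {0..b}" for n
      using p2 by (intro integrable_continuous_real continuous_on_powr' continuous_intros c) auto
    show "(\<lambda>n. \<bar>f n t\<bar> powr p) \<longlonglongrightarrow> \<bar>F t\<bar> powr p" if "t \<in> {0..b}" for t
      using p2 by (intro tendsto_powr' tendsto_intros lim[OF that]) auto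
  qed auto
  ultimately have "(\<lambda>n. L * integral {0..b} (\<lambda>t. (f n t)\<^sup>2) - integral {0..b} (\<lambda>t. \<bar>f n t\<bar> powr p) / p)
      \<longlonglongrightarrow> L * integral {0..b} (\<lambda>t. (F t)\<^sup>2) - integral {0..b} (\<lambda>t. \<bar>F t\<bar> powr p) / p"
    using p2 by (intro tendsto_intros) auto
  then have P: "\<forall>\<^sub>F n in sequentially. L * integral {0..b} (\<lambda>t. (F t)\<^sup>2) - integral {0..b} (\<lambda>t. \<bar>F t\<bar> powr p) / p - e / 2
     < L * integral {0..b} (\<lambda>t. (f n t)\<^sup>2) - integral {0..b} (\<lambda>t. \<bar>f n t\<bar> powr p) / p"
    by (rule order_tendstoD(1)) (use e in simp)
  have "\<forall>\<^sub>F n in sequentially. integral {0..b} (\<lambda>t. (H t)\<^sup>2) - e \<le> integral {0..b} (\<lambda>t. (g n t)\<^sup>2)"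
    by (rule kinetic_lsc[OF pr lim F b e])
  with P show ?thesis
    by eventually_elim (simp add: J_def field_simps)
qed

text \<open>The half-line is cut at a point \<open>b\<close> beyond which \<open>F\<close>
  contributes little and where \<open>F\<close> is small. Up to \<open>b\<close> the case of an
  interval applies. Beyond \<open>b\<close> mass may escape, and \<open>half_line_far\<close> bounds
  what it can gain once each unit is charged with \<open>L\<close>, up to an error controlled by the
  value at \<open>b\<close>.\<close>

lemma lsc_half_line:
  assumes pr: "\<And>n. prim_on {0..} (f n) (g n)" and lim: "\<And>t. 0 \<le> t \<Longrightarrow> (\<lambda>n. f n t) \<longlonglongrightarrow> F t"
    and F: "prim_on {0..} F H" "(\<lambda>t. (F t)\<^sup>2) integrable_on {0..}"
    and f2: "\<And>n. (\<lambda>t. (f n t)\<^sup>2) integrable_on {0..}"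
    and A: "\<And>n t. 0 \<le> t \<Longrightarrow> \<bar>f n t\<bar> \<le> A"
    and mu: "\<And>n. integral {0..} (\<lambda>t. (f n t)\<^sup>2) \<le> \<mu>"
    and L: "\<And>M \<nu>. 0 < M \<Longrightarrow> 0 \<le> \<nu> \<Longrightarrow> \<nu> \<le> \<mu> \<Longrightarrow> - L * \<nu> \<le> elin M \<nu>"
    and e: "0 < e"
  shows "\<forall>\<^sub>F n in sequentially. J {0..} F H + L * integral {0..} (\<lambda>t. (F t)\<^sup>2) - e
    \<le> J {0..} (f n) (g n) + L * integral {0..} (\<lambda>t. (f n t)\<^sup>2)"
proof -
  have FA: "\<bar>F t\<bar> \<le> A" if "0 \<le> t" for t
    by (rule LIMSEQ_le_const2[OF tendsto_rabs[OF lim[OF that]]]) (use A that in auto)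
  have Fc: "continuous_on {0..} F" by (rule prim_on_continuous_half_line[OF F(1)])
  have fc: "continuous_on {0..} (f n)" for n by (rule prim_on_continuous_half_line[OF pr])
  have Fp: "(\<lambda>t. \<bar>F t\<bar> powr p) integrable_on {0..}" by (rule powr_integrable[OF Fc F(2)]) (use FA in auto)
  have fp: "(\<lambda>t. \<bar>f n t\<bar> powr p) integrable_on {0..}" for n by (rule powr_integrable[OF fc f2]) (use A in auto)
  have H2: "(\<lambda>t. (H t)\<^sup>2) integrable_on {0..}" using F(1) by (simp add: prim_on_def)
  have g2: "(\<lambda>t. (g n t)\<^sup>2) integrable_on {0..}" for n using pr[of n] by (simp add: prim_on_def)
  have "((\<lambda>b. J {0..b} F H + L * integral {0..b} (\<lambda>t. (F t)\<^sup>2)) \<longlongrightarrow> J {0..} F H + L * integral {0..} (\<lambda>t. (F t)\<^sup>2)) at_top"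
    unfolding J_def using p2 by (intro tendsto_intros tendsto_integral_at_top H2 Fp F(2)) auto
  then have 1: "\<forall>\<^sub>F b in at_top. J {0..} F H + L * integral {0..} (\<lambda>t. (F t)\<^sup>2) - e / 3 < J {0..b} F H + L * integral {0..b} (\<lambda>t. (F t)\<^sup>2)"
    by (rule order_tendstoD(1)) (use e in simp)
  have "((\<lambda>b. A powr (p / 2) * \<bar>F b\<bar>) \<longlongrightarrow> A powr (p / 2) * \<bar>0\<bar>) at_top"
    by (intro tendsto_intros half_line_tendsto_0[OF F])
  then have 2: "\<forall>\<^sub>F b in at_top. A powr (p / 2) * \<bar>F b\<bar> < e / 3"
    by (rule order_tendstoD(2)) (use e in simp)
  from eventually_conj[OF eventually_conj[OF 1 2] eventually_gt_at_top[of 0]]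
  obtain b where b: "0 < b" "A powr (p / 2) * \<bar>F b\<bar> < e / 3"
    "J {0..} F H + L * integral {0..} (\<lambda>t. (F t)\<^sup>2) - e / 3 < J {0..b} F H + L * integral {0..b} (\<lambda>t. (F t)\<^sup>2)"
    using eventually_happens'[OF trivial_limit_at_top_linorder] by blast
  have pb: "prim_on {0..b} (f n) (g n)" "prim_on {b..} (f n) (g n)" for n
    using prim_on_subset[OF pr[of n], of "{0..b}"] prim_on_subset[OF pr[of n], of "{b..}"] b(1) by auto
  have Fb: "prim_on {0..b} F H" by (rule prim_on_subset[OF F(1)]) auto
  have 3: "\<forall>\<^sub>F n in sequentially. J {0..b} F H + L * integral {0..b} (\<lambda>t. (F t)\<^sup>2) - e / 3
    \<le> J {0..b} (f n) (g n) + L * integral {0..b} (\<lambda>t. (f n t)\<^sup>2)"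
    by (rule lsc_interval[OF pb(1) _ Fb b(1)]) (use lim A e in auto)
  have "(\<lambda>n. A powr (p / 2) * \<bar>f n b\<bar>) \<longlonglongrightarrow> A powr (p / 2) * \<bar>F b\<bar>"
    by (intro tendsto_intros lim) (use b in simp)
  then have 4: "\<forall>\<^sub>F n in sequentially. A powr (p / 2) * \<bar>f n b\<bar> < e / 3" by (rule order_tendstoD(2)[OF _ b(2)])
  from 3 4 show ?thesis
  proof eventually_elim
    case (elim n)
    note s = integral_half_line_split[OF f2[of n], of b] integral_half_line_split[OF g2[of n], of b]
      integral_half_line_split[OF fp[of n], of b]
    have nn: "0 \<le> integral {0..b} (\<lambda>t. (f n t)\<^sup>2)"
      using s(2) b(1) by (intro Henstock_Kurzweil_Integration.integral_nonneg) auto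
    have "- (A powr (p / 2) * \<bar>f n b\<bar>) \<le> J {b..} (f n) (g n) + L * integral {b..} (\<lambda>t. (f n t)\<^sup>2)"
      by (rule half_line_far[OF pb(2) _ _ _ L]) (use s b A mu[of n] nn in auto)
    moreover have "J {0..} (f n) (g n) = J {0..b} (f n) (g n) + J {b..} (f n) (g n)"
      using s b(1) by (simp add: J_def add_divide_distrib)
    moreover have "L * integral {0..} (\<lambda>t. (f n t)\<^sup>2) = L * integral {0..b} (\<lambda>t. (f n t)\<^sup>2) + L * integral {b..} (\<lambda>t. (f n t)\<^sup>2)"
      using s b(1) by (simp add: distrib_left)
    ultimately show ?case using elim b(3) by linarith
  qed
qed

end

section \<open>A loop with half-lines\<close>

text \<open>The edges 0 and 1 both run from vertex 0 to vertex 1, so \<open>origin\<close> and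
  \<open>terminus\<close> can be constant; together they form a loop of length \<open>2 * l\<close>
  at vertex 0, with vertex 1 in its middle. The edges from 2 on are half-lines, for which
  \<open>terminus\<close> has no meaning.\<close>

definition loop_graph :: "nat \<Rightarrow> real \<Rightarrow> (nat, nat) mgraph" where
  "loop_graph N l = \<lparr>vertices = {0, 1}, edges = {..<N + 2}, origin = (\<lambda>_. 0), terminus = (\<lambda>_. 1),
     len = (\<lambda>e. if e < 2 then ereal l else \<infinity>)\<rparr>"

lemma loop_graph_simps [simp]:
  "vertices (loop_graph N l) = {0, 1}" "edges (loop_graph N l) = {..<N + 2}"
  "origin (loop_graph N l) e = 0" "terminus (loop_graph N l) e = 1"
  "len (loop_graph N l) e = (if e < 2 then ereal l else \<infinity>)"
  by (simp_all add: loop_graph_def)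

lemma half_lines_loop_graph: "half_lines (loop_graph N l) = {2..<N + 2}"
  by (auto simp: half_lines_def)

lemma bounded_edges_loop_graph: "bounded_edges (loop_graph N l) = {0, 1}"
  by (auto simp: bounded_edges_def)

lemma metric_graph_loop_graph: "0 < l \<Longrightarrow> metric_graph (loop_graph N l)"
proof -
  assume l: "0 < l"
  have adj: "adjacency (loop_graph N l) = {(0, 1), (1, 0)}"
    by (auto simp: adjacency_def bounded_edges_loop_graph)
  have "(v, w) \<in> {(0, 1), (1, 0)}\<^sup>*" if "v \<in> {0, 1}" "w \<in> {0, 1}" for v w :: nat
    using that by auto
  then show ?thesis using l by (auto simp: metric_graph_def bounded_edges_loop_graph adj)
qed

lemma vertex_degree_loop_graph: "vertex_degree (loop_graph N l) 1 = 2"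
proof -
  have "{e \<in> bounded_edges (loop_graph N l). terminus (loop_graph N l) e = 1} = {0, 1}"
    by (auto simp: bounded_edges_loop_graph)
  then show ?thesis unfolding vertex_degree_def by (simp only:) simp
qed

lemma trail_loop_graph:
  assumes "0 < l" "2 \<le> h" "2 \<le> k" "h \<noteq> k" "h < N + 2" "k < N + 2"
  shows "trail (loop_graph N l) [(h, False), (0, True), (1, False), (k, True)]"
  unfolding trail_def
proof (intro conjI allI impI)
  fix i assume "Suc i < length [(h, False), (0, True), (1::nat, False), (k, True)]"
  then have "i = 0 \<or> i = 1 \<or> i = 2" by auto
  then show "finish_of (loop_graph N l) ([(h, False), (0, True), (1, False), (k, True)] ! i) \<noteq> None"
    "finish_of (loop_graph N l) ([(h, False), (0, True), (1, False), (k, True)] ! i)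
      = start_of (loop_graph N l) ([(h, False), (0, True), (1, False), (k, True)] ! Suc i)"
    by (auto simp: edge_end_def)
qed (use assms in auto)

text \<open>A trail that comes in along one half-line, runs once round the loop and leaves along
  another contains the loop; one of its two half-lines is chosen to be the edge of the given point,
  if that is a half-line.\<close>

lemma every_point_loop_graph:
  assumes l: "0 < l" and N: "3 \<le> N"
  shows "every_point_on_two_half_line_trail (loop_graph N l)"
  unfolding every_point_on_two_half_line_trail_def
proof
  fix x assume x: "x \<in> points (loop_graph N l)"
  have "\<exists>e<N + 2. x \<in> edge_point (loop_graph N l) e ` edge_interval (loop_graph N l) e"
  proof -
    have "Vertex 0 = edge_point (loop_graph N l) 0 0" "0 \<in> edge_interval (loop_graph N l) 0"
      "Vertex 1 = edge_point (loop_graph N l) 0 l" "l \<in> edge_interval (loop_graph N l) 0"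
      using l by (auto simp: edge_point_def edge_interval_def)
    then have "Vertex 0 \<in> edge_point (loop_graph N l) 0 ` edge_interval (loop_graph N l) 0"
      "Vertex 1 \<in> edge_point (loop_graph N l) 0 ` edge_interval (loop_graph N l) 0" by blast+
    then show ?thesis using x unfolding points_def by fastforce
  qed
  then obtain e where e: "e < N + 2" "x \<in> edge_point (loop_graph N l) e ` edge_interval (loop_graph N l) e" by blast
  define h where "h = (if e < 2 then 2 else e)"
  define k where "k = (if h = 2 then 3 else 2 :: nat)"
  have hk: "2 \<le> h" "2 \<le> k" "h \<noteq> k" "h < N + 2" "k < N + 2" using e N by (auto simp: h_def k_def)
  let ?T = "[(h, False), (0, True), (1::nat, False), (k, True)]"
  have "e \<in> fst ` set ?T" by (auto simp: h_def)
  then have "lies_on (loop_graph N l) x ?T" unfolding lies_on_def using e(2) by blast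
  moreover have "contains_two_half_lines (loop_graph N l) ?T"
    unfolding contains_two_half_lines_def half_lines_loop_graph using hk by force
  ultimately show "\<exists>T. trail (loop_graph N l) T \<and> contains_two_half_lines (loop_graph N l) T \<and> lies_on (loop_graph N l) x T"
    using trail_loop_graph[OF l hk] by blast
qed

section \<open>Functions on the loop graph as families of edge functions\<close>

definition edge_dom :: "real \<Rightarrow> nat \<Rightarrow> real set" where
  "edge_dom l e = (if e < 2 then {0..l} else {0..})"

definition edge_int :: "real \<Rightarrow> nat \<Rightarrow> real set" where
  "edge_int l e = (if e < 2 then {0<..<l} else {0<..})"

lemma edge_domain_loop_graph: "0 < l \<Longrightarrow> edge_domain (edge_int l e) (edge_dom l e)"
  by (auto simp: edge_domain_def edge_int_def edge_dom_def)

lemma edge_interval_loop_graph: "edge_interval (loop_graph N l) e = edge_dom l e"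
  by (auto simp: edge_interval_def edge_dom_def)

lemma einterval_loop_graph: "einterval 0 (if e < 2 then ereal l else \<infinity>) = edge_int l e"
  by (auto simp: einterval_def edge_int_def)

lemma edge_dom_borel [simp]: "edge_dom l e \<in> sets borel"
  by (simp add: edge_dom_def)

text \<open>A function of class H1 on the graph, with its derivatives as explicit data instead of a
  choice; the two matching conditions are continuity at vertex 0 and at vertex 1.\<close>

definition adm :: "nat \<Rightarrow> real \<Rightarrow> (nat \<Rightarrow> real \<Rightarrow> real) \<Rightarrow> (nat \<Rightarrow> real \<Rightarrow> real) \<Rightarrow> bool" where
  "adm N l f g \<longleftrightarrow> (\<forall>e<N + 2. prim_on (edge_dom l e) (f e) (g e) \<and>
     (\<lambda>t. (f e t)\<^sup>2) integrable_on edge_dom l e \<and> f e 0 = f 0 0) \<and> f 1 l = f 0 l"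

definition mass :: "nat \<Rightarrow> real \<Rightarrow> (nat \<Rightarrow> real \<Rightarrow> real) \<Rightarrow> real" where
  "mass N l f = (\<Sum>e<N + 2. integral (edge_dom l e) (\<lambda>t. (f e t)\<^sup>2))"

lemma admD:
  assumes "adm N l f g" "e < N + 2"
  shows "prim_on (edge_dom l e) (f e) (g e)" "(\<lambda>t. (f e t)\<^sup>2) integrable_on edge_dom l e"
    "f e 0 = f 0 0" "f 1 l = f 0 l" "continuous_on (edge_dom l e) (f e)"
    "(\<lambda>t. (g e t)\<^sup>2) integrable_on edge_dom l e"
proof -
  show p: "prim_on (edge_dom l e) (f e) (g e)" using assms unfolding adm_def by blast
  show "continuous_on (edge_dom l e) (f e)"
  proof (cases "e < 2")
    case True
    then show ?thesis using prim_on_continuous_interval[of 0 l "f e" "g e"] p by (simp add: edge_dom_def)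
  next
    case False
    then show ?thesis using prim_on_continuous_half_line[of 0 "f e" "g e"] p by (simp add: edge_dom_def)
  qed
  show "(\<lambda>t. (g e t)\<^sup>2) integrable_on edge_dom l e" using p by (simp add: prim_on_def)
  show "(\<lambda>t. (f e t)\<^sup>2) integrable_on edge_dom l e" "f e 0 = f 0 0" "f 1 l = f 0 l"
    using assms unfolding adm_def by blast+
qed

lemma edge_attains_max:
  assumes "prim_on (edge_dom l e) f g" "(\<lambda>t. (f t)\<^sup>2) integrable_on edge_dom l e" "0 < l"
  obtains x where "x \<in> edge_dom l e" "\<And>t. t \<in> edge_dom l e \<Longrightarrow> \<bar>f t\<bar> \<le> \<bar>f x\<bar>"
proof (cases "e < 2")
  case True
  have "continuous_on {0..l} (\<lambda>t. \<bar>f t\<bar>)"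
    using prim_on_continuous_interval[of 0 l f g] assms(1) True
    by (intro continuous_intros) (simp add: edge_dom_def)
  moreover have "{0..l} \<noteq> {}" using assms(3) by simp
  ultimately obtain x where "x \<in> {0..l}" "\<forall>t\<in>{0..l}. \<bar>f t\<bar> \<le> \<bar>f x\<bar>"
    using continuous_attains_sup[of "{0..l}" "\<lambda>t. \<bar>f t\<bar>"] by auto
  then show thesis using that[of x] True by (simp add: edge_dom_def)
next
  case False
  then have d: "edge_dom l e = {0..}" by (simp add: edge_dom_def)
  obtain x where "0 \<le> x" "\<And>t. 0 \<le> t \<Longrightarrow> \<bar>f t\<bar> \<le> \<bar>f x\<bar>"
    using half_line_attains_max[of 0 f g] assms(1,2) unfolding d by metis
  then show thesis using that[of x] by (simp add: d)
qed

context exponents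
begin

definition En :: "nat \<Rightarrow> real \<Rightarrow> (nat \<Rightarrow> real \<Rightarrow> real) \<Rightarrow> (nat \<Rightarrow> real \<Rightarrow> real) \<Rightarrow> real" where
  "En N l f g = (\<Sum>e<N + 2. J (edge_dom l e) (f e) (g e)) - (\<bar>f 0 0\<bar> powr q + \<bar>f 0 l\<bar> powr q) / q"

lemma adm_powr_integrable:
  assumes "adm N l f g" "e < N + 2" "0 < l"
  shows "(\<lambda>t. \<bar>f e t\<bar> powr p) integrable_on edge_dom l e"
proof -
  note a = admD[OF assms(1,2)]
  obtain x where "\<And>t. t \<in> edge_dom l e \<Longrightarrow> \<bar>f e t\<bar> \<le> \<bar>f e x\<bar>" using edge_attains_max[OF a(1,2) assms(3)] by metis
  then show ?thesis by (intro powr_integrable[OF a(5,2)]) auto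
qed

lemma energy_eq_En:
  assumes l: "0 < l" and a: "adm N l f g"
    and al: "\<And>e t. e < N + 2 \<Longrightarrow> t \<in> edge_dom l e \<Longrightarrow> along (loop_graph N l) u e t = f e t"
    and d: "\<And>e. e < N + 2 \<Longrightarrow> (LINT t:edge_int l e|lborel. \<bar>along_deriv (loop_graph N l) u e t\<bar>\<^sup>2)
      = integral (edge_dom l e) (\<lambda>t. (g e t)\<^sup>2)"
  shows "graph_integral (loop_graph N l) (\<lambda>e t. \<bar>along (loop_graph N l) u e t\<bar>\<^sup>2) = mass N l f"
    "energy p q (loop_graph N l) u = En N l f g"
proof -
  have F: "(LINT t:edge_int l e|lborel. F (along (loop_graph N l) u e t)) = integral (edge_dom l e) (\<lambda>t. F (f e t))"
    if e: "e < N + 2" and F: "(\<lambda>t. F (f e t)) integrable_on edge_dom l e"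
      "continuous_on UNIV F" "\<And>x. 0 \<le> F x" for e and F :: "real \<Rightarrow> real"
  proof -
    note D = edge_domain_loop_graph[OF l, of e]
    have "(LINT t:edge_int l e|lborel. F (along (loop_graph N l) u e t)) = (LINT t:edge_int l e|lborel. F (f e t))"
      unfolding set_lebesgue_integral_def using edge_domainD(3)[OF D] al[OF e]
      by (intro Bochner_Integration.integral_cong) (auto simp: indicator_def)
    also have "\<dots> = integral (edge_dom l e) (\<lambda>t. F (f e t))"
      by (rule set_integrable_edge_domain(2)[OF D continuous_edge_domain_measurable[OF D] F(1)])
        (use F continuous_on_compose2[OF F(2) admD(5)[OF a e]] in auto)
    finally show ?thesis .
  qed
  have sq: "(LINT t:edge_int l e|lborel. \<bar>along (loop_graph N l) u e t\<bar>\<^sup>2) = integral (edge_dom l e) (\<lambda>t. (f e t)\<^sup>2)"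
    if e: "e < N + 2" for e
    using F[OF e, of "\<lambda>x. x\<^sup>2"] admD(2)[OF a e] by (simp add: continuous_intros)
  have pw: "(LINT t:edge_int l e|lborel. \<bar>along (loop_graph N l) u e t\<bar> powr p) = integral (edge_dom l e) (\<lambda>t. \<bar>f e t\<bar> powr p)"
    if e: "e < N + 2" for e
  proof (rule F[of e "\<lambda>x. \<bar>x\<bar> powr p", OF e adm_powr_integrable[OF a e l]])
    show "continuous_on UNIV (\<lambda>x::real. \<bar>x\<bar> powr p)"
      by (rule continuous_on_powr') (use p2 in \<open>auto intro!: continuous_intros\<close>)
  qed simp
  show "graph_integral (loop_graph N l) (\<lambda>e t. \<bar>along (loop_graph N l) u e t\<bar>\<^sup>2) = mass N l f"
    unfolding graph_integral_def mass_def loop_graph_simps einterval_loop_graph using sq by simp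
  have v: "u (Vertex 0) = f 0 0" "u (Vertex 1) = f 0 l"
    using al[of 0 0] al[of 0 l] l by (auto simp: along_def edge_point_def edge_dom_def)
  show "energy p q (loop_graph N l) u = En N l f g"
    unfolding energy_def En_def graph_integral_def loop_graph_simps einterval_loop_graph J_def sum_subtractf
      sum_divide_distrib[symmetric] v
    using d pw v by simp
qed

text \<open>Together with the converse \<open>H1_of_adm\<close> this moves the variational problem
  to admissible families, where weak derivatives no longer occur.\<close>

lemma adm_of_H1:
  assumes l: "0 < l" and u: "u \<in> H1_mass (loop_graph N l) \<mu>"
  obtains f g where "adm N l f g" "mass N l f = \<mu>" "energy p q (loop_graph N l) u = En N l f g"
proof -
  let ?G = "loop_graph N l"
  define f where "f e = along ?G u e" for e
  define g where "g e t = indicator (edge_int l e) t * along_deriv ?G u e t" for e t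
  have E: "prim_on (edge_dom l e) (f e) (g e)" "(\<lambda>t. (f e t)\<^sup>2) integrable_on edge_dom l e"
    "(LINT t:edge_int l e|lborel. \<bar>along_deriv ?G u e t\<bar>\<^sup>2) = integral (edge_dom l e) (\<lambda>t. (g e t)\<^sup>2)"
    if e: "e < N + 2" for e
  proof -
    have c: "continuous_on (edge_dom l e) (f e)"
      and w: "\<exists>g. has_weak_deriv (edge_int l e) (f e) g"
      and i: "set_integrable lborel (edge_int l e) (\<lambda>t. \<bar>along_deriv ?G u e t\<bar>\<^sup>2 + \<bar>f e t\<bar>\<^sup>2)"
      using u e unfolding H1_mass_def H1_def
      by (auto simp: f_def edge_interval_loop_graph einterval_loop_graph simp del: power2_abs)
    have "has_weak_deriv (edge_int l e) (f e) (weak_deriv (edge_int l e) (f e))"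
      unfolding weak_deriv_def using w by (rule someI_ex)
    then have "has_weak_deriv (edge_int l e) (f e) (along_deriv ?G u e)"
      by (simp add: along_deriv_def f_def einterval_loop_graph)
    from weak_deriv_prim_on[OF edge_domain_loop_graph[OF l] c this i]
    show "prim_on (edge_dom l e) (f e) (g e)" "(\<lambda>t. (f e t)\<^sup>2) integrable_on edge_dom l e"
      "(LINT t:edge_int l e|lborel. \<bar>along_deriv ?G u e t\<bar>\<^sup>2) = integral (edge_dom l e) (\<lambda>t. (g e t)\<^sup>2)"
      by (simp_all add: g_def[abs_def])
  qed
  have "f e 0 = f 0 0" "f 1 l = f 0 l" for e using l by (auto simp: f_def along_def edge_point_def)
  then have a: "adm N l f g" unfolding adm_def using E(1,2) by blast
  note eq = energy_eq_En[OF l a _ E(3)]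
  have "graph_integral ?G (\<lambda>e t. \<bar>along ?G u e t\<bar>\<^sup>2) = mass N l f" by (rule eq(1)) (simp_all add: f_def)
  then have "mass N l f = \<mu>" using u by (simp add: H1_mass_def)
  moreover have "energy p q ?G u = En N l f g" by (rule eq(2)) (simp_all add: f_def)
  ultimately show thesis using a that by blast
qed

lemma H1_of_adm:
  assumes l: "0 < l" and a: "adm N l f g" and m: "mass N l f = \<mu>"
  obtains u where "u \<in> H1_mass (loop_graph N l) \<mu>" "energy p q (loop_graph N l) u = En N l f g"
proof -
  let ?G = "loop_graph N l"
  \<comment> \<open>The value at vertex 1 is read off edge 0; edge 1 agrees with it by the matching
    condition.\<close>
  define u where "u x = (case x of Vertex v \<Rightarrow> if v = 0 then f 0 0 else f 0 l | Inner e t \<Rightarrow> f e t)" for x :: "(nat, nat) point"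
  have al: "along ?G u e t = f e t" if "e < N + 2" "t \<in> edge_dom l e" for e t
  proof -
    have "e = 0 \<or> e = 1" if "e < 2" using that by auto
    then show ?thesis
      using admD(3,4)[OF a that(1)] l by (auto simp: along_def edge_point_def u_def)
  qed
  have E: "continuous_on (edge_dom l e) (along ?G u e)"
    "has_weak_deriv (edge_int l e) (along ?G u e) (along_deriv ?G u e)"
    "set_integrable lborel (edge_int l e) (\<lambda>t. \<bar>along_deriv ?G u e t\<bar>\<^sup>2 + \<bar>along ?G u e t\<bar>\<^sup>2)"
    "(LINT t:edge_int l e|lborel. \<bar>along_deriv ?G u e t\<bar>\<^sup>2) = integral (edge_dom l e) (\<lambda>t. (g e t)\<^sup>2)"
    if e: "e < N + 2" for e
  proof -
    show c: "continuous_on (edge_dom l e) (along ?G u e)"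
      using admD(5)[OF a e] al[OF e] continuous_on_cong[of "edge_dom l e" "edge_dom l e" "along ?G u e" "f e"] by simp
    have p: "prim_on (edge_dom l e) (along ?G u e) (g e)"
      using admD(1)[OF a e] al[OF e] by (simp add: prim_on_def)
    have i: "(\<lambda>t. (along ?G u e t)\<^sup>2) integrable_on edge_dom l e"
      by (rule integrable_eq[OF admD(2)[OF a e]]) (simp add: al[OF e])
    have ad: "along_deriv ?G u e = weak_deriv (edge_int l e) (along ?G u e)"
      by (simp add: along_deriv_def einterval_loop_graph)
    show "has_weak_deriv (edge_int l e) (along ?G u e) (along_deriv ?G u e)"
      "set_integrable lborel (edge_int l e) (\<lambda>t. \<bar>along_deriv ?G u e t\<bar>\<^sup>2 + \<bar>along ?G u e t\<bar>\<^sup>2)"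
      "(LINT t:edge_int l e|lborel. \<bar>along_deriv ?G u e t\<bar>\<^sup>2) = integral (edge_dom l e) (\<lambda>t. (g e t)\<^sup>2)"
      unfolding ad by (rule weak_deriv_of_prim_on[OF edge_domain_loop_graph[OF l] c p i])+
  qed
  have "u \<in> H1 ?G" unfolding H1_def edge_interval_loop_graph loop_graph_simps einterval_loop_graph
    using E by blast
  moreover note energy_eq_En[OF l a al E(4)]
  ultimately show thesis using that m by (simp add: H1_mass_def)
qed

text \<open>The three parts of the energy are homogeneous of degrees 2, \<open>p\<close> and
  \<open>q\<close>, so the cost of correcting a mass by a factor is known exactly.\<close>

lemma En_scale:
  assumes a: "adm N l f g" and l: "0 < l" and s: "0 \<le> s"
  shows "adm N l (\<lambda>e t. s * f e t) (\<lambda>e t. s * g e t)" "mass N l (\<lambda>e t. s * f e t) = s\<^sup>2 * mass N l f"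
    "En N l (\<lambda>e t. s * f e t) (\<lambda>e t. s * g e t) = s\<^sup>2 * (\<Sum>e<N + 2. integral (edge_dom l e) (\<lambda>t. (g e t)\<^sup>2)) / 2
      - s powr p * (\<Sum>e<N + 2. integral (edge_dom l e) (\<lambda>t. \<bar>f e t\<bar> powr p)) / p
      - s powr q * (\<bar>f 0 0\<bar> powr q + \<bar>f 0 l\<bar> powr q) / q"
proof -
  have sub: "{c..d} \<subseteq> edge_dom l e" if "c \<in> edge_dom l e" "d \<in> edge_dom l e" for c d e
    using that by (auto simp: edge_dom_def split: if_splits)
  have "prim_on (edge_dom l e) (\<lambda>t. s * f e t) (\<lambda>t. s * g e t)" if "e < N + 2" for e
    using prim_on_lin[OF edge_dom_borel sub admD(1)[OF a that] admD(1)[OF a that], of s 0] by simp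
  then show "adm N l (\<lambda>e t. s * f e t) (\<lambda>e t. s * g e t)"
    unfolding adm_def
  proof (intro conjI allI impI)
    fix e assume e: "e < N + 2"
    show "(\<lambda>t. (s * f e t)\<^sup>2) integrable_on edge_dom l e"
      unfolding power_mult_distrib by (rule integrable_on_mult_right[OF admD(2)[OF a e]])
    show "s * f e 0 = s * f 0 0" by (rule arg_cong[OF admD(3)[OF a e]])
  next
    have "f 1 l = f 0 l" using a unfolding adm_def by blast
    then show "s * f 1 l = s * f 0 l" by simp
  qed blast
  show "mass N l (\<lambda>e t. s * f e t) = s\<^sup>2 * mass N l f"
    by (simp add: mass_def power_mult_distrib sum_distrib_left del: sum.lessThan_Suc)
  show "En N l (\<lambda>e t. s * f e t) (\<lambda>e t. s * g e t) = s\<^sup>2 * (\<Sum>e<N + 2. integral (edge_dom l e) (\<lambda>t. (g e t)\<^sup>2)) / 2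
      - s powr p * (\<Sum>e<N + 2. integral (edge_dom l e) (\<lambda>t. \<bar>f e t\<bar> powr p)) / p
      - s powr q * (\<bar>f 0 0\<bar> powr q + \<bar>f 0 l\<bar> powr q) / q"
    using s by (simp add: En_def J_def power_mult_distrib powr_mult abs_mult sum_subtractf sum_distrib_left
        sum_divide_distrib distrib_left del: sum.lessThan_Suc)
qed

end

section \<open>Existence by compactness\<close>

lemma edge_dom_Icc: "a \<in> edge_dom l e \<Longrightarrow> b \<in> edge_dom l e \<Longrightarrow> {a..b} \<subseteq> edge_dom l e"
  by (auto simp: edge_dom_def split: if_splits)

text \<open>Only the far end of a bounded edge has to be approached from the left.\<close>

lemma edge_dom_dense:
  assumes "0 < l" "x \<in> edge_dom l e" "0 < d"
  obtains y where "y \<in> edge_dom l e" "y \<in> \<rat>" "\<bar>x - y\<bar> < d"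
proof (cases "e < 2 \<and> x = l")
  case True
  have "max 0 (x - d) < x" using assms True by simp
  then obtain y where "y \<in> \<rat>" "max 0 (x - d) < y" "y < x" using Rats_dense_in_real by blast
  then show thesis using that[of y] assms True by (auto simp: edge_dom_def)
next
  case False
  define z where "z = (if e < 2 then min l (x + d) else x + d)"
  have "x < z" using assms False by (auto simp: z_def edge_dom_def)
  then obtain y where y: "y \<in> \<rat>" "x < y" "y < z" using Rats_dense_in_real by blast
  show thesis
  proof (rule that)
    show "y \<in> edge_dom l e" using y assms by (auto simp: z_def edge_dom_def split: if_splits)
    show "\<bar>x - y\<bar> < d" using y by (auto simp: z_def split: if_splits)
  qed (rule y(1))
qed

lemma edge_holder:
  assumes "prim_on (edge_dom l e) f g" "integral (edge_dom l e) (\<lambda>t. (g t)\<^sup>2) \<le> C"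
    "x \<in> edge_dom l e" "y \<in> edge_dom l e"
  shows "(f x - f y)\<^sup>2 \<le> \<bar>x - y\<bar> * C"
proof -
  have *: "(f b - f a)\<^sup>2 \<le> (b - a) * C" if ab: "a \<in> edge_dom l e" "b \<in> edge_dom l e" "a \<le> b" for a b
  proof -
    have sub: "{a..b} \<subseteq> edge_dom l e" by (rule edge_dom_Icc[OF ab(1,2)])
    have p: "prim_on {a..b} f g" by (rule prim_on_subset[OF assms(1) sub]) simp
    have "(f b - f a)\<^sup>2 \<le> (b - a) * integral {a..b} (\<lambda>t. (g t)\<^sup>2)" by (rule prim_on_holder[OF p ab(3)])
    also have "\<dots> \<le> (b - a) * C"
    proof (intro mult_left_mono)
      have "integral {a..b} (\<lambda>t. (g t)\<^sup>2) \<le> integral (edge_dom l e) (\<lambda>t. (g t)\<^sup>2)"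
        by (rule integral_subset_le[OF sub]) (use p assms(1) in \<open>auto simp: prim_on_def\<close>)
      then show "integral {a..b} (\<lambda>t. (g t)\<^sup>2) \<le> C" using assms(2) by simp
    qed (use ab in simp)
    finally show ?thesis .
  qed
  show ?thesis
  proof (cases "x \<le> y")
    case True
    then show ?thesis using *[OF assms(3,4)] by (simp add: power2_commute)
  next
    case False
    then show ?thesis using *[OF assms(4,3)] by simp
  qed
qed

lemma integrable_half_line_limit:
  fixes F :: "real \<Rightarrow> real"
  assumes F: "continuous_on {0..} F" "\<And>t. 0 \<le> F t" and b: "\<And>k :: nat. integral {0..real k} F \<le> B"
  shows "F integrable_on {0..}"
proof -
  define h where "h k t = (if t \<in> {0..real k} then F t else 0)" for k t
  have Fi: "F integrable_on {0..real k}" for k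
    by (intro integrable_continuous_real continuous_on_subset[OF F(1)]) auto
  have int: "{0..real k} \<inter> {0..} = {0..real k}" for k by auto
  have hi: "h k integrable_on {0..}" "integral {0..} (h k) = integral {0..real k} F" for k
    unfolding h_def[abs_def] integrable_restrict_Int integral_restrict_Int int using Fi by auto
  show ?thesis
  proof (rule monotone_convergence_increasing[of h, THEN conjunct1])
    show "h k integrable_on {0..}" for k by (rule hi)
    show "h k t \<le> h (Suc k) t" for k t using F(2)[of t] by (auto simp: h_def)
    show "(\<lambda>k. h k t) \<longlonglongrightarrow> F t" if "t \<in> {0..}" for t
    proof (rule tendsto_eventually)
      show "\<forall>\<^sub>F k in sequentially. h k t = F t"
        using eventually_ge_at_top[of "nat \<lceil>t\<rceil>"]
      proof eventually_elim
        case (elim k)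
        then have "t \<le> real k" by linarith
        then show ?case using that by (simp add: h_def)
      qed
    qed
    have "0 \<le> integral {0..real k} F" for k
      by (rule Henstock_Kurzweil_Integration.integral_nonneg[OF Fi]) (rule F(2))
    then show "bounded (range (\<lambda>k. integral {0..} (h k)))"
      unfolding bounded_iff hi(2) using b by (intro exI[of _ B]) auto
  qed
qed

text \<open>Arzela-Ascoli along the edges: a diagonal subsequence converges at the rational points
  of all edges, and the common Hoelder bound from the kinetic energy spreads convergence to every
  point. \<open>prim_on_limit\<close> provides the limit with a square-integrable derivative. Its
  mass may be smaller, since mass can escape along the half-lines.\<close>

lemma adm_compactness:
  assumes l: "0 < l" and a: "\<And>n. adm N l (fs n) (gs n)"
    and C: "\<And>n e. e < N + 2 \<Longrightarrow> integral (edge_dom l e) (\<lambda>t. (gs n e t)\<^sup>2) \<le> C"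
    and A: "\<And>n e t. e < N + 2 \<Longrightarrow> t \<in> edge_dom l e \<Longrightarrow> \<bar>fs n e t\<bar> \<le> A"
    and m: "\<And>n. mass N l (fs n) = \<mu>"
  obtains r F H where "strict_mono (r :: nat \<Rightarrow> nat)" "adm N l F H" "mass N l F \<le> \<mu>"
    "\<And>e t. e < N + 2 \<Longrightarrow> t \<in> edge_dom l e \<Longrightarrow> (\<lambda>n. fs (r n) e t) \<longlonglongrightarrow> F e t"
proof -
  define T where "T = {(e, x). e < N + 2 \<and> x \<in> edge_dom l e \<and> x \<in> \<rat>}"
  have "T \<subseteq> {..<N + 2} \<times> \<rat>" by (auto simp: T_def)
  then have "countable T" by (rule countable_subset) (auto intro: countable_rat)
  then obtain r where r: "strict_mono (r :: nat \<Rightarrow> nat)"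
    "\<And>z. z \<in> T \<Longrightarrow> \<exists>L. (\<lambda>n. (\<lambda>(e, x). fs (r n) e x) z) \<longlonglongrightarrow> L"
    by (rule function_convergent_subsequence[of T "\<lambda>n (e, x). fs n e x" A]) (use A in \<open>auto simp: T_def\<close>)
  have C0: "0 \<le> C"
    using Henstock_Kurzweil_Integration.integral_nonneg[OF admD(6)[OF a[of 0], of 0]] C[of 0 0] by fastforce
  have conv: "convergent (\<lambda>n. fs (r n) e x)" if e: "e < N + 2" and x: "x \<in> edge_dom l e" for e x
  proof (rule real_Cauchy_convergent, rule metric_CauchyI)
    fix \<epsilon> :: real assume \<epsilon>: "0 < \<epsilon>"
    \<comment> \<open>Within this distance the Hoelder bound moves all values by at most
      \<open>\<epsilon> / 3\<close>.\<close>
    define d where "d = (\<epsilon> / 3)\<^sup>2 / (C + 1)"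
    have d: "0 < d" "d * C \<le> (\<epsilon> / 3)\<^sup>2" using \<epsilon> C0 by (auto simp: d_def field_simps)
    obtain y where y: "y \<in> edge_dom l e" "y \<in> \<rat>" "\<bar>x - y\<bar> < d" using edge_dom_dense[OF l x d(1)] by metis
    have near: "\<bar>fs n e x - fs n e y\<bar> \<le> \<epsilon> / 3" for n
    proof (rule power2_le_imp_le)
      have "(fs n e x - fs n e y)\<^sup>2 \<le> \<bar>x - y\<bar> * C"
        by (rule edge_holder[OF admD(1)[OF a e] C[OF e] x y(1)])
      also have "\<dots> \<le> d * C" using y(3) C0 by (intro mult_right_mono) auto
      finally show "\<bar>fs n e x - fs n e y\<bar>\<^sup>2 \<le> (\<epsilon> / 3)\<^sup>2" using d(2) by simp
    qed (use \<epsilon> in simp)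
    have "(e, y) \<in> T" using e y by (simp add: T_def)
    then obtain L where "(\<lambda>n. fs (r n) e y) \<longlonglongrightarrow> L" using r(2) by fastforce
    then have "Cauchy (\<lambda>n. fs (r n) e y)" by (rule LIMSEQ_imp_Cauchy)
    then obtain K where K: "\<And>m n. K \<le> m \<Longrightarrow> K \<le> n \<Longrightarrow> dist (fs (r m) e y) (fs (r n) e y) < \<epsilon> / 3"
      using \<epsilon> unfolding Cauchy_def by (metis divide_pos_pos zero_less_numeral)
    show "\<exists>M. \<forall>m\<ge>M. \<forall>n\<ge>M. dist (fs (r m) e x) (fs (r n) e x) < \<epsilon>"
    proof (intro exI[of _ K] allI impI)
      fix m n assume "K \<le> m" "K \<le> n"
      then have "\<bar>fs (r m) e y - fs (r n) e y\<bar> < \<epsilon> / 3" using K by (simp add: dist_real_def)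
      then show "dist (fs (r m) e x) (fs (r n) e x) < \<epsilon>"
        using near[of "r m"] near[of "r n"] unfolding dist_real_def by linarith
    qed
  qed
  define F where "F e x = lim (\<lambda>n. fs (r n) e x)" for e x
  have lim: "(\<lambda>n. fs (r n) e x) \<longlonglongrightarrow> F e x" if "e < N + 2" "x \<in> edge_dom l e" for e x
    using conv[OF that] unfolding F_def by (simp add: convergent_LIMSEQ_iff)
  have "\<exists>h. prim_on (edge_dom l e) (F e) h" if e: "e < N + 2" for e
  proof -
    obtain h where "prim_on (edge_dom l e) (F e) h" "integral (edge_dom l e) (\<lambda>t. (h t)\<^sup>2) \<le> C"
      by (rule prim_on_limit[of "edge_dom l e" "\<lambda>n. fs (r n) e" "\<lambda>n. gs (r n) e" "F e" C])
        (use lim[OF e] admD(1)[OF a e] C[OF e] edge_dom_Icc in auto)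
    then show ?thesis by blast
  qed
  then obtain H where H: "\<And>e. e < N + 2 \<Longrightarrow> prim_on (edge_dom l e) (F e) (H e)" by metis
  have Fc: "continuous_on (edge_dom l e) (F e)" if e: "e < N + 2" for e
  proof (rule holder_continuous_on[of _ _ C])
    fix x y assume xy: "x \<in> edge_dom l e" "y \<in> edge_dom l e" "x \<le> y"
    show "(F e y - F e x)\<^sup>2 \<le> (y - x) * C"
    proof (rule LIMSEQ_le_const2)
      show "(\<lambda>n. (fs (r n) e y - fs (r n) e x)\<^sup>2) \<longlonglongrightarrow> (F e y - F e x)\<^sup>2"
        by (intro tendsto_intros lim e xy)
      show "\<exists>K. \<forall>n\<ge>K. (fs (r n) e y - fs (r n) e x)\<^sup>2 \<le> (y - x) * C"
        using edge_holder[OF admD(1)[OF a e] C[OF e] xy(2,1)] xy(3) by auto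
    qed
  qed
  \<comment> \<open>Edges truncated at \<open>b\<close>: on them the constant \<open>A\<close>
    dominates, so masses converge; \<open>b\<close> is sent to infinity only after the mass bound
    has passed to the limit.\<close>
  define D where "D e b = (if e < 2 then {0..l} else {0..b})" for e :: nat and b :: real
  have Dsub: "D e b \<subseteq> edge_dom l e" for e b by (auto simp: D_def edge_dom_def)
  have DI: "\<exists>c. D e b = {0..c}" for e b by (auto simp: D_def)
  have Dlim: "(\<lambda>n. integral (D e b) (\<lambda>t. (fs (r n) e t)\<^sup>2)) \<longlonglongrightarrow> integral (D e b) (\<lambda>t. (F e t)\<^sup>2)" if e: "e < N + 2" for e b
  proof (rule dominated_convergence(2)[where h = "\<lambda>_. A\<^sup>2"])
    obtain c where c: "D e b = {0..c}" using DI by blast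
    show "(\<lambda>t. (fs (r n) e t)\<^sup>2) integrable_on D e b" for n
    proof -
      have "continuous_on (D e b) (fs (r n) e)" by (rule continuous_on_subset[OF admD(5)[OF a e] Dsub])
      then show ?thesis unfolding c by (intro integrable_continuous_real continuous_intros)
    qed
    show "(\<lambda>_. A\<^sup>2) integrable_on D e b" unfolding c by (rule integrable_const_ivl)
    show "norm ((fs (r n) e t)\<^sup>2) \<le> A\<^sup>2" if "t \<in> D e b" for n t
      using power_mono[OF A[OF e, of t "r n"], of 2] that Dsub by auto
    show "(\<lambda>n. (fs (r n) e t)\<^sup>2) \<longlonglongrightarrow> (F e t)\<^sup>2" if "t \<in> D e b" for t
      by (intro tendsto_intros lim[OF e]) (use that Dsub in blast)
  qed
  have Dle: "integral (D e b) (\<lambda>t. (fs n e t)\<^sup>2) \<le> integral (edge_dom l e) (\<lambda>t. (fs n e t)\<^sup>2)" if e: "e < N + 2" for e b n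
    by (rule integral_subset_le[OF Dsub admD(2)[OF a e, THEN integrable_on_subset_nonneg] admD(2)[OF a e]])
      (use Dsub DI[of e b] in auto)
  have Dmass: "(\<Sum>e<N + 2. integral (D e b) (\<lambda>t. (F e t)\<^sup>2)) \<le> \<mu>" for b
  proof (rule LIMSEQ_le_const2)
    show "(\<lambda>n. \<Sum>e<N + 2. integral (D e b) (\<lambda>t. (fs (r n) e t)\<^sup>2)) \<longlonglongrightarrow> (\<Sum>e<N + 2. integral (D e b) (\<lambda>t. (F e t)\<^sup>2))"
      by (intro tendsto_sum Dlim) simp
    have "(\<Sum>e<N + 2. integral (D e b) (\<lambda>t. (fs (r n) e t)\<^sup>2)) \<le> \<mu>" for n
      unfolding m[of "r n", symmetric] mass_def by (rule sum_mono) (simp add: Dle)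
    then show "\<exists>K. \<forall>n\<ge>K. (\<Sum>e<N + 2. integral (D e b) (\<lambda>t. (fs (r n) e t)\<^sup>2)) \<le> \<mu>" by blast
  qed
  have D0: "0 \<le> integral (D e b) (\<lambda>t. (F e t)\<^sup>2)" for e b
    by (cases "(\<lambda>t. (F e t)\<^sup>2) integrable_on D e b")
      (auto simp: not_integrable_integral intro: Henstock_Kurzweil_Integration.integral_nonneg)
  have F2: "(\<lambda>t. (F e t)\<^sup>2) integrable_on edge_dom l e" if e: "e < N + 2" for e
  proof (cases "e < 2")
    case True
    then show ?thesis using Fc[OF e]
      by (auto simp: edge_dom_def intro!: integrable_continuous_real continuous_intros)
  next
    case False
    have "integral {0..real k} (\<lambda>t. (F e t)\<^sup>2) \<le> \<mu>" for k
    proof -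
      have "integral {0..real k} (\<lambda>t. (F e t)\<^sup>2) = integral (D e k) (\<lambda>t. (F e t)\<^sup>2)" using False by (simp add: D_def)
      also have "\<dots> \<le> (\<Sum>e<N + 2. integral (D e k) (\<lambda>t. (F e t)\<^sup>2))"
        by (rule member_le_sum) (use e D0 in auto)
      also have "\<dots> \<le> \<mu>" by (rule Dmass)
      finally show ?thesis .
    qed
    moreover have "continuous_on {0..} (\<lambda>t. (F e t)\<^sup>2)"
      using Fc[OF e] False by (auto simp: edge_dom_def intro!: continuous_intros)
    ultimately have "(\<lambda>t. (F e t)\<^sup>2) integrable_on {0..}" by (intro integrable_half_line_limit) auto
    then show ?thesis using False by (simp add: edge_dom_def)
  qed
  have "((\<lambda>b. \<Sum>e<N + 2. integral (D e b) (\<lambda>t. (F e t)\<^sup>2)) \<longlongrightarrow> mass N l F) at_top"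
    unfolding mass_def
  proof (intro tendsto_sum)
    fix e assume "e \<in> {..<N + 2}"
    then have "(\<lambda>t. (F e t)\<^sup>2) integrable_on edge_dom l e" using F2 by simp
    then show "((\<lambda>b. integral (D e b) (\<lambda>t. (F e t)\<^sup>2)) \<longlongrightarrow> integral (edge_dom l e) (\<lambda>t. (F e t)\<^sup>2)) at_top"
      by (cases "e < 2") (auto simp: D_def edge_dom_def intro: tendsto_integral_at_top)
  qed
  then have mF: "mass N l F \<le> \<mu>" by (rule tendsto_upperbound) (use Dmass in auto)
  have "F e 0 = F 0 0" if e: "e < N + 2" for e
    unfolding F_def by (rule arg_cong[of _ _ lim]) (rule ext, rule admD(3)[OF a e])
  moreover have "F 1 l = F 0 l"
    unfolding F_def by (rule arg_cong[of _ _ lim]) (rule ext, rule admD(4)[OF a, of 0], simp)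
  ultimately have "adm N l F H" unfolding adm_def using H F2 by blast
  from that[OF r(1) this mF lim] show thesis .
qed

lemma sum_edges:
  fixes F :: "nat \<Rightarrow> real"
  shows "(\<Sum>e<N + 2. F e) = F 0 + F 1 + (\<Sum>e\<in>{2..<N + 2}. F e)"
proof -
  have "{..<N + 2} = {0, 1} \<union> {2..<N + 2}" by auto
  then have "(\<Sum>e<N + 2. F e) = (\<Sum>e\<in>{0, 1} \<union> {2..<N + 2}. F e)" by (simp only:)
  also have "\<dots> = (\<Sum>e\<in>{0, 1}. F e) + (\<Sum>e\<in>{2..<N + 2}. F e)" by (rule sum.union_disjoint) auto
  finally show ?thesis by simp
qed

context exponents
begin

section \<open>Lower bounds for the energy on the graph by counting levels\<close>

lemma adm_attains_max:
  assumes l: "0 < l" and a: "adm N l f g"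
  obtains e x where "e < N + 2" "x \<in> edge_dom l e"
    "\<And>e' t. e' < N + 2 \<Longrightarrow> t \<in> edge_dom l e' \<Longrightarrow> \<bar>f e' t\<bar> \<le> \<bar>f e x\<bar>"
proof -
  have "\<exists>x. x \<in> edge_dom l e \<and> (\<forall>t\<in>edge_dom l e. \<bar>f e t\<bar> \<le> \<bar>f e x\<bar>)" if "e < N + 2" for e
    using edge_attains_max[OF admD(1,2)[OF a that] l] by metis
  then obtain x where x: "\<And>e. e < N + 2 \<Longrightarrow> x e \<in> edge_dom l e"
    "\<And>e t. e < N + 2 \<Longrightarrow> t \<in> edge_dom l e \<Longrightarrow> \<bar>f e t\<bar> \<le> \<bar>f e (x e)\<bar>" by metis
  define S where "S = (\<lambda>e. \<bar>f e (x e)\<bar>) ` {..<N + 2}"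
  have S: "finite S" "S \<noteq> {}" by (auto simp: S_def)
  obtain e where e: "e < N + 2" "Max S = \<bar>f e (x e)\<bar>" using Max_in[OF S] by (auto simp: S_def)
  show thesis
  proof (rule that[OF e(1) x(1)[OF e(1)]])
    fix e' t assume t: "e' < N + 2" "t \<in> edge_dom l e'"
    have "\<bar>f e' t\<bar> \<le> \<bar>f e' (x e')\<bar>" by (rule x(2)[OF t])
    also have "\<dots> \<le> Max S" by (rule Max_ge[OF S(1)]) (use t in \<open>auto simp: S_def\<close>)
    finally show "\<bar>f e' t\<bar> \<le> \<bar>f e (x e)\<bar>" using e by simp
  qed
qed

lemma adm_dens:
  assumes l: "0 < l" and a: "adm N l f g" and e: "e < N + 2"
    and M: "\<And>t. t \<in> edge_dom l e \<Longrightarrow> \<bar>f e t\<bar> \<le> M"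
  shows "dens M (f e) (g e) integrable_on edge_dom l e"
    "integral (edge_dom l e) (dens M (f e) (g e)) = J (edge_dom l e) (f e) (g e)
       + M powr (p - 2) / p * integral (edge_dom l e) (\<lambda>t. (f e t)\<^sup>2)"
    "0 \<le> integral (edge_dom l e) (dens M (f e) (g e))"
proof -
  note d = dens_integral[OF admD(1)[OF a e] admD(5)[OF a e] admD(2)[OF a e] edge_dom_borel M]
  show "dens M (f e) (g e) integrable_on edge_dom l e"
    "integral (edge_dom l e) (dens M (f e) (g e)) = J (edge_dom l e) (f e) (g e)
       + M powr (p - 2) / p * integral (edge_dom l e) (\<lambda>t. (f e t)\<^sup>2)" by (rule d; assumption)+
  then show "0 \<le> integral (edge_dom l e) (dens M (f e) (g e))"
    using M by (intro Henstock_Kurzweil_Integration.integral_nonneg) (auto intro: dens_nonneg)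
qed

text \<open>Every half-line crosses all levels below the common value at vertex 0. The last two
  variants single out one half-line; if it carries the maximum, it crosses the higher levels
  twice.\<close>

lemma calibrated_half_lines:
  assumes l: "0 < l" and a: "adm N l f g" and N: "2 \<le> N"
    and M: "0 < M" "\<And>e t. e < N + 2 \<Longrightarrow> t \<in> edge_dom l e \<Longrightarrow> \<bar>f e t\<bar> \<le> M"
  shows "real N * G M \<bar>f 0 0\<bar> \<le> (\<Sum>e\<in>{2..<N + 2}. integral (edge_dom l e) (dens M (f e) (g e)))"
    "e0 \<in> {2..<N + 2} \<Longrightarrow> integral (edge_dom l e0) (dens M (f e0) (g e0)) + (real N - 1) * G M \<bar>f 0 0\<bar>
       \<le> (\<Sum>e\<in>{2..<N + 2}. integral (edge_dom l e) (dens M (f e) (g e)))"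
    "e0 \<in> {2..<N + 2} \<Longrightarrow> 0 \<le> x0 \<Longrightarrow> \<bar>f e0 x0\<bar> = M \<Longrightarrow> 2 * G M M + (real N - 2) * G M \<bar>f 0 0\<bar>
       \<le> (\<Sum>e\<in>{2..<N + 2}. integral (edge_dom l e) (dens M (f e) (g e)))"
proof -
  define D where "D e = integral (edge_dom l e) (dens M (f e) (g e))" for e
  define a0 where "a0 = G M \<bar>f 0 0\<bar>"
  have h: "a0 \<le> D e" if e: "e < N + 2" "2 \<le> e" for e
  proof -
    have d: "edge_dom l e = {0..}" using e by (simp add: edge_dom_def)
    have "G M \<bar>f e 0\<bar> \<le> integral {0..} (dens M (f e) (g e))"
      by (rule half_line_calibrated) (use admD(1,2)[OF a e(1)] M(1) M(2)[OF e(1)] d in auto)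
    then show ?thesis unfolding D_def a0_def d using admD(3)[OF a e(1)] by simp
  qed
  have "(\<Sum>e\<in>{2..<N + 2}. a0) \<le> (\<Sum>e\<in>{2..<N + 2}. D e)" by (rule sum_mono) (use h in auto)
  then show "real N * G M \<bar>f 0 0\<bar> \<le> (\<Sum>e\<in>{2..<N + 2}. integral (edge_dom l e) (dens M (f e) (g e)))"
    by (simp add: a0_def D_def)
  have rem: "D e0 + (real N - 1) * a0 \<le> (\<Sum>e\<in>{2..<N + 2}. D e)" if mem: "e0 \<in> {2..<N + 2}" for e0
  proof -
    have "(\<Sum>e\<in>{2..<N + 2} - {e0}. a0) = (real N - 1) * a0"
      using mem N by (simp add: card_Diff_singleton of_nat_diff)
    moreover have "(\<Sum>e\<in>{2..<N + 2} - {e0}. a0) \<le> (\<Sum>e\<in>{2..<N + 2} - {e0}. D e)"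
      by (rule sum_mono) (use h in auto)
    moreover have "(\<Sum>e\<in>{2..<N + 2}. D e) = D e0 + (\<Sum>e\<in>{2..<N + 2} - {e0}. D e)"
      by (rule sum.remove[OF _ mem]) simp
    ultimately show ?thesis by (simp only:)
  qed
  then show "e0 \<in> {2..<N + 2} \<Longrightarrow> integral (edge_dom l e0) (dens M (f e0) (g e0)) + (real N - 1) * G M \<bar>f 0 0\<bar>
       \<le> (\<Sum>e\<in>{2..<N + 2}. integral (edge_dom l e) (dens M (f e) (g e)))"
    unfolding D_def a0_def .
  assume e0: "e0 \<in> {2..<N + 2}" and x0: "0 \<le> x0" "\<bar>f e0 x0\<bar> = M"
  then have d: "edge_dom l e0 = {0..}" and lt: "e0 < N + 2" by (auto simp: edge_dom_def)
  have "2 * G M M - G M \<bar>f e0 0\<bar> \<le> integral {0..} (dens M (f e0) (g e0))"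
    by (rule half_line_calibrated_max[of 0 _ _ M x0]) (use admD(1,2)[OF a lt] M(1) M(2)[OF lt] x0 d in auto)
  then have "2 * G M M - a0 \<le> D e0" unfolding D_def a0_def d using admD(3)[OF a lt] by simp
  then show "2 * G M M + (real N - 2) * G M \<bar>f 0 0\<bar>
       \<le> (\<Sum>e\<in>{2..<N + 2}. integral (edge_dom l e) (dens M (f e) (g e)))"
    using rem[OF e0] unfolding D_def a0_def by (simp add: algebra_simps)
qed

text \<open>Every level below the value at the loop vertex is attained on each half-line, every other
  level below the maximum at least twice.\<close>

lemma calibrated_graph:
  assumes l: "0 < l" and a: "adm N l f g" and N: "2 \<le> N"
    and M: "0 < M" "\<And>e t. e < N + 2 \<Longrightarrow> t \<in> edge_dom l e \<Longrightarrow> \<bar>f e t\<bar> \<le> M"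
    and x: "e0 < N + 2" "x0 \<in> edge_dom l e0" "\<bar>f e0 x0\<bar> = M"
  shows "2 * G M M + (real N - 2) * G M \<bar>f 0 0\<bar> \<le> (\<Sum>e<N + 2. integral (edge_dom l e) (dens M (f e) (g e)))"
proof -
  define D where "D e = integral (edge_dom l e) (dens M (f e) (g e))" for e
  define a0 where "a0 = G M \<bar>f 0 0\<bar>"
  have D0: "0 \<le> D e" if "e < N + 2" for e unfolding D_def by (rule adm_dens(3)[OF l a that M(2)[OF that]])
  have split: "(\<Sum>e<N + 2. D e) = D 0 + D 1 + (\<Sum>e\<in>{2..<N + 2}. D e)" by (rule sum_edges)
  have "2 * G M M + (real N - 2) * a0 \<le> (\<Sum>e<N + 2. D e)"
  proof (cases "e0 < 2")
    case False
    then have "e0 \<in> {2..<N + 2}" "0 \<le> x0" using x by (auto simp: edge_dom_def)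
    from calibrated_half_lines(3)[OF l a N M this x(3)]
    have "2 * G M M + (real N - 2) * a0 \<le> (\<Sum>e\<in>{2..<N + 2}. D e)" unfolding D_def a0_def .
    then show ?thesis using split D0[of 0] D0[of 1] by simp
  next
    case True
    \<comment> \<open>The maximum lies on the loop. Its edge crosses the levels between the maximum
      and each of its end values, the other edge \<open>e1\<close> those between the end values. The
      value at vertex 1 cancels, which leaves \<open>2 * G M M - 2 * a0\<close>, and two of the
      half-lines supply the missing \<open>2 * a0\<close>.\<close>
    define e1 where "e1 = 1 - e0"
    have e01: "e0 = 0 \<and> e1 = 1 \<or> e0 = 1 \<and> e1 = 0" using True by (auto simp: e1_def)
    have d: "edge_dom l e0 = {0..l}" "edge_dom l e1 = {0..l}" using e01 by (auto simp: edge_dom_def)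
    have lt: "e1 < N + 2" using e01 by auto
    have x0: "0 \<le> x0" "x0 \<le> l" using x(2) d by auto
    define b where "b = G M \<bar>f 0 l\<bar>"
    have fl: "f e0 l = f 0 l" "f e1 l = f 0 l" using e01 admD(4)[OF a x(1)] by auto
    have f0: "f e0 0 = f 0 0" "f e1 0 = f 0 0" using admD(3)[OF a x(1)] admD(3)[OF a lt] by auto
    have c: "abs (G M \<bar>f e v\<bar> - G M \<bar>f e u\<bar>) \<le> integral {u..v} (dens M (f e) (g e))"
      if "e < N + 2" "edge_dom l e = {0..l}" "0 \<le> u" "u \<le> v" "v \<le> l" for e u v
    proof (rule calibrated_interval(1))
      show "prim_on {u..v} (f e) (g e)" by (rule prim_on_subset[OF admD(1)[OF a that(1)]]) (use that in auto)
    qed (use that M in auto)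
    have "D e0 = integral {0..x0} (dens M (f e0) (g e0)) + integral {x0..l} (dens M (f e0) (g e0))"
      unfolding D_def d(1)
      by (rule Henstock_Kurzweil_Integration.integral_combine[symmetric])
        (use x0 adm_dens(1)[OF l a x(1) M(2)[OF x(1)]] d in auto)
    moreover have "abs (G M M - a0) \<le> integral {0..x0} (dens M (f e0) (g e0))"
      using c[OF x(1) d(1), of 0 x0] x0 x(3) f0 by (simp add: a0_def)
    moreover have "abs (b - G M M) \<le> integral {x0..l} (dens M (f e0) (g e0))"
      using c[OF x(1) d(1), of x0 l] x0 x(3) fl by (simp add: b_def)
    ultimately have 1: "2 * G M M - a0 - b \<le> D e0" by linarith
    have "abs (b - a0) \<le> D e1"
      using c[OF lt d(2), of 0 l] l fl f0 by (simp add: b_def a0_def D_def d)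
    then have "2 * G M M - 2 * a0 \<le> D 0 + D 1" using 1 e01 by auto
    moreover have "real N * a0 \<le> (\<Sum>e\<in>{2..<N + 2}. D e)"
      using calibrated_half_lines(1)[OF l a N M] unfolding D_def a0_def .
    ultimately show ?thesis using split by (simp add: algebra_simps)
  qed
  then show ?thesis by (simp only: D_def a0_def)
qed

text \<open>\<open>calibrated_graph\<close> with the mass term taken off again. The first bound
  keeps the excess of the half-lines; the cruder second one knows of the function only its mass and
  maximum.\<close>

lemma En_lower:
  assumes l: "0 < l" and a: "adm N l f g" and N: "2 \<le> N"
    and M: "0 < M" "\<And>e t. e < N + 2 \<Longrightarrow> t \<in> edge_dom l e \<Longrightarrow> \<bar>f e t\<bar> \<le> M"
    and x: "e0 < N + 2" "x0 \<in> edge_dom l e0" "\<bar>f e0 x0\<bar> = M"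
  shows "elin M (mass N l f) + (real N - 2) * G M \<bar>f 0 0\<bar> - (\<bar>f 0 0\<bar> powr q + \<bar>f 0 l\<bar> powr q) / q \<le> En N l f g"
    "elin M (mass N l f) - 2 * M powr q / q \<le> En N l f g"
proof -
  have "(\<Sum>e<N + 2. integral (edge_dom l e) (dens M (f e) (g e)))
     = (\<Sum>e<N + 2. J (edge_dom l e) (f e) (g e) + M powr (p - 2) / p * integral (edge_dom l e) (\<lambda>t. (f e t)\<^sup>2))"
    by (rule sum.cong) (use adm_dens(2)[OF l a _ M(2)] in auto)
  also have "\<dots> = (\<Sum>e<N + 2. J (edge_dom l e) (f e) (g e)) + M powr (p - 2) / p * mass N l f"
    unfolding mass_def sum_distrib_left sum.distrib ..
  finally have "2 * G M M + (real N - 2) * G M \<bar>f 0 0\<bar>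
     \<le> (\<Sum>e<N + 2. J (edge_dom l e) (f e) (g e)) + M powr (p - 2) / p * mass N l f"
    using calibrated_graph[OF assms] by simp
  then show 1: "elin M (mass N l f) + (real N - 2) * G M \<bar>f 0 0\<bar> - (\<bar>f 0 0\<bar> powr q + \<bar>f 0 l\<bar> powr q) / q \<le> En N l f g"
    unfolding elin_def En_def G_self[OF M(1)] by (simp add: algebra_simps del: sum.lessThan_Suc)
  have b: "\<bar>f 0 0\<bar> \<le> M" "\<bar>f 0 l\<bar> \<le> M" using M(2)[of 0 0] M(2)[of 0 l] l by (auto simp: edge_dom_def)
  have "0 \<le> (real N - 2) * G M \<bar>f 0 0\<bar>" using N b by (intro mult_nonneg_nonneg G_nonneg) auto
  moreover have "(\<bar>f 0 0\<bar> powr q + \<bar>f 0 l\<bar> powr q) / q \<le> 2 * M powr q / q"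
    using powr_mono2[OF _ _ b(1), of q] powr_mono2[OF _ _ b(2), of q] q2 by (intro divide_right_mono) auto
  ultimately show "elin M (mass N l f) - 2 * M powr q / q \<le> En N l f g" using 1 by linarith
qed

text \<open>After division by \<open>M powr (p / 2 + 1)\<close> the mass term and the vertex term
  carry the exponents \<open>p / 2 - 3\<close> and \<open>q - p / 2 - 1\<close>, both
  negative.\<close>

lemma coercive:
  assumes "0 \<le> \<mu>"
  obtains A where "0 < A" "\<And>M. A < M \<Longrightarrow> C < elin M \<mu> - 2 * M powr q / q"
proof -
  have t: "((\<lambda>M::real. M powr s) \<longlongrightarrow> 0) at_top" if "s < 0" for s
    by (rule tendsto_neg_powr[OF that filterlim_ident])
  have "((\<lambda>M. 2 * Psi 1 - M powr (p - 2 - (p / 2 + 1)) * \<mu> / p - 2 * M powr (q - (p / 2 + 1)) / q) \<longlongrightarrow> 2 * Psi 1 - 0 * \<mu> / p - 2 * 0 / q) at_top"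
    using p2 p6 q2 qp by (intro tendsto_intros t) auto
  then have 1: "\<forall>\<^sub>F M in at_top. Psi 1 < 2 * Psi 1 - M powr (p - 2 - (p / 2 + 1)) * \<mu> / p - 2 * M powr (q - (p / 2 + 1)) / q"
    by (rule order_tendstoD(1)) (use Psi_1_pos in simp)
  have 2: "\<forall>\<^sub>F M::real in at_top. \<bar>C\<bar> / Psi 1 < M powr (p / 2 + 1)"
    using eventually_gt_at_top[of "(\<bar>C\<bar> / Psi 1) powr (1 / (p / 2 + 1))"]
  proof eventually_elim
    case (elim M)
    have "((\<bar>C\<bar> / Psi 1) powr (1 / (p / 2 + 1))) powr (p / 2 + 1) < M powr (p / 2 + 1)"
      using elim p2 by (intro powr_less_mono2) auto
    then show ?case using p2 Psi_1_pos by (simp add: powr_powr)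
  qed
  have "\<forall>\<^sub>F M::real in at_top. C < elin M \<mu> - 2 * M powr q / q"
    using 1 2 eventually_gt_at_top[of 0]
  proof eventually_elim
    case (elim M)
    define Q where "Q = 2 * Psi 1 - M powr (p - 2 - (p / 2 + 1)) * \<mu> / p - 2 * M powr (q - (p / 2 + 1)) / q"
    have "\<bar>C\<bar> < M powr (p / 2 + 1) * Psi 1" using elim(2) Psi_1_pos by (simp add: pos_divide_less_eq)
    also have "\<dots> < M powr (p / 2 + 1) * Q"
      using elim unfolding Q_def by (intro mult_strict_left_mono) auto
    also have "\<dots> = elin M \<mu> - 2 * M powr q / q"
    proof -
      have "M powr (p / 2 + 1) * M powr (p - 2 - (p / 2 + 1)) = M powr (p - 2)"
        "M powr (p / 2 + 1) * M powr (q - (p / 2 + 1)) = M powr q" by (simp_all flip: powr_add)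
      moreover have "X * (2 * c - Y * \<mu> / p - 2 * Z / q) = 2 * c * X - (X * Y) * \<mu> / p - 2 * (X * Z) / q" for X Y Z c
        by (simp add: right_diff_distrib mult_ac)
      ultimately show ?thesis unfolding Q_def elin_def by (simp only:)
    qed
    finally show ?case by linarith
  qed
  then obtain B where B: "\<And>M. B \<le> M \<Longrightarrow> C < elin M \<mu> - 2 * M powr q / q" unfolding eventually_at_top_linorder by blast
  show thesis by (rule that[of "max B 1"]) (use B in auto)
qed

lemma integral_square_zero:
  assumes l: "0 < l" and a: "adm N l f g" and e: "e < N + 2" and t: "t \<in> edge_dom l e"
    and z: "integral (edge_dom l e) (\<lambda>t. (f e t)\<^sup>2) = 0"
  shows "f e t = 0"
proof -
  define b where "b = (if e < 2 then l else t + 1)"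
  have b: "0 < b" "t \<in> {0..b}" "{0..b} \<subseteq> edge_dom l e" using l t by (auto simp: b_def edge_dom_def split: if_splits)
  have c: "continuous_on {0..b} (\<lambda>t. (f e t)\<^sup>2)"
    using continuous_on_subset[OF admD(5)[OF a e] b(3)] by (intro continuous_intros)
  have "integral {0..b} (\<lambda>t. (f e t)\<^sup>2) \<le> integral (edge_dom l e) (\<lambda>t. (f e t)\<^sup>2)"
    by (rule integral_subset_le[OF b(3) integrable_continuous_real[OF c] admD(2)[OF a e]]) auto
  moreover have "0 \<le> integral {0..b} (\<lambda>t. (f e t)\<^sup>2)"
    by (rule Henstock_Kurzweil_Integration.integral_nonneg[OF integrable_continuous_real[OF c]]) auto
  ultimately have "integral {0..b} (\<lambda>t. (f e t)\<^sup>2) = 0" using z by simp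
  then have "\<forall>t\<in>{0..b}. (f e t)\<^sup>2 = 0"
    using integral_eq_0_iff[OF c] b(1) by auto
  then show ?thesis using b(2) by auto
qed

lemma mass_nonneg:
  assumes a: "adm N l f g"
  shows "0 \<le> mass N l f" "e < N + 2 \<Longrightarrow> integral (edge_dom l e) (\<lambda>t. (f e t)\<^sup>2) \<le> mass N l f"
proof -
  have nn: "0 \<le> integral (edge_dom l e) (\<lambda>t. (f e t)\<^sup>2)" if "e < N + 2" for e
    by (rule Henstock_Kurzweil_Integration.integral_nonneg[OF admD(2)[OF a that]]) simp
  show "0 \<le> mass N l f" unfolding mass_def by (rule sum_nonneg) (use nn in auto)
  show "e < N + 2 \<Longrightarrow> integral (edge_dom l e) (\<lambda>t. (f e t)\<^sup>2) \<le> mass N l f"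
    unfolding mass_def by (rule member_le_sum) (use nn in auto)
qed

text \<open>Scaling up to mass \<open>\<mu>\<close> multiplies the kinetic term by
  \<open>s\<^sup>2\<close> and the two negative terms by at least as much, because \<open>p\<close>
  and \<open>q\<close> exceed 2 and \<open>1 \<le> s\<close>. A function of mass zero cannot be
  scaled, but it vanishes and has nonnegative energy.\<close>

lemma En_lower_scaled:
  assumes l: "0 < l" and a: "adm N l f g" and mu: "0 < \<mu>" "mass N l f \<le> \<mu>"
    and E0: "\<And>f g. adm N l f g \<Longrightarrow> mass N l f = \<mu> \<Longrightarrow> E0 \<le> En N l f g"
  shows "mass N l f / \<mu> * E0 \<le> En N l f g"
proof (cases "mass N l f = 0")
  case True
  have z: "f e t = 0" if "e < N + 2" "t \<in> edge_dom l e" for e t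
  proof (rule integral_square_zero[OF l a that])
    have "0 \<le> integral (edge_dom l e) (\<lambda>t. (f e t)\<^sup>2)"
      by (rule Henstock_Kurzweil_Integration.integral_nonneg[OF admD(2)[OF a that(1)]]) simp
    then show "integral (edge_dom l e) (\<lambda>t. (f e t)\<^sup>2) = 0" using mass_nonneg(2)[OF a that(1)] True by simp
  qed
  have "0 \<le> J (edge_dom l e) (f e) (g e)" if e: "e < N + 2" for e
  proof -
    have "integral (edge_dom l e) (\<lambda>t. \<bar>f e t\<bar> powr p) = integral (edge_dom l e) (\<lambda>t. 0)"
      by (rule Henstock_Kurzweil_Integration.integral_cong) (simp add: z[OF e])
    moreover have "0 \<le> integral (edge_dom l e) (\<lambda>t. (g e t)\<^sup>2)"
      by (rule Henstock_Kurzweil_Integration.integral_nonneg[OF admD(6)[OF a e]]) simp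
    ultimately show ?thesis by (simp add: J_def)
  qed
  then have "0 \<le> (\<Sum>e<N + 2. J (edge_dom l e) (f e) (g e))" by (intro sum_nonneg) auto
  moreover have "f 0 0 = 0" "f 0 l = 0" using z[of 0 0] z[of 0 l] l by (auto simp: edge_dom_def)
  ultimately show ?thesis using True by (simp add: En_def del: sum.lessThan_Suc)
next
  case False
  define m where "m = mass N l f"
  have m: "0 < m" "m \<le> \<mu>" using False mass_nonneg(1)[OF a] mu by (auto simp: m_def)
  define s where "s = sqrt (\<mu> / m)"
  have s1: "1 \<le> s" using m by (simp add: s_def)
  have s2: "s\<^sup>2 = \<mu> / m" using m mu by (simp add: s_def)
  define K where "K = (\<Sum>e<N + 2. integral (edge_dom l e) (\<lambda>t. (g e t)\<^sup>2))"
  define P where "P = (\<Sum>e<N + 2. integral (edge_dom l e) (\<lambda>t. \<bar>f e t\<bar> powr p))"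
  define Q where "Q = \<bar>f 0 0\<bar> powr q + \<bar>f 0 l\<bar> powr q"
  have P0: "0 \<le> P" unfolding P_def
    by (intro sum_nonneg Henstock_Kurzweil_Integration.integral_nonneg adm_powr_integrable[OF a _ l]) auto
  have Q0: "0 \<le> Q" by (simp add: Q_def)
  have s0: "0 \<le> s" using s1 by simp
  note sc = En_scale[OF a l s0]
  have En1: "En N l f g = K / 2 - P / p - Q / q"
    using En_scale(3)[OF a l, of 1] by (simp add: K_def P_def Q_def del: sum.lessThan_Suc)
  have "E0 \<le> En N l (\<lambda>e t. s * f e t) (\<lambda>e t. s * g e t)"
    by (rule E0[OF sc(1)]) (use sc(2) s2 m in \<open>simp add: m_def[symmetric]\<close>)
  also have "\<dots> = s\<^sup>2 * K / 2 - s powr p * P / p - s powr q * Q / q"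
    unfolding sc(3) K_def P_def Q_def ..
  also have "\<dots> \<le> s\<^sup>2 * K / 2 - s\<^sup>2 * P / p - s\<^sup>2 * Q / q"
  proof -
    have "s\<^sup>2 \<le> s powr p" "s\<^sup>2 \<le> s powr q"
      using powr_mono[of 2 p s] powr_mono[of 2 q s] s1 p2 q2 by simp_all
    then have "s\<^sup>2 * P / p \<le> s powr p * P / p" "s\<^sup>2 * Q / q \<le> s powr q * Q / q"
      using P0 Q0 p2 q2 by (auto intro!: divide_right_mono mult_right_mono)
    then show ?thesis by linarith
  qed
  also have "\<dots> = \<mu> / m * En N l f g" unfolding En1 s2 by (simp add: right_diff_distrib)
  finally have "E0 \<le> \<mu> / m * En N l f g" .
  then have "m / \<mu> * E0 \<le> m / \<mu> * (\<mu> / m * En N l f g)" using m mu by (intro mult_left_mono) auto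
  also have "\<dots> = En N l f g" using m mu by simp
  finally show ?thesis by (simp add: m_def)
qed

text \<open>Escaping mass is priced at \<open>E / \<mu> = - L\<close> per unit. If the limit
  \<open>F\<close> of a minimising sequence has mass \<open>m\<close>, semicontinuity gives
  \<open>En N l F H + L * m \<le> E0 + L * \<mu>\<close>, while \<open>En_lower_scaled\<close> gives
  \<open>m / \<mu> * E0 \<le> En N l F H\<close>. Together they yield
  \<open>m / \<mu> * (E0 - E) \<le> E0 - E\<close>, which for \<open>E0 < E\<close> forces
  \<open>m = \<mu>\<close>: no mass escapes.\<close>

theorem ground_state_exists:
  assumes l: "0 < l" and N: "2 \<le> N" and mu: "0 < \<mu>"
    and E: "\<And>M. 0 < M \<Longrightarrow> E \<le> elin M \<mu>"
    and comp: "adm N l f0 g0" "mass N l f0 = \<mu>" "En N l f0 g0 < E"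
  shows "\<exists>u. ground_state p q (loop_graph N l) \<mu> u"
proof -
  define X where "X = {En N l f g | f g. adm N l f g \<and> mass N l f = \<mu>}"
  have max: "\<exists>M>0. (\<forall>e<N + 2. \<forall>t\<in>edge_dom l e. \<bar>f e t\<bar> \<le> M) \<and> elin M \<mu> - 2 * M powr q / q \<le> En N l f g"
    if a: "adm N l f g" "mass N l f = \<mu>" for f g
  proof -
    obtain e x where ex: "e < N + 2" "x \<in> edge_dom l e"
      "\<And>e' t. e' < N + 2 \<Longrightarrow> t \<in> edge_dom l e' \<Longrightarrow> \<bar>f e' t\<bar> \<le> \<bar>f e x\<bar>"
      using adm_attains_max[OF l a(1)] by metis
    have "0 < \<bar>f e x\<bar>"
    proof (rule ccontr)
      assume "\<not> 0 < \<bar>f e x\<bar>"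
      then have "f e' t = 0" if "e' < N + 2" "t \<in> edge_dom l e'" for e' t using ex(3)[OF that] by simp
      then have "mass N l f = (\<Sum>e<N + 2. integral (edge_dom l e) (\<lambda>t. 0))"
        unfolding mass_def by (intro sum.cong refl Henstock_Kurzweil_Integration.integral_cong) simp
      then show False using a(2) mu by simp
    qed
    then show ?thesis using En_lower(2)[OF l a(1) N _ ex(3) ex(1,2) refl] ex(3) a(2) by blast
  qed
  obtain A0 where A0: "0 < A0" "\<And>M. A0 < M \<Longrightarrow> 0 < elin M \<mu> - 2 * M powr q / q"
    using coercive[of \<mu> 0] mu by (metis less_imp_le)
  \<comment> \<open>Up to the maximum \<open>A0\<close> the positive term of \<open>elin\<close> is
    dropped and the negative ones are taken at \<open>A0\<close>; beyond \<open>A0\<close> the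
    energy is bounded below by zero through coercivity.\<close>
  define B where "B = - (A0 powr (p - 2) * \<mu> / p) - 2 * A0 powr q / q"
  have "0 \<le> A0 powr (p - 2) * \<mu> / p" "0 \<le> 2 * A0 powr q / q" using mu p2 q2 by simp_all
  then have B0: "B \<le> 0" unfolding B_def by linarith
  have low: "B \<le> elin M \<mu> - 2 * M powr q / q" if M: "0 < M" for M
  proof (cases "A0 < M")
    case True
    then show ?thesis using A0(2)[of M] B0 by linarith
  next
    case False
    then have "M powr (p - 2) * \<mu> / p \<le> A0 powr (p - 2) * \<mu> / p" "2 * M powr q / q \<le> 2 * A0 powr q / q"
      using M p2 q2 mu by (auto intro!: divide_right_mono mult_right_mono mult_left_mono powr_mono2)
    moreover have "0 \<le> 2 * Psi 1 * M powr (p / 2 + 1)" using Psi_1_pos by simp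
    ultimately show ?thesis unfolding B_def elin_def by linarith
  qed
  have XB: "B \<le> x" if x: "x \<in> X" for x
  proof -
    obtain f g where fg: "x = En N l f g" "adm N l f g" "mass N l f = \<mu>" using x unfolding X_def by blast
    obtain M where M: "0 < M" "elin M \<mu> - 2 * M powr q / q \<le> En N l f g" using max[OF fg(2,3)] by blast
    show ?thesis using low[OF M(1)] M(2) fg(1) by linarith
  qed
  have bdd: "bdd_below X" using XB by (meson bdd_belowI)
  have X0: "En N l f0 g0 \<in> X" using comp unfolding X_def by blast
  define E0 where "E0 = Inf X"
  have E0: "E0 \<le> En N l f g" if "adm N l f g" "mass N l f = \<mu>" for f g
    unfolding E0_def by (rule cInf_lower[OF _ bdd]) (use that in \<open>auto simp: X_def\<close>)
  have E0E: "E0 < E" using E0[OF comp(1,2)] comp(3) by simp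
  have "\<exists>f g. adm N l f g \<and> mass N l f = \<mu> \<and> En N l f g < E0 + inverse (real (Suc n))" for n
  proof -
    have "Inf X < E0 + inverse (real (Suc n))" by (simp add: E0_def)
    then obtain x where "x \<in> X" "x < E0 + inverse (real (Suc n))" using cInf_lessD X0 by blast
    then show ?thesis unfolding X_def by auto
  qed
  then obtain fs gs where fg: "\<And>n. adm N l (fs n) (gs n)" "\<And>n. mass N l (fs n) = \<mu>"
    "\<And>n. En N l (fs n) (gs n) < E0 + inverse (real (Suc n))" by metis
  have ub: "En N l (fs n) (gs n) \<le> E0 + 1" for n
  proof -
    have "inverse (real (Suc n)) \<le> 1" by (simp add: inverse_le_1_iff)
    then show ?thesis using fg(3)[of n] by linarith
  qed
  obtain A where A: "0 < A" "\<And>M. A < M \<Longrightarrow> E0 + 1 < elin M \<mu> - 2 * M powr q / q"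
    using coercive[of \<mu> "E0 + 1"] mu by (metis less_imp_le)
  have fA: "\<bar>fs n e t\<bar> \<le> A" if "e < N + 2" "t \<in> edge_dom l e" for n e t
  proof -
    obtain M where M: "0 < M" "\<forall>e<N + 2. \<forall>t\<in>edge_dom l e. \<bar>fs n e t\<bar> \<le> M"
      "elin M \<mu> - 2 * M powr q / q \<le> En N l (fs n) (gs n)" using max[OF fg(1,2)] by blast
    then have "M \<le> A" using A(2)[of M] ub[of n] by (meson leI le_less_trans not_less order_trans)
    then show ?thesis using M(2) that by force
  qed
  \<comment> \<open>Half the kinetic integral is the energy, here at most \<open>E0 + 1\<close>,
    plus the potential and vertex terms, which the bound \<open>A\<close> and the mass
    control.\<close>
  define C where "C = 2 * (E0 + 1 + A powr (p - 2) * \<mu> / p + 2 * A powr q / q)"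
  have kin: "integral (edge_dom l e) (\<lambda>t. (gs n e t)\<^sup>2) \<le> C" if e: "e < N + 2" for n e
  proof -
    let ?K = "\<lambda>e. integral (edge_dom l e) (\<lambda>t. (gs n e t)\<^sup>2)"
    let ?P = "\<lambda>e. integral (edge_dom l e) (\<lambda>t. \<bar>fs n e t\<bar> powr p)"
    have K0: "0 \<le> ?K e" if "e < N + 2" for e
      by (rule Henstock_Kurzweil_Integration.integral_nonneg[OF admD(6)[OF fg(1) that]]) simp
    have "?P e \<le> A powr (p - 2) * integral (edge_dom l e) (\<lambda>t. (fs n e t)\<^sup>2)" if e: "e < N + 2" for e
      unfolding integral_mult_right[symmetric]
      by (rule integral_le[OF adm_powr_integrable[OF fg(1) e l] integrable_on_mult_right[OF admD(2)[OF fg(1) e]]])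
        (use fA[OF e] in \<open>auto intro: powr_abs_le\<close>)
    then have "(\<Sum>e<N + 2. ?P e) \<le> (\<Sum>e<N + 2. A powr (p - 2) * integral (edge_dom l e) (\<lambda>t. (fs n e t)\<^sup>2))"
      by (intro sum_mono) auto
    also have "\<dots> = A powr (p - 2) * \<mu>" unfolding sum_distrib_left[symmetric] using fg(2)[of n] by (simp only: mass_def)
    finally have P: "(\<Sum>e<N + 2. ?P e) / p \<le> A powr (p - 2) * \<mu> / p" using p2 by (intro divide_right_mono) auto
    have Q: "(\<bar>fs n 0 0\<bar> powr q + \<bar>fs n 0 l\<bar> powr q) / q \<le> 2 * A powr q / q"
      using powr_mono2[OF _ _ fA[of 0 0 n], of q] powr_mono2[OF _ _ fA[of 0 l n], of q] l q2
      by (intro divide_right_mono) (auto simp: edge_dom_def)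
    have "En N l (fs n) (gs n) = (\<Sum>e<N + 2. ?K e) / 2 - (\<Sum>e<N + 2. ?P e) / p - (\<bar>fs n 0 0\<bar> powr q + \<bar>fs n 0 l\<bar> powr q) / q"
      unfolding En_def J_def sum_subtractf sum_divide_distrib ..
    moreover have "?K e \<le> (\<Sum>e<N + 2. ?K e)" by (rule member_le_sum) (use e K0 in auto)
    ultimately show ?thesis using P Q ub[of n] unfolding C_def by argo
  qed
  obtain r F H where r: "strict_mono (r :: nat \<Rightarrow> nat)" "adm N l F H" "mass N l F \<le> \<mu>"
    "\<And>e t. e < N + 2 \<Longrightarrow> t \<in> edge_dom l e \<Longrightarrow> (\<lambda>n. fs (r n) e t) \<longlonglongrightarrow> F e t"
    by (rule adm_compactness[OF l fg(1) kin fA fg(2)]) (assumption | rule that)+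
  define L where "L = - E / \<mu>"
  \<comment> \<open>For smaller mass only the mass term of \<open>elin\<close> shrinks; the positive
    term stays whole, which helps.\<close>
  have L: "- L * \<nu> \<le> elin M \<nu>" if "0 < M" "0 \<le> \<nu>" "\<nu> \<le> \<mu>" for M \<nu>
  proof -
    have "- L * \<nu> = \<nu> / \<mu> * E" by (simp add: L_def)
    also have "\<dots> \<le> \<nu> / \<mu> * elin M \<mu>" using E[OF that(1)] that mu by (intro mult_left_mono) auto
    also have "\<dots> = \<nu> / \<mu> * (2 * Psi 1 * M powr (p / 2 + 1)) - M powr (p - 2) * \<nu> / p"
      using mu by (simp add: elin_def right_diff_distrib)
    also have "\<dots> \<le> 1 * (2 * Psi 1 * M powr (p / 2 + 1)) - M powr (p - 2) * \<nu> / p"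
      using that mu Psi_1_pos by (intro diff_right_mono mult_right_mono) auto
    finally show ?thesis by (simp add: elin_def)
  qed
  let ?T = "\<lambda>f g e. J (edge_dom l e) (f e) (g e) + L * integral (edge_dom l e) (\<lambda>t. (f e t)\<^sup>2)"
  have lsc: "\<forall>\<^sub>F n in sequentially. ?T F H e - \<epsilon> \<le> ?T (fs (r n)) (gs (r n)) e" if e: "e < N + 2" and \<epsilon>: "0 < \<epsilon>" for e \<epsilon>
  proof (cases "e < 2")
    case True
    then have d: "edge_dom l e = {0..l}" by (simp add: edge_dom_def)
    show ?thesis unfolding d
      by (rule lsc_interval[of l "\<lambda>n. fs (r n) e" "\<lambda>n. gs (r n) e" "F e" "H e" \<epsilon> A L])
        (use admD(1)[OF fg(1) e] admD(1)[OF r(2) e] r(4)[OF e] fA[OF e] l \<epsilon> d in auto)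
  next
    case False
    then have d: "edge_dom l e = {0..}" by (simp add: edge_dom_def)
    have mle: "integral {0..} (\<lambda>t. (fs (r n) e t)\<^sup>2) \<le> \<mu>" for n
      using mass_nonneg(2)[OF fg(1) e, of "r n"] fg(2)[of "r n"] d by simp
    show ?thesis unfolding d
      by (rule lsc_half_line[of "\<lambda>n. fs (r n) e" "\<lambda>n. gs (r n) e" "F e" "H e" A \<mu> L \<epsilon>])
        (use admD(1,2)[OF fg(1) e] admD(1,2)[OF r(2) e] r(4)[OF e] fA[OF e] \<epsilon> d mle L in auto)
  qed
  have tot: "En N l f g + L * mass N l f = (\<Sum>e<N + 2. ?T f g e) - (\<bar>f 0 0\<bar> powr q + \<bar>f 0 l\<bar> powr q) / q" for f g
    unfolding En_def mass_def sum.distrib sum_distrib_left by simp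
  have main: "En N l F H + L * mass N l F \<le> E0 + L * \<mu>"
  proof (rule field_le_epsilon)
    fix \<epsilon> :: real assume \<epsilon>: "0 < \<epsilon>"
    \<comment> \<open>One share for each of the \<open>N + 2\<close> edges, one for the vertex terms
      and one for the distance of the sequence from the infimum.\<close>
    define \<eta> where "\<eta> = \<epsilon> / (real N + 4)"
    have \<eta>: "0 < \<eta>" "(real N + 4) * \<eta> = \<epsilon>" using \<epsilon> by (auto simp: \<eta>_def)
    have "\<forall>\<^sub>F n in sequentially. \<forall>e\<in>{..<N + 2}. ?T F H e - \<eta> \<le> ?T (fs (r n)) (gs (r n)) e"
      by (rule eventually_ball_finite) (use lsc \<eta>(1) in auto)
    moreover have "(\<lambda>n. (\<bar>fs (r n) 0 0\<bar> powr q + \<bar>fs (r n) 0 l\<bar> powr q) / q) \<longlonglongrightarrow> (\<bar>F 0 0\<bar> powr q + \<bar>F 0 l\<bar> powr q) / q"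
      using q2 l by (intro tendsto_intros tendsto_powr' r(4)) (auto simp: edge_dom_def)
    then have "\<forall>\<^sub>F n in sequentially. (\<bar>fs (r n) 0 0\<bar> powr q + \<bar>fs (r n) 0 l\<bar> powr q) / q < (\<bar>F 0 0\<bar> powr q + \<bar>F 0 l\<bar> powr q) / q + \<eta>"
      by (rule order_tendstoD(2)) (use \<eta> in simp)
    moreover have "\<forall>\<^sub>F n in sequentially. inverse (real (Suc n)) < \<eta>"
      by (rule order_tendstoD(2)[OF LIMSEQ_inverse_real_of_nat \<eta>(1)])
    ultimately have "\<forall>\<^sub>F n in sequentially. En N l F H + L * mass N l F \<le> E0 + L * \<mu> + \<epsilon>"
    proof eventually_elim
      case (elim n)
      have "(\<Sum>e<N + 2. ?T F H e - \<eta>) \<le> (\<Sum>e<N + 2. ?T (fs (r n)) (gs (r n)) e)"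
        by (rule sum_mono) (use elim(1) in blast)
      then have 1: "(\<Sum>e<N + 2. ?T F H e) - (real N + 2) * \<eta> \<le> (\<Sum>e<N + 2. ?T (fs (r n)) (gs (r n)) e)"
        by (simp add: sum_subtractf add.commute del: sum.lessThan_Suc)
      have "inverse (real (Suc (r n))) \<le> inverse (real (Suc n))"
        using seq_suble[OF r(1), of n] by (intro le_imp_inverse_le) auto
      then have 2: "En N l (fs (r n)) (gs (r n)) \<le> E0 + \<eta>" using fg(3)[of "r n"] elim(3) by linarith
      have "(real N + 4) * \<eta> = (real N + 2) * \<eta> + \<eta> + \<eta>" by (simp add: algebra_simps)
      then show ?case using 1 2 elim(2) tot[of F H] tot[of "fs (r n)" "gs (r n)"] fg(2)[of "r n"] \<eta>(2) by simp
    qed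
    from eventually_happens'[OF sequentially_bot this] show "En N l F H + L * mass N l F \<le> E0 + L * \<mu> + \<epsilon>" by blast
  qed
  define m where "m = mass N l F"
  have m: "0 \<le> m" "m \<le> \<mu>" using mass_nonneg(1)[OF r(2)] r(3) by (auto simp: m_def)
  have "m / \<mu> * E0 \<le> En N l F H" unfolding m_def by (rule En_lower_scaled[OF l r(2) mu r(3) E0])
  then have "m / \<mu> * E0 + L * m \<le> E0 + L * \<mu>" using main by (simp add: m_def)
  moreover have "m / \<mu> * E0 + L * m = m / \<mu> * (E0 - E)" "E0 + L * \<mu> = 1 * (E0 - E)"
    using mu by (auto simp: L_def field_simps)
  ultimately have "m / \<mu> * (E0 - E) \<le> 1 * (E0 - E)" by simp
  then have "1 \<le> m / \<mu>" using mult_strict_right_mono_neg[of "m / \<mu>" 1 "E0 - E"] E0E by fastforce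
  then have meq: "mass N l F = \<mu>" using m mu by (simp add: m_def)
  then have EF: "En N l F H \<le> E0" using main by simp
  obtain u where u: "u \<in> H1_mass (loop_graph N l) \<mu>" "energy p q (loop_graph N l) u = En N l F H"
    using H1_of_adm[OF l r(2) meq] by metis
  have min: "energy p q (loop_graph N l) u \<le> energy p q (loop_graph N l) w" if w: "w \<in> H1_mass (loop_graph N l) \<mu>" for w
  proof -
    obtain f g where "adm N l f g" "mass N l f = \<mu>" "energy p q (loop_graph N l) w = En N l f g"
      using adm_of_H1[OF l w] by metis
    then show ?thesis using EF E0 u(2) by force
  qed
  have "ground_state p q (loop_graph N l) \<mu> u" unfolding ground_state_def
    using u(1) min by (auto intro!: antisym INF_lower INF_greatest)
  then show ?thesis by blast
qed

end

section \<open>The soliton\<close>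

text \<open>The improper integral by an antiderivative; existence comes from the nonnegative
  Lebesgue integral.\<close>

lemma has_integral_half_line:
  fixes F f :: "real \<Rightarrow> real"
  assumes "continuous_on UNIV f" and d: "\<And>x. a \<le> x \<Longrightarrow> (F has_real_derivative f x) (at x)"
    and nn: "\<And>x. a \<le> x \<Longrightarrow> 0 \<le> f x" and lim: "(F \<longlongrightarrow> T) at_top"
  shows "(f has_integral (T - F a)) {a..}"
proof -
  have [measurable]: "f \<in> borel_measurable borel" by (rule borel_measurable_continuous_onI[OF assms(1)])
  have "F a \<le> F y" if "a \<le> y" for y
    by (rule DERIV_nonneg_imp_nondecreasing[OF that]) (use d nn in blast)
  then have "F a \<le> T" by (intro tendsto_lowerbound[OF lim] eventually_mono[OF eventually_ge_at_top[of a]]) auto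
  define h where "h x = (if x \<in> {a..} then f x else 0)" for x
  have "h \<in> borel_measurable borel" unfolding h_def by measurable
  moreover have "ennreal (h x) = ennreal (f x) * indicator {a..} x" for x by (auto simp: h_def)
  then have "(\<integral>\<^sup>+x. h x \<partial>lborel) = ennreal (T - F a)"
    using nn_integral_FTC_atLeast[of f a F T] d nn lim by simp
  ultimately have "(h has_integral (T - F a)) UNIV"
    using nn \<open>F a \<le> T\<close> by (intro nn_integral_has_integral) (auto simp: h_def)
  then show ?thesis unfolding h_def[abs_def] has_integral_restrict_UNIV .
qed

lemma prim_on_C1:
  fixes f g :: "real \<Rightarrow> real"
  assumes d: "\<And>x. (f has_real_derivative g x) (at x)" and c: "continuous_on UNIV g" and i: "(\<lambda>t. (g t)\<^sup>2) integrable_on S"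
  shows "prim_on S f g"
  unfolding prim_on_def
proof (intro conjI ballI impI i)
  show "g \<in> borel_measurable borel" by (rule borel_measurable_continuous_onI[OF c])
  fix a b :: real assume "a \<le> b"
  then have "(g has_integral (f b - f a)) {a..b}"
    by (rule fundamental_theorem_of_calculus)
      (use d in \<open>auto simp: has_real_derivative_iff_has_vector_derivative[symmetric] intro: has_field_derivative_at_within\<close>)
  then show "f b - f a = integral {a..b} g" by (simp add: integral_unique)
qed

text \<open>Convexity of the exponential function bounds \<open>x powr c\<close> by the mean of
  \<open>x powr a\<close> and 1 with weights \<open>c / a\<close> and \<open>1 - c / a\<close>.
  Equality holds at \<open>x = 1\<close>.\<close>

lemma powr_Bernoulli:
  fixes x a c :: real
  assumes x: "0 < x" and ac: "0 < c" "c < a"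
  shows "1 - a / c \<le> x powr a - a / c * x powr c"
proof -
  have "exp ((c / a) *\<^sub>R (a * ln x) + (1 - c / a) *\<^sub>R 0) \<le> c / a * exp (a * ln x) + (1 - c / a) * exp 0"
    using convex_onD[OF exp_convex, of "1 - c / a" "a * ln x" 0] ac by (simp add: add.commute)
  then have "x powr c \<le> c / a * x powr a + (1 - c / a)" using x ac by (simp add: powr_def)
  then have "a / c * x powr c \<le> a / c * (c / a * x powr a + (1 - c / a))" using ac by (intro mult_left_mono) auto
  also have "\<dots> = x powr a + (a / c - 1)" using ac by (simp add: field_simps)
  finally show ?thesis by simp
qed

context exponents
begin

text \<open>The decay rate of the soliton: near level 0 the weight h for maximum \<open>M\<close>
  behaves like \<open>om M\<close> times the level.\<close>

definition om :: "real \<Rightarrow> real" where "om M = sqrt (2 / p) * M powr ((p - 2) / 2)"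

definition kap :: "real \<Rightarrow> real" where "kap M = (p - 2) / 2 * om M"

text \<open>The soliton of the line with height \<open>M\<close>, centred at 0: a power of the
  hyperbolic secant.\<close>

definition sol :: "real \<Rightarrow> real \<Rightarrow> real" where "sol M x = M * cosh (kap M * x) powr (- 2 / (p - 2))"

definition sol' :: "real \<Rightarrow> real \<Rightarrow> real" where "sol' M x = - om M * sol M x * tanh (kap M * x)"

text \<open>The mass of the soliton beyond \<open>y\<close> in closed form. By the soliton equation
  the derivatives of \<open>G M (sol M y)\<close> and of \<open>sol M y * sol' M y\<close> are
  combinations of the squares of \<open>sol'\<close> and \<open>sol\<close>; the factor
  \<open>1 + p / 2\<close> cancels the square of \<open>sol'\<close>.\<close>

definition tailB :: "real \<Rightarrow> real \<Rightarrow> real" where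
  "tailB M y = ((1 + p / 2) * G M (sol M y) + sol M y * sol' M y) / ((p / 2 - 1) * (om M)\<^sup>2)"

lemma om_pos: "0 < M \<Longrightarrow> 0 < om M"
  using p2 by (simp add: om_def)

lemma kap_pos: "0 < M \<Longrightarrow> 0 < kap M"
  using p2 om_pos by (simp add: kap_def)

lemma om_square: "0 < M \<Longrightarrow> (om M)\<^sup>2 = 2 / p * M powr (p - 2)"
proof -
  assume M: "0 < M"
  have "(M powr ((p - 2) / 2))\<^sup>2 = M powr (p - 2)" by (simp add: power2_eq_square flip: powr_add)
  then show ?thesis using p2 by (simp add: om_def power_mult_distrib)
qed

lemma sol_pos: "0 < M \<Longrightarrow> 0 < sol M x"
  by (simp add: sol_def)

lemma sol_le: "0 < M \<Longrightarrow> sol M x \<le> M"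
proof -
  assume M: "0 < M"
  have "cosh (kap M * x) powr (- 2 / (p - 2)) \<le> 1 powr (- 2 / (p - 2))"
    using p2 cosh_real_ge_1[of "kap M * x"] by (intro powr_mono2') (auto simp: divide_nonpos_pos)
  then show ?thesis using M mult_left_mono[of _ 1 M] by (simp add: sol_def)
qed

lemma sol_0 [simp]: "sol M 0 = M"
  by (simp add: sol_def)

lemma sol'_0 [simp]: "sol' M 0 = 0"
  by (simp add: sol'_def)

lemma sol_minus [simp]: "sol M (- x) = sol M x" "sol' M (- x) = - sol' M x"
  by (simp_all add: sol_def sol'_def)

lemma DERIV_sol: "0 < M \<Longrightarrow> (sol M has_real_derivative sol' M x) (at x)"
proof -
  assume M: "0 < M"
  let ?c = "cosh (kap M * x)" and ?b = "- 2 / (p - 2)"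
  have "((\<lambda>x. cosh (kap M * x)) has_real_derivative (sinh (kap M * x) * kap M)) (at x)"
    by (auto intro!: derivative_eq_intros)
  from DERIV_chain2[OF has_real_derivative_powr[of "cosh (kap M * x)" ?b] this]
  have "((\<lambda>x. cosh (kap M * x) powr ?b) has_real_derivative ?b * ?c powr (?b - 1) * (sinh (kap M * x) * kap M)) (at x)"
    by simp
  then have "(sol M has_real_derivative M * (?b * ?c powr (?b - 1) * (sinh (kap M * x) * kap M))) (at x)"
    unfolding sol_def[abs_def] by (rule DERIV_cmult)
  moreover have "M * (?b * ?c powr (?b - 1) * (sinh (kap M * x) * kap M)) = sol' M x"
  proof -
    have b: "?b * kap M = - om M" using p2 by (simp add: kap_def field_simps)
    have "?c powr (?b - 1) = ?c powr ?b / ?c" by (simp add: powr_diff)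
    then have "M * (?b * ?c powr (?b - 1) * (sinh (kap M * x) * kap M)) = (?b * kap M) * (M * ?c powr ?b) * tanh (kap M * x)"
      by (simp add: tanh_def)
    then show ?thesis unfolding b sol'_def sol_def .
  qed
  ultimately show ?thesis by simp
qed

lemma sol_continuous: "0 < M \<Longrightarrow> continuous_on UNIV (sol M)"
  using DERIV_sol by (meson DERIV_continuous_on has_field_derivative_at_within)

lemma sol'_continuous: "0 < M \<Longrightarrow> continuous_on UNIV (sol' M)"
  unfolding sol'_def[abs_def] by (intro continuous_intros sol_continuous) (auto intro: less_imp_neq[THEN not_sym])

lemma tanh_square: "0 < M \<Longrightarrow> (tanh (kap M * x))\<^sup>2 = 1 - (sol M x / M) powr (p - 2)"
proof -
  assume M: "0 < M"
  let ?c = "cosh (kap M * x)"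
  have c: "0 < ?c" by simp
  have "(sol M x / M) powr (p - 2) = ?c powr (- 2 / (p - 2) * (p - 2))"
    using M by (simp add: sol_def powr_powr)
  also have "- 2 / (p - 2) * (p - 2) = - 2"
  proof -
    have "p - 2 \<noteq> 0" using p2 by simp
    then show ?thesis by (rule nonzero_eq_divide_eq[THEN iffD1, OF _ refl])
  qed
  also have "?c powr (- 2) = 1 / ?c\<^sup>2" using c by (simp add: powr_minus_divide)
  finally have "(sol M x / M) powr (p - 2) = 1 / ?c\<^sup>2" .
  moreover have "(tanh (kap M * x))\<^sup>2 = 1 - 1 / ?c\<^sup>2"
  proof -
    have "(tanh (kap M * x))\<^sup>2 = (sinh (kap M * x))\<^sup>2 / ?c\<^sup>2" by (simp add: tanh_def power_divide)
    also have "(sinh (kap M * x))\<^sup>2 = ?c\<^sup>2 - 1" by (simp add: cosh_square_eq)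
    finally show ?thesis using c by (simp add: diff_divide_distrib)
  qed
  ultimately show ?thesis by simp
qed

text \<open>First integral of the soliton equation, obtained from the relation between tanh and
  cosh. To the right of the centre it says that \<open>sol'\<close> is minus the calibrating weight
  at \<open>sol\<close>, so the soliton gives equality in the calibration.\<close>

lemma sol'_square: "0 < M \<Longrightarrow> (sol' M x)\<^sup>2 = (om M)\<^sup>2 * (sol M x)\<^sup>2 - 2 / p * sol M x powr p"
proof -
  assume M: "0 < M"
  note s = sol_pos[OF M, of x]
  have "(sol' M x)\<^sup>2 = (om M)\<^sup>2 * (sol M x)\<^sup>2 * (1 - (sol M x / M) powr (p - 2))"
    by (simp add: sol'_def power_mult_distrib tanh_square[OF M])
  also have "\<dots> = (om M)\<^sup>2 * (sol M x)\<^sup>2 - (om M)\<^sup>2 * ((sol M x)\<^sup>2 * (sol M x / M) powr (p - 2))"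
    by (simp add: right_diff_distrib)
  also have "(om M)\<^sup>2 * ((sol M x)\<^sup>2 * (sol M x / M) powr (p - 2)) = 2 / p * ((sol M x)\<^sup>2 * sol M x powr (p - 2))"
    using M s by (simp add: om_square powr_divide)
  also have "(sol M x)\<^sup>2 * sol M x powr (p - 2) = sol M x powr p"
    using s powr_add[of "sol M x" 2 "p - 2"] by simp
  finally show ?thesis .
qed

lemma sol'_nonpos: "0 < M \<Longrightarrow> 0 \<le> x \<Longrightarrow> sol' M x \<le> 0"
  unfolding sol'_def using sol_pos[of M x] om_pos[of M] kap_pos[of M] by (simp add: mult_nonneg_nonneg)

text \<open>The derivative of \<open>G M\<close> is the weight, and the weight at the soliton is
  \<open>- sol'\<close>. Hence \<open>G M (sol M x)\<close> is the kinetic integral of the soliton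
  beyond \<open>x\<close>.\<close>

lemma DERIV_G_sol: "0 < M \<Longrightarrow> 0 \<le> x \<Longrightarrow> ((\<lambda>x. G M (sol M x)) has_real_derivative - (sol' M x)\<^sup>2) (at x)"
proof -
  assume M: "0 < M" and x: "0 \<le> x"
  define t where "t = sol M x / M"
  have mem: "sol M y / M \<in> {0..1}" for y using sol_pos[OF M, of y] sol_le[OF M, of y] M by simp
  have "(Psi has_real_derivative calib t) (at (sol M x / M) within (\<lambda>x. sol M x / M) ` UNIV)"
    unfolding t_def by (rule DERIV_subset[OF Psi_deriv[OF mem]]) (use mem in auto)
  moreover have "((\<lambda>x. sol M x / M) has_real_derivative sol' M x / M) (at x within UNIV)"
    using DERIV_cdivide[OF DERIV_sol[OF M, of x], of M] by simp
  ultimately have "((Psi \<circ> (\<lambda>x. sol M x / M)) has_real_derivative calib t * (sol' M x / M)) (at x within UNIV)"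
    by (rule DERIV_image_chain)
  from DERIV_cmult[OF this, of "M powr (p / 2 + 1)"]
  have d: "((\<lambda>x. G M (sol M x)) has_real_derivative M powr (p / 2 + 1) * (calib t * (sol' M x / M))) (at x)"
    by (simp add: G_def[abs_def] o_def)
  have t: "0 \<le> t" "t \<le> 1" using mem[of x] by (auto simp: t_def)
  have "M powr (p / 2) * calib t = - sol' M x"
  proof (rule power2_eq_imp_eq)
    have "(M powr (p / 2) * calib t)\<^sup>2 = M powr p * (2 / p * (t\<^sup>2 - t powr p))"
      using calib_square[OF t] by (simp add: power_mult_distrib power2_eq_square[of "M powr _"] flip: powr_add)
    also have "\<dots> = 2 / p * (M powr p / M\<^sup>2 * (sol M x)\<^sup>2 - sol M x powr p)"
      using M sol_pos[OF M, of x] by (simp add: t_def powr_divide power_divide right_diff_distrib mult_ac)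
    also have "M powr p / M\<^sup>2 = M powr (p - 2)" using M by (simp add: powr_diff)
    also have "2 / p * (M powr (p - 2) * (sol M x)\<^sup>2 - sol M x powr p) = (sol' M x)\<^sup>2"
      using M by (simp add: sol'_square om_square right_diff_distrib)
    finally show "(M powr (p / 2) * calib t)\<^sup>2 = (- sol' M x)\<^sup>2" by simp
  qed (use t sol'_nonpos[OF M x] calib_nonneg in auto)
  moreover have "M powr (p / 2 + 1) * (calib t * (sol' M x / M)) = (M powr (p / 2) * calib t) * sol' M x"
    using M by (simp add: powr_add)
  ultimately have "M powr (p / 2 + 1) * (calib t * (sol' M x / M)) = - (sol' M x)\<^sup>2"
    by (simp add: power2_eq_square)
  with d show ?thesis by simp
qed

lemma DERIV_tailB: "0 < M \<Longrightarrow> 0 \<le> x \<Longrightarrow> (tailB M has_real_derivative - (sol M x)\<^sup>2) (at x)"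
proof -
  assume M: "0 < M" and x: "0 \<le> x"
  define T where "T = tanh (kap M * x)"
  define s where "s = sol M x"
  have dt: "((\<lambda>x. tanh (kap M * x)) has_real_derivative (1 - T\<^sup>2) * kap M) (at x)"
    unfolding T_def by (auto intro!: derivative_eq_intros)
  have "((\<lambda>x. - om M * sol M x * tanh (kap M * x)) has_real_derivative
      - om M * sol' M x * T + - om M * s * ((1 - T\<^sup>2) * kap M)) (at x)"
    using DERIV_mult[OF DERIV_cmult[OF DERIV_sol[OF M], of "- om M"] dt] by (simp add: T_def s_def algebra_simps)
  then have d': "(sol' M has_real_derivative - om M * sol' M x * T + - om M * s * ((1 - T\<^sup>2) * kap M)) (at x)"
    by (simp add: sol'_def[abs_def])
  have "((\<lambda>x. (1 + p / 2) * G M (sol M x) + sol M x * sol' M x) has_real_derivative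
     (1 + p / 2) * - (sol' M x)\<^sup>2 + (sol' M x * sol' M x + (- om M * sol' M x * T + - om M * s * ((1 - T\<^sup>2) * kap M)) * sol M x)) (at x)"
    by (intro DERIV_add DERIV_cmult DERIV_G_sol[OF M x] DERIV_mult DERIV_sol[OF M] d')
  from DERIV_cdivide[OF this, of "(p / 2 - 1) * (om M)\<^sup>2"]
  have D: "(tailB M has_real_derivative ((1 + p / 2) * - (sol' M x)\<^sup>2 + (sol' M x * sol' M x + (- om M * sol' M x * T + - om M * s * ((1 - T\<^sup>2) * kap M)) * sol M x))
     / ((p / 2 - 1) * (om M)\<^sup>2)) (at x)"
    by (simp add: tailB_def[abs_def])
  have s': "sol' M x = - om M * s * T" by (simp add: sol'_def s_def T_def)
  have "(1 + p / 2) * - (sol' M x)\<^sup>2 + (sol' M x * sol' M x + (- om M * sol' M x * T + - om M * s * ((1 - T\<^sup>2) * kap M)) * sol M x)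
     = - s\<^sup>2 * ((p / 2 - 1) * (om M)\<^sup>2)"
    unfolding s' kap_def s_def[symmetric] by (simp add: field_simps power2_eq_square)
  then show ?thesis using D om_pos[OF M] p2 by (simp add: s_def)
qed

lemma sol_tendsto: "0 < M \<Longrightarrow> (sol M \<longlongrightarrow> 0) at_top"
proof -
  assume M: "0 < M"
  have lin: "filterlim (\<lambda>x. kap M * x) at_top at_top"
    by (rule filterlim_tendsto_pos_mult_at_top[OF tendsto_const kap_pos[OF M] filterlim_ident])
  have "filterlim (\<lambda>x. cosh (kap M * x)) at_top at_top"
    by (rule filterlim_compose[OF cosh_real_at_top lin])
  then have "((\<lambda>x. cosh (kap M * x) powr (- 2 / (p - 2))) \<longlongrightarrow> 0) at_top"
    using p2 by (intro tendsto_neg_powr) (auto simp: divide_neg_pos)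
  from tendsto_mult_left[OF this, of M] show ?thesis by (simp add: sol_def[abs_def])
qed

lemma G_sol_bounds: "0 < M \<Longrightarrow> 0 \<le> G M (sol M x)" "0 < M \<Longrightarrow> G M (sol M x) \<le> M powr (p / 2) * sol M x"
  using G_nonneg[of "sol M x" M] G_le[of "sol M x" M] sol_pos[of M x] sol_le[of M x] by auto

lemma G_sol_tendsto: "0 < M \<Longrightarrow> ((\<lambda>x. G M (sol M x)) \<longlongrightarrow> 0) at_top"
  by (rule tendsto_sandwich[OF _ _ tendsto_const, of _ _ _ "\<lambda>x. M powr (p / 2) * sol M x"])
    (use G_sol_bounds tendsto_mult_left[OF sol_tendsto, of M "M powr (p / 2)"] in auto)

lemma abs_sol'_le: "0 < M \<Longrightarrow> \<bar>sol' M x\<bar> \<le> om M * sol M x"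
proof -
  assume M: "0 < M"
  have "\<bar>tanh (kap M * x)\<bar> \<le> 1" using tanh_real_bounds[of "kap M * x"] by auto
  then have "om M * sol M x * \<bar>tanh (kap M * x)\<bar> \<le> om M * sol M x * 1"
    using om_pos[OF M] sol_pos[OF M, of x] by (intro mult_left_mono) auto
  then show ?thesis using om_pos[OF M] sol_pos[OF M, of x] by (simp add: sol'_def abs_mult)
qed

lemma tailB_tendsto: "0 < M \<Longrightarrow> (tailB M \<longlongrightarrow> 0) at_top"
proof -
  assume M: "0 < M"
  have "(sol' M \<longlongrightarrow> 0) at_top"
  proof (rule Lim_null_comparison)
    show "\<forall>\<^sub>F x in at_top. norm (sol' M x) \<le> om M * sol M x" using abs_sol'_le[OF M] by simp
    show "((\<lambda>x. om M * sol M x) \<longlongrightarrow> 0) at_top" using tendsto_mult_left[OF sol_tendsto[OF M], of "om M"] by simp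
  qed
  then have "((\<lambda>x. ((1 + p / 2) * G M (sol M x) + sol M x * sol' M x) / ((p / 2 - 1) * (om M)\<^sup>2))
      \<longlongrightarrow> ((1 + p / 2) * 0 + 0 * 0) / ((p / 2 - 1) * (om M)\<^sup>2)) at_top"
    using om_pos[OF M] p2 by (intro tendsto_intros G_sol_tendsto[OF M] sol_tendsto[OF M]) auto
  then show ?thesis by (simp add: tailB_def[abs_def])
qed

lemma tailB_le: "0 < M \<Longrightarrow> 0 \<le> y \<Longrightarrow> tailB M y \<le> (1 + p / 2) * G M (sol M y) / ((p / 2 - 1) * (om M)\<^sup>2)"
  unfolding tailB_def using sol_pos[of M y] sol'_nonpos[of M y] p2
  by (intro divide_right_mono) (auto simp: mult_nonneg_nonpos)

lemma sol_integrals_right: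
  assumes M: "0 < M" and c: "0 \<le> a + c"
  shows "((\<lambda>t. (sol' M (t + c))\<^sup>2) has_integral G M (sol M (a + c))) {a..}"
    "((\<lambda>t. (sol M (t + c))\<^sup>2) has_integral tailB M (a + c)) {a..}"
proof -
  have shift: "filterlim (\<lambda>t. t + c) at_top at_top" by (rule filterlim_tendsto_add_at_top[OF tendsto_const filterlim_ident, of c, simplified add.commute])
  have sh: "((\<lambda>t. t + c) has_real_derivative 1) (at x)" for x by (auto intro!: derivative_eq_intros)
  have "((\<lambda>t. (sol' M (t + c))\<^sup>2) has_integral (- 0 - - G M (sol M (a + c)))) {a..}"
  proof (rule has_integral_half_line)
    show "continuous_on UNIV (\<lambda>t. (sol' M (t + c))\<^sup>2)"
      by (intro continuous_intros continuous_on_compose2[OF sol'_continuous[OF M]]) auto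
    show "((\<lambda>t. - G M (sol M (t + c))) has_real_derivative (sol' M (x + c))\<^sup>2) (at x)" if "a \<le> x" for x
      using DERIV_minus[OF DERIV_chain2[OF DERIV_G_sol[OF M, of "x + c"] sh]] that c by simp
    show "((\<lambda>t. - G M (sol M (t + c))) \<longlongrightarrow> - 0) at_top"
      by (intro tendsto_intros filterlim_compose[OF G_sol_tendsto[OF M] shift])
  qed simp
  then show "((\<lambda>t. (sol' M (t + c))\<^sup>2) has_integral G M (sol M (a + c))) {a..}" by simp
  have "((\<lambda>t. (sol M (t + c))\<^sup>2) has_integral (- 0 - - tailB M (a + c))) {a..}"
  proof (rule has_integral_half_line)
    show "continuous_on UNIV (\<lambda>t. (sol M (t + c))\<^sup>2)"
      by (intro continuous_intros continuous_on_compose2[OF sol_continuous[OF M]]) auto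
    show "((\<lambda>t. - tailB M (t + c)) has_real_derivative (sol M (x + c))\<^sup>2) (at x)" if "a \<le> x" for x
      using DERIV_minus[OF DERIV_chain2[OF DERIV_tailB[OF M, of "x + c"] sh]] that c by simp
    show "((\<lambda>t. - tailB M (t + c)) \<longlongrightarrow> - 0) at_top"
      by (intro tendsto_intros filterlim_compose[OF tailB_tendsto[OF M] shift])
  qed simp
  then show "((\<lambda>t. (sol M (t + c))\<^sup>2) has_integral tailB M (a + c)) {a..}" by simp
qed

lemma sol_integrals_left:
  assumes M: "0 < M" and L: "0 \<le> L"
  shows "((\<lambda>t. (sol' M (L - t))\<^sup>2) has_integral (G M M - G M (sol M L))) {0..L}"
    "((\<lambda>t. (sol M (L - t))\<^sup>2) has_integral (tailB M 0 - tailB M L)) {0..L}"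
proof -
  have sh: "((\<lambda>t. L - t) has_real_derivative - 1) (at x within {0..L})" for x by (auto intro!: derivative_eq_intros)
  have "((\<lambda>t. (sol' M (L - t))\<^sup>2) has_integral (G M (sol M (L - L)) - G M (sol M (L - 0)))) {0..L}"
  proof (rule fundamental_theorem_of_calculus[OF L])
    fix x assume "x \<in> {0..L}"
    then have "((\<lambda>t. G M (sol M (L - t))) has_real_derivative (sol' M (L - x))\<^sup>2) (at x within {0..L})"
      using DERIV_chain2[OF DERIV_G_sol[OF M, of "L - x"] sh] by simp
    then show "((\<lambda>t. G M (sol M (L - t))) has_vector_derivative (sol' M (L - x))\<^sup>2) (at x within {0..L})"
      by (simp add: has_real_derivative_iff_has_vector_derivative)
  qed
  then show "((\<lambda>t. (sol' M (L - t))\<^sup>2) has_integral (G M M - G M (sol M L))) {0..L}" by simp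
  have "((\<lambda>t. (sol M (L - t))\<^sup>2) has_integral (tailB M (L - L) - tailB M (L - 0))) {0..L}"
  proof (rule fundamental_theorem_of_calculus[OF L])
    fix x assume "x \<in> {0..L}"
    then have "((\<lambda>t. tailB M (L - t)) has_real_derivative (sol M (L - x))\<^sup>2) (at x within {0..L})"
      using DERIV_chain2[OF DERIV_tailB[OF M, of "L - x"] sh] by simp
    then show "((\<lambda>t. tailB M (L - t)) has_vector_derivative (sol M (L - x))\<^sup>2) (at x within {0..L})"
      by (simp add: has_real_derivative_iff_has_vector_derivative)
  qed
  then show "((\<lambda>t. (sol M (L - t))\<^sup>2) has_integral (tailB M 0 - tailB M L)) {0..L}" by simp
qed

lemma tailB_nonneg: "0 < M \<Longrightarrow> 0 \<le> y \<Longrightarrow> 0 \<le> tailB M y"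
  using has_integral_nonneg[OF sol_integrals_right(2)[of M y 0]] by simp

text \<open>The first integral expresses the potential term by kinetic integral and mass, so it
  requires no antiderivative of its own.\<close>

lemma sol_powr_has_integral:
  assumes M: "0 < M" and "((\<lambda>t. (sol' M (u t))\<^sup>2) has_integral K) S" "((\<lambda>t. (sol M (u t))\<^sup>2) has_integral m) S"
  shows "((\<lambda>t. \<bar>sol M (u t)\<bar> powr p) has_integral p / 2 * ((om M)\<^sup>2 * m - K)) S"
proof -
  have "((\<lambda>t. p / 2 * ((om M)\<^sup>2 * (sol M (u t))\<^sup>2 - (sol' M (u t))\<^sup>2)) has_integral p / 2 * ((om M)\<^sup>2 * m - K)) S"
    by (intro has_integral_mult_right has_integral_diff assms)
  moreover have "p / 2 * ((om M)\<^sup>2 * (sol M (u t))\<^sup>2 - (sol' M (u t))\<^sup>2) = \<bar>sol M (u t)\<bar> powr p" for t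
    using p2 sol_pos[OF M, of "u t"] by (simp add: sol'_square[OF M])
  ultimately show ?thesis by simp
qed

section \<open>Mass and energy of the soliton\<close>

definition sol_mass :: "real \<Rightarrow> real" where "sol_mass M = 2 * tailB M 0"

lemma sol_mass_eq:
  assumes M: "0 < M"
  shows "sol_mass M = p * (p + 2) / (p - 2) * Psi 1 * M powr (3 - p / 2)"
proof -
  have "sol_mass M = 2 * ((1 + p / 2) * (M powr (p / 2 + 1) * Psi 1)) / ((p / 2 - 1) * (2 / p * M powr (p - 2)))"
    by (simp add: sol_mass_def tailB_def G_self[OF M] om_square[OF M])
  also have "\<dots> = p * (p + 2) / (p - 2) * Psi 1 * (M powr (p / 2 + 1) / M powr (p - 2))"
    using p2 M by (simp add: field_simps)
  also have "M powr (p / 2 + 1) / M powr (p - 2) = M powr (3 - p / 2)"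
    using M by (simp add: powr_diff[symmetric])
  finally show ?thesis .
qed

lemma sol_mass_pos: "0 < M \<Longrightarrow> 0 < sol_mass M"
  using p2 Psi_1_pos by (simp add: sol_mass_eq)

lemma sol_mass_surj:
  assumes mu: "0 < \<mu>"
  obtains M where "0 < M" "sol_mass M = \<mu>"
proof -
  define c where "c = p * (p + 2) / (p - 2) * Psi 1"
  have c: "0 < c" using p2 Psi_1_pos by (simp add: c_def)
  define M where "M = (\<mu> / c) powr (1 / (3 - p / 2))"
  have M: "0 < M" using c mu by (simp add: M_def)
  have "M powr (3 - p / 2) = \<mu> / c" using p6 c mu by (simp add: M_def powr_powr)
  then have "sol_mass M = c * (\<mu> / c)" using sol_mass_eq[OF M] by (simp only: c_def)
  then have "sol_mass M = \<mu>" using c by simp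
  then show thesis using that[of M] c mu by (simp add: M_def)
qed

text \<open>In the variable \<open>y = x / M\<close> the function is a positive multiple of
  \<open>y powr (p / 2 + 1) - (p / 2 + 1) / (p - 2) * y powr (p - 2)\<close>, which is minimal at 1
  by \<open>powr_Bernoulli\<close>; \<open>p < 6\<close> puts the two exponents in order.\<close>

lemma elin_min:
  assumes M: "0 < M" and x: "0 < x"
  shows "elin M (sol_mass M) \<le> elin x (sol_mass M)"
proof -
  define y where "y = x / M"
  have y: "0 < y" "x = M * y" using M x by (auto simp: y_def)
  have e: "elin (M * y) (sol_mass M) = 2 * Psi 1 * M powr (p / 2 + 1) * (y powr (p / 2 + 1) - (p / 2 + 1) / (p - 2) * y powr (p - 2))" if "0 < y" for y
  proof -
    have "M powr (p - 2) * M powr (3 - p / 2) = M powr (p / 2 + 1)"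
      by (simp add: add.commute flip: powr_add)
    then have "(M * y) powr (p - 2) * sol_mass M / p = (p + 2) / (p - 2) * Psi 1 * M powr (p / 2 + 1) * y powr (p - 2)"
      using that M p2 by (simp add: sol_mass_eq powr_mult mult_ac)
    also have "(p + 2) / (p - 2) = 2 * ((p / 2 + 1) / (p - 2))"
    proof -
      have "p + 2 = 2 * (p / 2 + 1)" by simp
      then show ?thesis by (simp only: times_divide_eq_right)
    qed
    finally show ?thesis using that M by (simp add: elin_def powr_mult right_diff_distrib mult_ac)
  qed
  have "1 - (p / 2 + 1) / (p - 2) \<le> y powr (p / 2 + 1) - (p / 2 + 1) / (p - 2) * y powr (p - 2)"
    by (rule powr_Bernoulli) (use y p2 p6 in auto)
  then have "2 * Psi 1 * M powr (p / 2 + 1) * (1 powr (p / 2 + 1) - (p / 2 + 1) / (p - 2) * 1 powr (p - 2))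
     \<le> 2 * Psi 1 * M powr (p / 2 + 1) * (y powr (p / 2 + 1) - (p / 2 + 1) / (p - 2) * y powr (p - 2))"
    using Psi_1_pos by (intro mult_left_mono) auto
  then show ?thesis using e[of 1] e[of y] y by simp
qed

lemma elin_sol: "0 < M \<Longrightarrow> elin M (sol_mass M) = 2 * G M M - (om M)\<^sup>2 * sol_mass M / 2"
  by (simp add: elin_def G_self om_square)

text \<open>The integral of the p-th power of the soliton over the line, expressed through the first
  integral.\<close>

definition sol_pot :: "real \<Rightarrow> real" where
  "sol_pot M = p / 2 * ((om M)\<^sup>2 * sol_mass M - 2 * G M M)"

text \<open>The difference of the two sides is, up to the factor \<open>p / 2\<close>, the potential
  integral over the tail.\<close>

lemma G_sol_le_tailB: "0 < M \<Longrightarrow> 0 \<le> y \<Longrightarrow> G M (sol M y) \<le> (om M)\<^sup>2 * tailB M y"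
proof -
  assume M: "0 < M" and y: "0 \<le> y"
  have "((\<lambda>t. \<bar>sol M (t + 0)\<bar> powr p) has_integral p / 2 * ((om M)\<^sup>2 * tailB M (y + 0) - G M (sol M (y + 0)))) {y..}"
    by (rule sol_powr_has_integral[OF M sol_integrals_right[OF M]]) (use y in auto)
  then have "0 \<le> p / 2 * ((om M)\<^sup>2 * tailB M (y + 0) - G M (sol M (y + 0)))" by (rule has_integral_nonneg) simp
  then show ?thesis using p2 by (simp add: zero_le_mult_iff)
qed

lemma sol_pot_bounds:
  assumes M: "0 < M"
  shows "0 \<le> sol_pot M" "sol_pot M / p \<le> (om M)\<^sup>2 * sol_mass M / 2"
proof -
  have "0 \<le> (om M)\<^sup>2 * sol_mass M - 2 * G M M" using G_sol_le_tailB[OF M, of 0] by (simp add: sol_mass_def)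
  then show "0 \<le> sol_pot M" unfolding sol_pot_def using p2 by (intro mult_nonneg_nonneg) auto
  have "sol_pot M / p = (om M)\<^sup>2 * sol_mass M / 2 - G M M" using p2 by (simp add: sol_pot_def diff_divide_distrib right_diff_distrib)
  then show "sol_pot M / p \<le> (om M)\<^sup>2 * sol_mass M / 2" using G_nonneg[of M M] M by simp
qed

text \<open>A profile made of the soliton and surplus pieces, of mass \<open>T\<close> and kinetic
  integral at most \<open>\<kappa>\<close>, is scaled down to the mass of the soliton. Scaling loses
  at most the fraction \<open>3 * T / sol_mass M\<close> of the soliton's potential. The term of
  vertex 0 is given away, that of vertex 1 is kept.\<close>

lemma competitor_bound:
  assumes l: "0 < l" and a: "adm N l f g" and M: "0 < M" and T: "0 \<le> T" "mass N l f = sol_mass M + T"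
    and kin: "(\<Sum>e<N + 2. integral (edge_dom l e) (\<lambda>t. (g e t)\<^sup>2)) \<le> 2 * G M M + \<kappa>"
    and pot: "sol_pot M \<le> (\<Sum>e<N + 2. integral (edge_dom l e) (\<lambda>t. \<bar>f e t\<bar> powr p))"
    and kappa: "0 \<le> \<kappa>"
  obtains F H where "adm N l F H" "mass N l F = sol_mass M"
    "En N l F H \<le> elin M (sol_mass M) + \<kappa> / 2 + 3 * (T / sol_mass M) * (sol_pot M / p)
       - (sol_mass M / (sol_mass M + T)) powr (q / 2) * \<bar>f 0 l\<bar> powr q / q"
proof -
  define \<mu> where "\<mu> = sol_mass M"
  have mu: "0 < \<mu>" using sol_mass_pos[OF M] by (simp add: \<mu>_def)
  define s where "s = sqrt (\<mu> / (\<mu> + T))"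
  have r: "0 < \<mu> / (\<mu> + T)" "\<mu> / (\<mu> + T) \<le> 1" using mu T by (auto simp: divide_le_eq)
  have s: "0 < s" "s \<le> 1" "s\<^sup>2 = \<mu> / (\<mu> + T)" using r by (auto simp: s_def)
  define K where "K = (\<Sum>e<N + 2. integral (edge_dom l e) (\<lambda>t. (g e t)\<^sup>2))"
  define P where "P = (\<Sum>e<N + 2. integral (edge_dom l e) (\<lambda>t. \<bar>f e t\<bar> powr p))"
  note sc = En_scale[OF a l less_imp_le[OF s(1)]]
  have K0: "0 \<le> K" unfolding K_def
    by (intro sum_nonneg Henstock_Kurzweil_Integration.integral_nonneg admD(6)[OF a]) auto
  have P0: "0 \<le> sol_pot M" by (rule sol_pot_bounds(1)[OF M])
  have "s\<^sup>2 * K / 2 \<le> 1 * K / 2" using s r K0 by (intro divide_right_mono mult_right_mono) auto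
  then have kk: "s\<^sup>2 * K / 2 \<le> G M M + \<kappa> / 2" using kin unfolding K_def[symmetric] by simp
  define \<tau> where "\<tau> = T / \<mu>"
  have tau: "0 \<le> \<tau>" "\<mu> / (\<mu> + T) = 1 / (1 + \<tau>)" using T mu by (auto simp: \<tau>_def field_simps)
  \<comment> \<open>Bernoulli's inequality for the exponent -3: since \<open>p < 6\<close> and
    \<open>s \<le> 1\<close>, the factor \<open>s powr p\<close> is at least
    \<open>s ^ 6 = 1 / (1 + \<tau>) ^ 3\<close>.\<close>
  have "(1 - 3 * \<tau>) * (1 + \<tau>) ^ 3 \<le> 1"
  proof -
    have "(1 - 3 * \<tau>) * (1 + \<tau>) ^ 3 = 1 - (6 * \<tau>\<^sup>2 + 8 * \<tau> ^ 3 + 3 * \<tau> ^ 4)"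
      by (simp add: algebra_simps power2_eq_square power3_eq_cube power4_eq_xxxx)
    moreover have "0 \<le> 6 * \<tau>\<^sup>2 + 8 * \<tau> ^ 3 + 3 * \<tau> ^ 4" using tau by simp
    ultimately show ?thesis by linarith
  qed
  then have "1 - 3 * \<tau> \<le> (1 / (1 + \<tau>)) ^ 3" using tau by (simp add: power_one_over pos_le_divide_eq)
  also have "\<dots> = (s\<^sup>2) ^ 3" using s(3) tau(2) by simp
  also have "\<dots> = s ^ 6" by (simp flip: power_mult)
  also have "\<dots> = s powr 6" using s by simp
  also have "\<dots> \<le> s powr p" using p6 s by (intro powr_mono') auto
  finally have sp: "1 - 3 * \<tau> \<le> s powr p" .
  have "(1 - 3 * \<tau>) * sol_pot M \<le> s powr p * sol_pot M" by (rule mult_right_mono[OF sp P0])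
  also have "\<dots> \<le> s powr p * P" using pot unfolding P_def[symmetric] by (intro mult_left_mono) auto
  finally have pp: "(1 - 3 * \<tau>) * sol_pot M / p \<le> s powr p * P / p" using p2 by (intro divide_right_mono) auto
  have sq: "s powr q = (\<mu> / (\<mu> + T)) powr (q / 2)"
    using r by (simp add: s_def powr_half_sqrt[symmetric] powr_powr)
  have "En N l (\<lambda>e t. s * f e t) (\<lambda>e t. s * g e t) = s\<^sup>2 * K / 2 - s powr p * P / p - s powr q * (\<bar>f 0 0\<bar> powr q + \<bar>f 0 l\<bar> powr q) / q"
    unfolding sc(3) K_def P_def ..
  also have "\<dots> \<le> (G M M + \<kappa> / 2) - (1 - 3 * \<tau>) * sol_pot M / p - s powr q * \<bar>f 0 l\<bar> powr q / q"
    using q2 by (intro diff_mono kk pp divide_right_mono mult_left_mono) auto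
  also have "\<dots> = elin M \<mu> + \<kappa> / 2 + 3 * \<tau> * (sol_pot M / p) - s powr q * \<bar>f 0 l\<bar> powr q / q"
  proof -
    have "(1 - 3 * \<tau>) * sol_pot M / p = sol_pot M / p - 3 * \<tau> * (sol_pot M / p)" by (simp add: left_diff_distrib diff_divide_distrib)
    moreover have "sol_pot M / p = (om M)\<^sup>2 * \<mu> / 2 - G M M" using p2 by (simp add: sol_pot_def \<mu>_def diff_divide_distrib right_diff_distrib)
    ultimately show ?thesis using elin_sol[OF M] unfolding \<mu>_def by linarith
  qed
  finally have "En N l (\<lambda>e t. s * f e t) (\<lambda>e t. s * g e t)
     \<le> elin M \<mu> + \<kappa> / 2 + 3 * \<tau> * (sol_pot M / p) - (\<mu> / (\<mu> + T)) powr (q / 2) * \<bar>f 0 l\<bar> powr q / q"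
    unfolding sq .
  moreover have "mass N l (\<lambda>e t. s * f e t) = \<mu>" using sc(2) s(3) T mu by (simp add: \<mu>_def)
  ultimately show thesis using that[OF sc(1)] unfolding \<mu>_def \<tau>_def by blast
qed

text \<open>\<open>calib s \<le> s \<le> x\<close> on the interval of integration bounds
  \<open>Psi x\<close> by \<open>x\<^sup>2\<close>.\<close>

lemma G_le_square: "0 \<le> t \<Longrightarrow> t \<le> M \<Longrightarrow> 0 < M \<Longrightarrow> G M t \<le> M powr (p / 2 - 1) * t\<^sup>2"
proof -
  assume t: "0 \<le> t" "t \<le> M" "0 < M"
  define x where "x = t / M"
  have x: "0 \<le> x" "x \<le> 1" using t by (auto simp: x_def)
  have "Psi x \<le> integral {0..x} (\<lambda>_. x)" unfolding Psi_def
  proof (rule integral_le[OF calib_integrable[OF x]])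
    fix s assume "s \<in> {0..x}"
    then show "calib s \<le> x" using calib_le[of s] x by simp
  qed auto
  then have "Psi x \<le> x\<^sup>2" using x by (simp add: power2_eq_square)
  then have "G M t \<le> M powr (p / 2 + 1) * x\<^sup>2" unfolding G_def x_def by (intro mult_left_mono) auto
  moreover have "M powr (p / 2 + 1) = M powr (p / 2 - 1) * M\<^sup>2"
    using t powr_add[of M "p / 2 - 1" 2] by (simp add: add.commute)
  ultimately show ?thesis using t by (simp add: x_def power_divide)
qed

lemma sol_antimono:
  assumes "0 < M" "0 \<le> x" "x \<le> y"
  shows "sol M y \<le> sol M x"
proof (rule DERIV_nonpos_imp_nonincreasing[OF assms(3)])
  fix z assume "x \<le> z"
  then show "\<exists>y. (sol M has_real_derivative y) (at z) \<and> y \<le> 0"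
    using DERIV_sol[of M z] sol'_nonpos[of M z] assms by (intro exI[of _ "sol' M z"]) auto
qed

text \<open>As the soliton decreases, \<open>l * (sol M l)\<^sup>2\<close> is at most the mass of
  one half of it, and that square controls the tail through \<open>tailB_le\<close> and
  \<open>G_le_square\<close>. The point is the explicit power of \<open>M\<close> next to the factor
  \<open>1 / l\<close>: it permits one loop length for all masses.\<close>

lemma tailB_decay:
  assumes M: "0 < M" and l: "0 < l"
  shows "(om M)\<^sup>2 * tailB M l \<le> (1 + p / 2) / (p / 2 - 1) * M powr (p / 2 - 1) * (tailB M 0 / l)"
    "tailB M l \<le> tailB M 0"
proof -
  have I: "((\<lambda>t. (sol M (l - t))\<^sup>2) has_integral (tailB M 0 - tailB M l)) {0..l}"
    by (rule sol_integrals_left(2)[OF M]) (use l in simp)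
  have "((\<lambda>t. (sol M l)\<^sup>2) has_integral (l - 0) *\<^sub>R (sol M l)\<^sup>2) {0..l}"
    using has_integral_const_real[of "(sol M l)\<^sup>2" 0 l] l by simp
  then have "(l - 0) *\<^sub>R (sol M l)\<^sup>2 \<le> tailB M 0 - tailB M l"
    by (rule has_integral_le[OF _ I]) (use sol_antimono[OF M, of "l - _" l] sol_pos[OF M, of l] in \<open>auto intro!: power_mono\<close>)
  then have "l * (sol M l)\<^sup>2 \<le> tailB M 0" using tailB_nonneg[OF M, of l] l by simp
  then have sl: "(sol M l)\<^sup>2 \<le> tailB M 0 / l" using l by (simp add: pos_le_divide_eq mult.commute)
  show "tailB M l \<le> tailB M 0" using has_integral_nonneg[OF I] by simp
  have "(om M)\<^sup>2 * tailB M l \<le> (om M)\<^sup>2 * ((1 + p / 2) * G M (sol M l) / ((p / 2 - 1) * (om M)\<^sup>2))"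
    using tailB_le[OF M, of l] l by (intro mult_left_mono) auto
  also have "\<dots> = (1 + p / 2) / (p / 2 - 1) * G M (sol M l)" using om_pos[OF M] by simp
  also have "\<dots> \<le> (1 + p / 2) / (p / 2 - 1) * (M powr (p / 2 - 1) * (sol M l)\<^sup>2)"
    using G_le_square[of "sol M l" M] sol_pos[OF M, of l] sol_le[OF M] M p2 by (intro mult_left_mono) auto
  also have "\<dots> \<le> (1 + p / 2) / (p / 2 - 1) * (M powr (p / 2 - 1) * (tailB M 0 / l))"
    using sl p2 by (intro mult_left_mono) auto
  finally show "(om M)\<^sup>2 * tailB M l \<le> (1 + p / 2) / (p / 2 - 1) * M powr (p / 2 - 1) * (tailB M 0 / l)"
    by (simp only: mult.assoc)
qed

lemma prim_on_sol_shift: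
  assumes M: "0 < M" and "(\<lambda>t. (sol' M (t + c))\<^sup>2) integrable_on S"
  shows "prim_on S (\<lambda>t. sol M (t + c)) (\<lambda>t. sol' M (t + c))"
proof (rule prim_on_C1[OF _ _ assms(2)])
  have "((\<lambda>t. t + c) has_real_derivative 1) (at x)" for x by (auto intro!: derivative_eq_intros)
  from DERIV_chain2[OF DERIV_sol[OF M] this]
  show "((\<lambda>t. sol M (t + c)) has_real_derivative sol' M (x + c)) (at x)" for x by simp
  show "continuous_on UNIV (\<lambda>t. sol' M (t + c))"
    by (intro continuous_on_compose2[OF sol'_continuous[OF M]] continuous_intros) auto
qed

lemma prim_on_sol_reflect:
  assumes M: "0 < M" and "(\<lambda>t. (sol' M (c - t))\<^sup>2) integrable_on S"
  shows "prim_on S (\<lambda>t. sol M (c - t)) (\<lambda>t. - sol' M (c - t))"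
proof (rule prim_on_C1)
  have "((\<lambda>t. c - t) has_real_derivative - 1) (at x)" for x by (auto intro!: derivative_eq_intros)
  from DERIV_chain2[OF DERIV_sol[OF M] this]
  show "((\<lambda>t. sol M (c - t)) has_real_derivative - sol' M (c - x)) (at x)" for x by simp
  show "continuous_on UNIV (\<lambda>t. - sol' M (c - t))"
    by (intro continuous_intros continuous_on_compose2[OF sol'_continuous[OF M]]) auto
  show "(\<lambda>t. (- sol' M (c - t))\<^sup>2) integrable_on S" using assms(2) by simp
qed

section \<open>Competitors and ground states at all masses\<close>

text \<open>Two halves of the soliton fill the loop edges, with the peak at vertex 1, and the tail
  is repeated on all three half-lines. The soliton has two tails, so one is surplus. Its kinetic
  integral contributes at most one half of \<open>(om M)\<^sup>2 * tailB M l\<close> and the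
  rescaling three halves, whence the factor 2.\<close>

lemma loop_competitor:
  assumes M: "0 < M" and l: "0 < l"
  obtains F H where "adm 3 l F H" "mass 3 l F = sol_mass M"
    "En 3 l F H \<le> elin M (sol_mass M) + 2 * ((om M)\<^sup>2 * tailB M l) - 4 / 9 * M powr q / q"
proof -
  define f where "f e t = (if e < 2 then sol M (l - t) else sol M (t + l))" for e :: nat and t
  define g where "g e t = (if e < 2 then - sol' M (l - t) else sol' M (t + l))" for e :: nat and t
  define T where "T = tailB M l"
  define \<kappa> where "\<kappa> = G M (sol M l)"
  have l0: "0 \<le> l" using l by simp
  note L = sol_integrals_left[OF M l0] and R = sol_integrals_right[OF M, of 0 l, simplified, OF l0]
  note Lp = sol_powr_has_integral[OF M L] and Rp = sol_powr_has_integral[OF M R]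
  have a: "adm 3 l f g" unfolding adm_def
  proof (intro conjI allI impI)
    fix e :: nat assume "e < 3 + 2"
    show "prim_on (edge_dom l e) (f e) (g e)"
    proof (cases "e < 2")
      case True
      then show ?thesis using prim_on_sol_reflect[OF M, of l "{0..l}"] L(1)
        by (auto simp: f_def[abs_def] g_def[abs_def] edge_dom_def has_integral_iff)
    next
      case False
      then show ?thesis using prim_on_sol_shift[OF M, of l "{0..}"] R(1)
        by (auto simp: f_def[abs_def] g_def[abs_def] edge_dom_def has_integral_iff)
    qed
    show "(\<lambda>t. (f e t)\<^sup>2) integrable_on edge_dom l e"
      using L(2) R(2) by (cases "e < 2") (auto simp: f_def edge_dom_def has_integral_iff)
    show "f e 0 = f 0 0" by (simp add: f_def)
  qed (simp add: f_def)
  have mass: "mass 3 l f = sol_mass M + T"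
    unfolding mass_def sum_edges
    by (simp add: f_def edge_dom_def integral_unique[OF L(2)] integral_unique[OF R(2)] sol_mass_def T_def)
  have kin: "(\<Sum>e<3 + 2. integral (edge_dom l e) (\<lambda>t. (g e t)\<^sup>2)) = 2 * G M M + \<kappa>"
    unfolding sum_edges
    by (simp add: g_def edge_dom_def integral_unique[OF L(1)] integral_unique[OF R(1)] \<kappa>_def)
  have pot: "(\<Sum>e<3 + 2. integral (edge_dom l e) (\<lambda>t. \<bar>f e t\<bar> powr p)) = sol_pot M + p / 2 * ((om M)\<^sup>2 * T - \<kappa>)"
    unfolding sum_edges
    by (simp add: f_def edge_dom_def integral_unique[OF Lp] integral_unique[OF Rp] sol_pot_def sol_mass_def \<kappa>_def T_def
        algebra_simps)
  have kT: "\<kappa> \<le> (om M)\<^sup>2 * T" unfolding \<kappa>_def T_def by (rule G_sol_le_tailB[OF M l0])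
  have k0: "0 \<le> \<kappa>" unfolding \<kappa>_def by (rule G_sol_bounds(1)[OF M])
  have T0: "0 \<le> T" unfolding T_def by (rule tailB_nonneg[OF M l0])
  have pot': "sol_pot M \<le> (\<Sum>e<3 + 2. integral (edge_dom l e) (\<lambda>t. \<bar>f e t\<bar> powr p))"
    unfolding pot using kT p2 by simp
  define \<mu> where "\<mu> = sol_mass M"
  have mu: "0 < \<mu>" unfolding \<mu>_def by (rule sol_mass_pos[OF M])
  have Tm: "T \<le> \<mu> / 2" unfolding T_def \<mu>_def sol_mass_def using tailB_decay(2)[OF M l] by simp
  obtain F H where FH: "adm 3 l F H" "mass 3 l F = \<mu>"
    "En 3 l F H \<le> elin M \<mu> + \<kappa> / 2 + 3 * (T / \<mu>) * (sol_pot M / p) - (\<mu> / (\<mu> + T)) powr (q / 2) * \<bar>f 0 l\<bar> powr q / q"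
    using competitor_bound[OF l a M T0 mass kin[THEN eq_refl] pot' k0] unfolding \<mu>_def by metis
  have "3 * (T / \<mu>) * (sol_pot M / p) \<le> 3 * (T / \<mu>) * ((om M)\<^sup>2 * \<mu> / 2)"
    using sol_pot_bounds(2)[OF M] T0 mu by (intro mult_left_mono) (auto simp: \<mu>_def)
  also have "\<dots> = 3 / 2 * ((om M)\<^sup>2 * T)" using mu by simp
  finally have 1: "3 * (T / \<mu>) * (sol_pot M / p) \<le> 3 / 2 * ((om M)\<^sup>2 * T)" .
  \<comment> \<open>The surplus is at most half the mass, which gives the ratio
    \<open>2 / 3\<close>; with \<open>q / 2 < 2\<close> this is the origin of
    \<open>4 / 9\<close>.\<close>
  have r: "2 / 3 \<le> \<mu> / (\<mu> + T)" using Tm T0 mu by (simp add: pos_le_divide_eq)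
  have "(2 / 3 :: real) powr 2 \<le> (2 / 3) powr (q / 2)" using q4 by (intro powr_mono') auto
  also have "\<dots> \<le> (\<mu> / (\<mu> + T)) powr (q / 2)" using r q2 by (intro powr_mono2) auto
  finally have "4 / 9 \<le> (\<mu> / (\<mu> + T)) powr (q / 2)" by (simp add: power2_eq_square)
  then have "4 / 9 * M powr q / q \<le> (\<mu> / (\<mu> + T)) powr (q / 2) * M powr q / q"
    using q2 by (intro divide_right_mono mult_right_mono) auto
  moreover have "\<bar>f 0 l\<bar> = M" using M by (simp add: f_def)
  ultimately have "En 3 l F H \<le> elin M \<mu> + 2 * ((om M)\<^sup>2 * T) - 4 / 9 * M powr q / q"
    using FH(3) 1 kT by simp
  then show thesis using that FH unfolding \<mu>_def T_def by blast
qed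

text \<open>One length has to serve all masses. For heights up to \<open>M1\<close> the tail is
  estimated by half the mass, which makes the cost of order \<open>M powr (p / 2 + 1)\<close>, and
  \<open>q < p / 2 + 1\<close> lets \<open>M powr q\<close> win. Above \<open>M1\<close> the decay
  of the tail makes the cost of order \<open>M powr 2 / l\<close>, and \<open>2 < q\<close> lets
  \<open>M powr q\<close> win.\<close>

lemma ground_states_all_masses:
  obtains l where "0 < l" "\<And>\<mu>. 0 < \<mu> \<Longrightarrow> \<exists>u. ground_state p q (loop_graph 3 l) \<mu> u"
proof -
  define c where "c = p * (p + 2) / (p - 2) * Psi 1"
  have c: "0 < c" using p2 Psi_1_pos by (simp add: c_def)
  define C0 where "C0 = (1 + p / 2) / (p / 2 - 1)"
  have C0: "0 < C0" using p2 by (simp add: C0_def)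
  define \<sigma> where "\<sigma> = p / 2 + 1 - q"
  have sg: "0 < \<sigma>" using qp by (simp add: \<sigma>_def)
  \<comment> \<open>The height at which the crude estimate of the cost equals
    \<open>1 / (9 * q) * M powr q\<close>. Twice this amount is half of the vertex gain
    \<open>4 / 9 * M powr q / q\<close>.\<close>
  define M1 where "M1 = (p / (9 * q * c)) powr (1 / \<sigma>)"
  have M1: "0 < M1" using p2 q2 c by (simp add: M1_def)
  \<comment> \<open>Chosen such that the decay estimate of the cost equals the same bound at
    \<open>M = M1\<close>.\<close>
  define l where "l = C0 * c * 9 * q / (2 * M1 powr (q - 2))"
  have l: "0 < l" using C0 c q2 M1 by (simp add: l_def)
  show thesis
  proof (rule that[OF l])
    fix \<mu> :: real assume mu: "0 < \<mu>"
    obtain M where M: "0 < M" "sol_mass M = \<mu>" using sol_mass_surj[OF mu] by metis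
    have muM: "\<mu> = c * M powr (3 - p / 2)" using sol_mass_eq[OF M(1)] M(2) by (simp only: c_def)
    have B0: "tailB M 0 = \<mu> / 2" using M(2) by (simp add: sol_mass_def)
    have key: "(om M)\<^sup>2 * tailB M l \<le> 1 / (9 * q) * M powr q"
    proof (cases "M \<le> M1")
      case True
      have "(om M)\<^sup>2 * tailB M l \<le> (om M)\<^sup>2 * (\<mu> / 2)"
        using tailB_decay(2)[OF M(1) l] unfolding B0 by (intro mult_left_mono) auto
      also have "\<dots> = c / p * (M powr (p - 2) * M powr (3 - p / 2))"
        using p2 by (simp add: om_square[OF M(1)] muM)
      also have "M powr (p - 2) * M powr (3 - p / 2) = M powr \<sigma> * M powr q"
        by (simp add: \<sigma>_def add.commute flip: powr_add)
      also have "c / p * (M powr \<sigma> * M powr q) \<le> c / p * (M1 powr \<sigma> * M powr q)"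
        using True M(1) sg c p2 by (intro mult_left_mono mult_right_mono powr_mono2) auto
      also have "M1 powr \<sigma> = p / (9 * q * c)" using sg p2 q2 c by (simp add: M1_def powr_powr)
      also have "c / p * (p / (9 * q * c) * M powr q) = 1 / (9 * q) * M powr q" using c p2 by simp
      finally show ?thesis .
    next
      case False
      have "(om M)\<^sup>2 * tailB M l \<le> C0 * M powr (p / 2 - 1) * (\<mu> / 2 / l)"
        using tailB_decay(1)[OF M(1) l] unfolding B0 C0_def .
      also have "\<dots> = C0 * c / (2 * l) * (M powr (p / 2 - 1) * M powr (3 - p / 2))" by (simp add: muM)
      also have "M powr (p / 2 - 1) * M powr (3 - p / 2) = M powr (q - (q - 2))" by (simp flip: powr_add)
      also have "C0 * c / (2 * l) = 1 / (9 * q) * M1 powr (q - 2)" using C0 c q2 M1 by (simp add: l_def field_simps)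
      also have "1 / (9 * q) * M1 powr (q - 2) * M powr (q - (q - 2)) \<le> 1 / (9 * q) * M powr (q - 2) * M powr (q - (q - 2))"
        using False M1 q2 by (intro mult_right_mono mult_left_mono powr_mono2) auto
      also have "\<dots> = 1 / (9 * q) * M powr q" by (simp add: mult.assoc flip: powr_add)
      finally show ?thesis .
    qed
    obtain F H where FH: "adm 3 l F H" "mass 3 l F = \<mu>"
      "En 3 l F H \<le> elin M \<mu> + 2 * ((om M)\<^sup>2 * tailB M l) - 4 / 9 * M powr q / q"
      using loop_competitor[OF M(1) l] unfolding M(2) by metis
    have "0 < M powr q / q" using M(1) q2 by simp
    then have "2 * (1 / (9 * q) * M powr q) < 4 / 9 * M powr q / q" by (simp add: field_simps)
    then have lt: "En 3 l F H < elin M \<mu>" using FH(3) key by linarith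
    have E: "elin M \<mu> \<le> elin x \<mu>" if "0 < x" for x using elin_min[OF M(1) that] M(2) by simp
    show "\<exists>u. ground_state p q (loop_graph 3 l) \<mu> u"
      by (rule ground_state_exists[OF l _ mu E FH(1,2) lt]) simp_all
  qed
qed

text \<open>The soliton is centred at distance \<open>L\<close> on one half-line, continued by a
  constant on the loop and by its tail on every other half-line. One of those tails belongs to the
  soliton; the surplus, counted by \<open>T\<close> and \<open>\<kappa>\<close>, vanishes as
  \<open>L\<close> tends to infinity.\<close>

lemma half_line_competitor:
  assumes M: "0 < M" and l: "0 < l" and N: "2 \<le> N" and d: "0 < d"
  obtains F H where "adm N l F H" "mass N l F = sol_mass M" "En N l F H < elin M (sol_mass M) + d"
proof -
  define T where "T L = 2 * l * (sol M L)\<^sup>2 + (real N - 2) * tailB M L" for L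
  define \<kappa> where "\<kappa> L = (real N - 2) * G M (sol M L)" for L
  have "((\<lambda>L. \<kappa> L / 2 + 3 * (T L / sol_mass M) * (sol_pot M / p)) \<longlongrightarrow>
     ((real N - 2) * 0) / 2 + 3 * ((2 * l * 0\<^sup>2 + (real N - 2) * 0) / sol_mass M) * (sol_pot M / p)) at_top"
    unfolding \<kappa>_def T_def using sol_mass_pos[OF M]
    by (intro tendsto_intros G_sol_tendsto[OF M] sol_tendsto[OF M] tailB_tendsto[OF M]) auto
  then have "\<forall>\<^sub>F L in at_top. \<kappa> L / 2 + 3 * (T L / sol_mass M) * (sol_pot M / p) < d"
    by (rule order_tendstoD(2)) (use d in simp)
  from eventually_happens'[OF trivial_limit_at_top_linorder eventually_conj[OF this eventually_ge_at_top[of 0]]]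
  obtain L where L: "0 \<le> L" "\<kappa> L / 2 + 3 * (T L / sol_mass M) * (sol_pot M / p) < d" by blast
  define f where "f e t = (if e < 2 then sol M L else if e = 2 then sol M (t - L) else sol M (t + L))" for e :: nat and t
  define g where "g e t = (if e < 2 then 0 else if e = 2 then sol' M (t - L) else sol' M (t + L))" for e :: nat and t
  note Lf = sol_integrals_left[OF M L(1)] and R = sol_integrals_right[OF M, of 0 L, simplified, OF L(1)]
    and R' = sol_integrals_right[OF M, of L "- L", simplified]
  have un: "{0..} = {0..L} \<union> {L..}" using L(1) by auto
  have "{0..L} \<inter> {L..} = {L}" using L(1) by auto
  then have ng: "negligible ({0..L} \<inter> {L..})" by simp
  have even: "sol' M (L - t) ^ 2 = sol' M (t - L) ^ 2" "sol M (L - t) = sol M (t - L)" for t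
    using sol_minus[of M "t - L"] by (simp_all add: minus_diff_eq)
  have C: "((\<lambda>t. (sol' M (t - L))\<^sup>2) has_integral (G M M - G M (sol M L) + G M M)) {0..}"
    "((\<lambda>t. (sol M (t - L))\<^sup>2) has_integral (tailB M 0 - tailB M L + tailB M 0)) {0..}"
    unfolding un using has_integral_Un[OF _ R'(1) ng] has_integral_Un[OF _ R'(2) ng] Lf unfolding even by blast+
  note Rp = sol_powr_has_integral[OF M R] and Cp = sol_powr_has_integral[OF M C]
  have a: "adm N l f g" unfolding adm_def
  proof (intro conjI allI impI)
    fix e :: nat assume "e < N + 2"
    consider "e < 2" | "e = 2" | "2 < e" by linarith
    note c = this
    show "prim_on (edge_dom l e) (f e) (g e)" using c
    proof cases
      case 1
      then show ?thesis by (simp add: f_def[abs_def] g_def[abs_def] prim_on_def edge_dom_def integrable_const_ivl)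
    next
      case 2
      then show ?thesis using prim_on_sol_shift[OF M, of "- L" "{0..}"] C(1)
        by (auto simp: f_def[abs_def] g_def[abs_def] edge_dom_def has_integral_iff)
    next
      case 3
      then show ?thesis using prim_on_sol_shift[OF M, of L "{0..}"] R(1)
        by (auto simp: f_def[abs_def] g_def[abs_def] edge_dom_def has_integral_iff)
    qed
    show "(\<lambda>t. (f e t)\<^sup>2) integrable_on edge_dom l e" using c
    proof cases
      case 1
      then show ?thesis by (simp add: f_def edge_dom_def integrable_const_ivl)
    next
      case 2
      then show ?thesis using C(2) by (auto simp: f_def edge_dom_def has_integral_iff)
    next
      case 3
      then show ?thesis using R(2) by (auto simp: f_def edge_dom_def has_integral_iff)
    qed
    show "f e 0 = f 0 0" by (simp add: f_def)
  qed (simp add: f_def)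
  have "{2..<N + 2} = insert 2 {3..<N + 2}" using N by auto
  then have sum2: "(\<Sum>e\<in>{2..<N + 2}. X e) = X 2 + (\<Sum>e\<in>{3..<N + 2}. X e)" for X :: "nat \<Rightarrow> real" by simp
  have sum3: "(\<Sum>e\<in>{3..<N + 2}. X e) = (real N - 1) * Y" if "\<And>e. e \<in> {3..<N + 2} \<Longrightarrow> X e = Y" for X :: "nat \<Rightarrow> real" and Y
    using that N by (simp add: of_nat_diff)
  have mass: "mass N l f = sol_mass M + T L"
    unfolding mass_def sum_edges sum2
    by (subst sum3[of _ "tailB M L"])
      (use l in \<open>simp_all add: f_def edge_dom_def integral_unique[OF C(2)] integral_unique[OF R(2)] sol_mass_def T_def algebra_simps\<close>)
  have kin: "(\<Sum>e<N + 2. integral (edge_dom l e) (\<lambda>t. (g e t)\<^sup>2)) = 2 * G M M + \<kappa> L"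
    unfolding sum_edges sum2
    by (subst sum3[of _ "G M (sol M L)"])
      (use l in \<open>simp_all add: g_def edge_dom_def integral_unique[OF C(1)] integral_unique[OF R(1)] \<kappa>_def algebra_simps\<close>)
  define b where "b = p / 2 * ((om M)\<^sup>2 * tailB M L - G M (sol M L))"
  have b0: "0 \<le> b" unfolding b_def using G_sol_le_tailB[OF M L(1)] p2 by simp
  have "(\<Sum>e<N + 2. integral (edge_dom l e) (\<lambda>t. \<bar>f e t\<bar> powr p))
     = 2 * (l * sol M L powr p) + (sol_pot M - b) + (real N - 1) * b"
    unfolding sum_edges sum2
    by (subst sum3[of _ b])
      (use l sol_pos[OF M, of L] in \<open>simp_all add: f_def edge_dom_def integral_unique[OF Cp] integral_unique[OF Rp]
        sol_pot_def sol_mass_def b_def algebra_simps\<close>)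
  moreover have "0 \<le> (real N - 2) * b" using b0 N by simp
  moreover have "0 \<le> l * sol M L powr p" using l by simp
  ultimately have pot: "sol_pot M \<le> (\<Sum>e<N + 2. integral (edge_dom l e) (\<lambda>t. \<bar>f e t\<bar> powr p))"
    by (simp add: algebra_simps del: sum.lessThan_Suc)
  have T0: "0 \<le> T L" unfolding T_def using l N tailB_nonneg[OF M L(1)] by simp
  have k0: "0 \<le> \<kappa> L" unfolding \<kappa>_def using N G_sol_bounds(1)[OF M] by simp
  obtain F H where FH: "adm N l F H" "mass N l F = sol_mass M"
    "En N l F H \<le> elin M (sol_mass M) + \<kappa> L / 2 + 3 * (T L / sol_mass M) * (sol_pot M / p)
       - (sol_mass M / (sol_mass M + T L)) powr (q / 2) * \<bar>f 0 l\<bar> powr q / q"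
    using competitor_bound[OF l a M T0 mass kin[THEN eq_refl] pot k0] by metis
  have "0 \<le> (sol_mass M / (sol_mass M + T L)) powr (q / 2) * \<bar>f 0 l\<bar> powr q / q" using q2 by simp
  then have "En N l F H < elin M (sol_mass M) + d" using FH(3) L(2) by linarith
  then show thesis using that FH by blast
qed

section \<open>Nonexistence for many half-lines and a short loop\<close>

text \<open>A function that vanishes at the end of a half-line reaches its maximum in finite time. Calibrating
  with \<open>sqrt (h\<^sup>2 + \<delta>)\<close> costs \<open>\<delta> x / 2\<close> but gains a multiple of \<open>\<delta> ln (1 / \<delta>)\<close>, because
  \<open>h\<close> is at most linear near zero; hence the calibrated inequality is strict.\<close>

lemma half_line_calibrated_strict:
  assumes pr: "prim_on {0..} f g" and f2: "(\<lambda>t. (f t)\<^sup>2) integrable_on {0..}"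
    and M: "0 < M" "\<And>t. 0 \<le> t \<Longrightarrow> \<bar>f t\<bar> \<le> M" and f0: "f 0 = 0" and x: "0 \<le> x" "\<bar>f x\<bar> = M"
  shows "2 * G M M < integral {0..} (dens M f g)"
proof -
  have fc: "continuous_on {0..} f" by (rule prim_on_continuous_half_line[OF pr])
  have di: "dens M f g integrable_on {0..}" by (rule dens_integral(1)[OF pr fc f2]) (use M in auto)
  define h where "h t = M powr (p / 2) * calib (t / M)" for t
  have hc: "continuous_on {0..M} h" unfolding h_def[abs_def] by (rule calib_scaled(1)[OF M(1)])
  have h0: "0 \<le> h t" if "t \<in> {0..M}" for t unfolding h_def by (rule calib_scaled(2)[OF M(1) that])
  \<comment> \<open>\<open>h t\<close> is at most \<open>(C - 1) / 2 * t\<close>; the remaining 1 in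
    \<open>C\<close> absorbs the square of the correction \<open>d\<close> in
    \<open>hk'\<close>.\<close>
  define C where "C = 2 * M powr (p / 2 - 1) + 1"
  have C: "0 < C" "h t \<le> (C - 1) / 2 * t" if "t \<in> {0..M}" for t
  proof -
    have "0 \<le> M powr (p / 2 - 1)" by simp
    then show "0 < C" unfolding C_def by linarith
    show "h t \<le> (C - 1) / 2 * t" unfolding h_def C_def using calib_scaled(3)[OF M(1) that] by simp
  qed
  have C0: "0 < C" using C(1)[of 0] M by simp
  \<comment> \<open>Makes \<open>ln (M / \<eta>) = C * x / 2 + 1\<close>, so that the gain
    \<open>\<delta> / C * ln (M / \<eta>)\<close> exceeds the cost \<open>\<delta> / 2 * x\<close>
    by exactly \<open>\<delta> / C\<close>.\<close>
  define \<eta> where "\<eta> = M * exp (- (C * x / 2 + 1))"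
  have eta: "0 < \<eta>" "\<eta> \<le> M"
  proof -
    show "0 < \<eta>" using M by (simp add: \<eta>_def)
    have "0 \<le> C * x" using C0 x by simp
    then have "exp (- (C * x / 2 + 1)) \<le> exp 0" by (subst exp_le_cancel_iff) linarith
    then have "exp (- (C * x / 2 + 1)) \<le> 1" by simp
    then show "\<eta> \<le> M" using M mult_left_mono[of "exp (- (C * x / 2 + 1))" 1 M] by (simp add: \<eta>_def)
  qed
  define \<delta> where "\<delta> = \<eta>\<^sup>2"
  define k where "k t = sqrt ((h t)\<^sup>2 + \<delta>)" for t
  have kc: "continuous_on {0..M} k" unfolding k_def[abs_def] by (intro continuous_intros hc)
  have k0: "0 \<le> k t" for t by (simp add: k_def \<delta>_def)
  have k2: "(k t)\<^sup>2 = (h t)\<^sup>2 + \<delta>" for t by (simp add: k_def \<delta>_def)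
  have hk: "h t \<le> k t" if "t \<in> {0..M}" for t
    unfolding k_def by (rule real_le_rsqrt) (simp add: \<delta>_def)
  \<comment> \<open>Above the level \<open>\<eta>\<close>, the square root of
    \<open>\<delta>\<close>, the perturbed weight exceeds \<open>h\<close> by a multiple of
    \<open>\<delta> / t\<close>; integrated over the levels this is the logarithm.\<close>
  have hk': "h t + \<delta> / C * (1 / t) \<le> k t" if t: "t \<in> {\<eta>..M}" for t
  proof -
    have tp: "0 < t" using t eta by simp
    have hl: "0 \<le> h t" "h t \<le> (C - 1) / 2 * t" using h0[of t] C(2)[of t] t eta by auto
    define d where "d = \<delta> / C * (1 / t)"
    have d0: "0 \<le> d" using C0 tp by (simp add: d_def \<delta>_def)
    have "\<eta>\<^sup>2 \<le> t\<^sup>2" using t eta by (intro power_mono) auto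
    then have "\<delta> \<le> t * t" by (simp add: \<delta>_def power2_eq_square)
    then have dt: "d * C \<le> t" using tp C0 by (simp add: d_def pos_divide_le_eq)
    have "d * 1 \<le> d * C" using C0 d0 C_def by (intro mult_left_mono) auto
    then have "d \<le> t" using dt by simp
    then have "d + 2 * h t \<le> C * t" using hl by (simp add: field_simps)
    then have "d * (d + 2 * h t) \<le> d * (C * t)" by (rule mult_left_mono[OF _ d0])
    also have "\<dots> = \<delta>" using tp C0 by (simp add: d_def)
    finally have "(h t + d)\<^sup>2 \<le> (h t)\<^sup>2 + \<delta>" by (simp add: power2_eq_square algebra_simps)
    then show ?thesis unfolding k_def d_def by (rule real_le_rsqrt)
  qed
  define K where "K t = integral {0..t} k" for t
  have Kd: "(K has_real_derivative k t) (at t within {0..M})" if "t \<in> {0..M}" for t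
    unfolding K_def[abs_def] by (rule integral_has_real_derivative[OF kc that])
  have px: "prim_on {0..x} f g" by (rule prim_on_subset[OF pr]) auto
  have cal: "abs (K \<bar>f x\<bar> - K \<bar>f 0\<bar>) \<le> integral {0..x} (\<lambda>t. ((g t)\<^sup>2 + (k \<bar>f t\<bar>)\<^sup>2) / 2)"
    by (rule calibration(1)[OF px x(1) _ kc k0 Kd]) (use M in auto)
  have eq: "((g t)\<^sup>2 + (k \<bar>f t\<bar>)\<^sup>2) / 2 = dens M f g t + \<delta> / 2" if "t \<in> {0..x}" for t
  proof -
    have "((g t)\<^sup>2 + (h \<bar>f t\<bar>)\<^sup>2) / 2 = dens M f g t"
      unfolding h_def by (rule calib_scaled(4)[OF M(1), where f = f and g = g]) (use M that in auto)
    then show ?thesis unfolding k2 by (simp add: add_divide_distrib)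
  qed
  have dx: "dens M f g integrable_on {0..x}"
    by (rule integral_half_line_split(2)[OF di _ x(1)]) (use M in \<open>auto intro: dens_nonneg\<close>)
  have "integral {0..x} (\<lambda>t. ((g t)\<^sup>2 + (k \<bar>f t\<bar>)\<^sup>2) / 2) = integral {0..x} (\<lambda>t. dens M f g t + \<delta> / 2)"
    by (rule Henstock_Kurzweil_Integration.integral_cong) (rule eq)
  also have "\<dots> = integral {0..x} (dens M f g) + \<delta> / 2 * x"
    using x(1) dx by (simp add: Henstock_Kurzweil_Integration.integral_add integrable_const_ivl)
  finally have A: "K M \<le> integral {0..x} (dens M f g) + \<delta> / 2 * x"
    using cal f0 x(2) by (simp add: K_def)
  have ki: "k integrable_on {0..M}" by (rule integrable_continuous_real[OF kc])
  have hG: "(h has_integral (G M b - G M a)) {a..b}" if "0 \<le> a" "a \<le> b" "b \<le> M" for a b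
  proof (rule fundamental_theorem_of_calculus[OF that(2)])
    fix t assume t: "t \<in> {a..b}"
    have "(G M has_real_derivative h t) (at t within {0..M})" unfolding h_def by (rule DERIV_G[OF M(1)]) (use t that in auto)
    then show "(G M has_vector_derivative h t) (at t within {a..b})"
      unfolding has_real_derivative_iff_has_vector_derivative[symmetric]
      by (rule DERIV_subset) (use that in auto)
  qed
  have G0: "G M 0 = 0" by (simp add: G_def)
  have "((\<lambda>t. 1 / t) has_integral (ln M - ln \<eta>)) {\<eta>..M}"
  proof (rule fundamental_theorem_of_calculus[OF eta(2)])
    fix t assume "t \<in> {\<eta>..M}"
    then have "0 < t" using eta by simp
    then show "(ln has_vector_derivative 1 / t) (at t within {\<eta>..M})"
      unfolding has_real_derivative_iff_has_vector_derivative[symmetric]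
      by (rule has_field_derivative_at_within[OF DERIV_ln_divide])
  qed
  moreover have "ln M - ln \<eta> = C * x / 2 + 1" using M by (simp add: \<eta>_def ln_mult)
  ultimately have lnI: "((\<lambda>t. 1 / t) has_integral (C * x / 2 + 1)) {\<eta>..M}" by simp
  have "((\<lambda>t. h t + \<delta> / C * (1 / t)) has_integral (G M M - G M \<eta> + \<delta> / C * (C * x / 2 + 1))) {\<eta>..M}"
    by (intro has_integral_add has_integral_mult_right lnI hG) (use eta in auto)
  then have B1: "G M M - G M \<eta> + \<delta> / C * (C * x / 2 + 1) \<le> integral {\<eta>..M} k"
    by (rule has_integral_le[OF _ integrable_integral]) (use hk' integrable_on_subinterval[OF ki, of \<eta> M] eta in auto)
  have B2: "G M \<eta> - G M 0 \<le> integral {0..\<eta>} k"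
    by (rule has_integral_le[OF hG integrable_integral])
      (use hk integrable_on_subinterval[OF ki, of 0 \<eta>] eta in auto)
  have "K M = integral {0..\<eta>} k + integral {\<eta>..M} k" unfolding K_def
    by (rule Henstock_Kurzweil_Integration.integral_combine[symmetric]) (use eta ki in auto)
  then have "G M M + \<delta> / C * (C * x / 2 + 1) \<le> K M" using B1 B2 G0 by linarith
  moreover have "\<delta> / C * (C * x / 2 + 1) = \<delta> / 2 * x + \<delta> / C" using C0 by (simp add: distrib_left)
  moreover have "0 < \<delta> / C" using C0 eta by (simp add: \<delta>_def)
  ultimately have 1: "G M M < integral {0..x} (dens M f g)" using A by linarith
  have pxx: "prim_on {x..} f g" by (rule prim_on_subset[OF pr]) (use x in auto)
  have "G M \<bar>f x\<bar> \<le> integral {x..} (dens M f g)"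
    by (rule half_line_calibrated[OF pxx _ M(1)]) (use x M integrable_on_subset_nonneg[OF f2, of "{x..}"] in auto)
  moreover have "integral {0..} (dens M f g) = integral {0..x} (dens M f g) + integral {x..} (dens M f g)"
    by (rule integral_half_line_split(1)[OF di _ x(1)]) (use M in \<open>auto intro: dens_nonneg\<close>)
  ultimately show ?thesis using 1 x(2) by simp
qed

section \<open>Energies strictly above that of the line\<close>

lemma J_loop_edge_lower:
  assumes l: "0 < l" and a: "adm N l f g" and e: "e < 2"
    and c: "\<And>t. t \<in> {0..l} \<Longrightarrow> \<bar>f e t\<bar> \<le> c"
  shows "integral {0..l} (\<lambda>t. (g e t)\<^sup>2) / 2 - l * c powr p / p \<le> J (edge_dom l e) (f e) (g e)"
proof -
  have eN: "e < N + 2" and d: "edge_dom l e = {0..l}" using e by (auto simp: edge_dom_def)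
  have "integral {0..l} (\<lambda>t. \<bar>f e t\<bar> powr p) \<le> integral {0..l} (\<lambda>t. c powr p)"
    by (rule integral_le[OF adm_powr_integrable[OF a eN l, unfolded d]])
      (use c p2 in \<open>auto intro!: powr_mono2 integrable_const_ivl\<close>)
  then have "integral {0..l} (\<lambda>t. \<bar>f e t\<bar> powr p) / p \<le> l * c powr p / p"
    using l p2 by (intro divide_right_mono) auto
  then show ?thesis by (simp add: J_def d)
qed

text \<open>The mass is that of the soliton of height 1. Maxima below \<open>M0\<close> or above
  \<open>A\<close> are excluded by the energy alone. Between these bounds the constants can be
  chosen uniformly: \<open>N\<close> handles functions whose values on the loop stay below
  \<open>2 * a\<close>, and \<open>l\<close> handles the others.\<close>

lemma no_ground_state:
  obtains N l where "3 \<le> N" "0 < l" "\<And>f g. adm N l f g \<Longrightarrow> mass N l f = sol_mass 1 \<Longrightarrow> elin 1 (sol_mass 1) < En N l f g"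
proof -
  define m where "m = sol_mass 1"
  define E where "E = elin 1 m"
  have m: "0 < m" unfolding m_def by (rule sol_mass_pos) simp
  have Emin: "E \<le> elin M m" if "0 < M" for M unfolding E_def m_def using elin_min[of 1 M] that by simp
  have E: "E < 0"
  proof -
    have "m / p = (p + 2) / (p - 2) * Psi 1" unfolding m_def using p2 by (simp add: sol_mass_eq)
    then have "E = Psi 1 * (2 - (p + 2) / (p - 2))" by (simp add: E_def elin_def algebra_simps)
    moreover have "2 < (p + 2) / (p - 2)" using p2 p6 by (simp add: pos_less_divide_eq)
    ultimately show ?thesis using Psi_1_pos by (simp add: mult_pos_neg)
  qed
  \<comment> \<open>Up to the maximum \<open>M0\<close> the mass term and the vertex terms are at
    most \<open>- E / 4\<close> each, so the energy is at least \<open>E / 2\<close>, which exceeds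
    the negative \<open>E\<close>.\<close>
  define M0 where "M0 = min ((- E * p / (4 * m)) powr (1 / (p - 2))) ((- E * q / 8) powr (1 / q))"
  have M0: "0 < M0" using E p2 q2 m by (simp add: M0_def mult_neg_pos)
  have small: "E < elin M m - 2 * M powr q / q" if M: "0 < M" "M \<le> M0" for M
  proof -
    have "M powr (p - 2) \<le> ((- E * p / (4 * m)) powr (1 / (p - 2))) powr (p - 2)"
      using M p2 by (intro powr_mono2) (auto simp: M0_def)
    also have "\<dots> = - E * p / (4 * m)"
    proof -
      have "0 \<le> - E * p / (4 * m)" using p2 E m by (intro divide_nonneg_nonneg mult_nonneg_nonneg) auto
      moreover have "1 / (p - 2) * (p - 2) = 1" using p2 by simp
      ultimately show ?thesis by (simp only: powr_powr powr_one)
    qed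
    finally have "M powr (p - 2) * m / p \<le> (- E * p / (4 * m)) * m / p"
      using m p2 by (intro divide_right_mono mult_right_mono) auto
    then have 1: "M powr (p - 2) * m / p \<le> - E / 4" using m p2 by simp
    have "M powr q \<le> ((- E * q / 8) powr (1 / q)) powr q"
      using M q2 by (intro powr_mono2) (auto simp: M0_def)
    also have "\<dots> = - E * q / 8"
    proof -
      have "0 \<le> - E * q / 8" using q2 E by (intro divide_nonneg_nonneg mult_nonneg_nonneg) auto
      then show ?thesis using q2 by (simp only: powr_powr) simp
    qed
    finally have "2 * M powr q / q \<le> 2 * (- E * q / 8) / q"
      using q2 by (intro divide_right_mono mult_left_mono) auto
    then have 2: "2 * M powr q / q \<le> - E / 4" using q2 by simp
    have "0 \<le> 2 * Psi 1 * M powr (p / 2 + 1)" using Psi_1_pos by simp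
    then show ?thesis using 1 2 E unfolding elin_def by linarith
  qed
  obtain A where A: "0 < A" "\<And>M. A < M \<Longrightarrow> 0 < elin M m - 2 * M powr q / q" using coercive[of m 0] m by auto
  \<comment> \<open>\<open>17 = 1 + 2 ^ 4\<close>: the powers of the values at the two vertices, the
    second at most twice the first, are summed with \<open>q < 4\<close>.\<close>
  obtain N0 :: nat where N0: "17 * A powr (q - 2) / (M0 powr (p / 2 - 1) * Psi 1) < real N0" using reals_Archimedean2 by blast
  define N where "N = N0 + 3"
  have N: "3 \<le> N" "2 \<le> N" by (auto simp: N_def)
  have NN: "17 * A powr (q - 2) < (real N - 2) * (M0 powr (p / 2 - 1) * Psi 1)"
  proof -
    have pos: "0 < M0 powr (p / 2 - 1) * Psi 1" using M0 Psi_1_pos by simp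
    have "17 * A powr (q - 2) < real N0 * (M0 powr (p / 2 - 1) * Psi 1)" using N0 pos by (simp add: pos_divide_less_eq)
    also have "\<dots> \<le> (real N - 2) * (M0 powr (p / 2 - 1) * Psi 1)" using pos by (intro mult_right_mono) (auto simp: N_def)
    finally show ?thesis .
  qed
  define D where "D = A powr (p - 2) * m / p"
  have D0: "0 \<le> D" using m p2 by (simp add: D_def)
  \<comment> \<open>Three claims on the kinetic energy of the loop, as multiples of the squared
    maximum on the loop: its potential, the vertex terms, and the whole mass term \<open>D\<close>
    with 1 to spare, for the case that the global maximum lies on the loop. If it lies on a
    half-line, the further 1 in the choice of \<open>l\<close> gives strictness.\<close>
  define B where "B = 2 * A powr (p - 2) / p + 2 * A powr (q - 2) / q + (D + 1) / M0\<^sup>2"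
  have B0: "0 < B" unfolding B_def using p2 q2 D0 M0 by (intro add_nonneg_pos add_nonneg_nonneg) auto
  define l where "l = 1 / (8 * (B + 1))"
  have l: "0 < l" "l \<le> 1" "1 / (8 * l) = B + 1" using B0 by (auto simp: l_def field_simps)
  have "E < En N l f g" if ad: "adm N l f g" and ms: "mass N l f = m" for f g
  proof -
    obtain e0 x0 where ex: "e0 < N + 2" "x0 \<in> edge_dom l e0"
      "\<And>e t. e < N + 2 \<Longrightarrow> t \<in> edge_dom l e \<Longrightarrow> \<bar>f e t\<bar> \<le> \<bar>f e0 x0\<bar>"
      using adm_attains_max[OF l(1) ad] by metis
    define M where "M = \<bar>f e0 x0\<bar>"
    have Mb: "\<bar>f e t\<bar> \<le> M" if "e < N + 2" "t \<in> edge_dom l e" for e t using ex(3)[OF that] by (simp add: M_def)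
    have M: "0 < M"
    proof (rule ccontr)
      assume "\<not> 0 < M"
      then have "f e' t = 0" if "e' < N + 2" "t \<in> edge_dom l e'" for e' t using Mb[OF that] by simp
      then have "mass N l f = (\<Sum>e<N + 2. integral (edge_dom l e) (\<lambda>t. 0))"
        unfolding mass_def by (intro sum.cong refl Henstock_Kurzweil_Integration.integral_cong) simp
      then show False using ms m by simp
    qed
    have x0: "\<bar>f e0 x0\<bar> = M" by (simp add: M_def)
    have low: "elin M m - 2 * M powr q / q \<le> En N l f g"
      using En_lower(2)[OF l(1) ad N(2) M Mb ex(1,2) x0] ms by simp
    show "E < En N l f g"
    proof (cases "M \<le> M0 \<or> A < M")
      case True
      then show ?thesis using small[OF M] A(2)[of M] low E by linarith
    next
      case False
      then have MM: "M0 < M" "M \<le> A" by auto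
      have el: "elin M m = 2 * G M M - M powr (p - 2) / p * m" by (simp add: elin_def G_self[OF M])
      define a where "a = \<bar>f 0 0\<bar>"
      define b where "b = \<bar>f 0 l\<bar>"
      have mono_p: "y powr p \<le> A powr (p - 2) * y\<^sup>2" if "0 \<le> y" "y \<le> A" for y
        using powr_abs_le[of y A] that by simp
      have mono_q: "y powr q \<le> A powr (q - 2) * y\<^sup>2" if "0 \<le> y" "y \<le> A" for y
      proof (cases "y = 0")
        case False
        have "y powr q = y powr (q - 2) * y\<^sup>2" using powr_add[of y "q - 2" 2] False that by simp
        also have "\<dots> \<le> A powr (q - 2) * y\<^sup>2" using that q2 by (intro mult_right_mono powr_mono2) auto
        finally show ?thesis .
      qed simp
      have "\<exists>t\<in>{0..l}. \<forall>s\<in>{0..l}. \<bar>f e s\<bar> \<le> \<bar>f e t\<bar>" if e: "e < 2" for e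
      proof -
        obtain x where "x \<in> edge_dom l e" "\<And>t. t \<in> edge_dom l e \<Longrightarrow> \<bar>f e t\<bar> \<le> \<bar>f e x\<bar>"
          by (rule edge_attains_max[OF admD(1,2)[OF ad, of e] l(1)]) (use e in auto)
        then show ?thesis using e by (intro bexI[of _ x]) (auto simp: edge_dom_def)
      qed
      from this[of 0] this[of 1] obtain t0 t1 where t: "t0 \<in> {0..l}" "t1 \<in> {0..l}"
        "\<And>s. s \<in> {0..l} \<Longrightarrow> \<bar>f 0 s\<bar> \<le> \<bar>f 0 t0\<bar>" "\<And>s. s \<in> {0..l} \<Longrightarrow> \<bar>f 1 s\<bar> \<le> \<bar>f 1 t1\<bar>" by auto
      define c where "c = max \<bar>f 0 t0\<bar> \<bar>f 1 t1\<bar>"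
      have cm: "\<bar>f e s\<bar> \<le> c" if "e < 2" "s \<in> {0..l}" for e s
      proof -
        have "e = 0 \<or> e = 1" using that by auto
        then show ?thesis using t(3,4)[OF that(2)] by (auto simp: c_def)
      qed
      obtain e1 s1 where es: "e1 < 2" "s1 \<in> {0..l}" "\<bar>f e1 s1\<bar> = c"
      proof (cases "\<bar>f 1 t1\<bar> \<le> \<bar>f 0 t0\<bar>")
        case True
        then show ?thesis using that[of 0 t0] t by (simp add: c_def)
      next
        case False
        then show ?thesis using that[of 1 t1] t by (simp add: c_def)
      qed
      have cM: "c \<le> M" using Mb[of e1 s1] es by (simp add: edge_dom_def)
      have c0: "0 \<le> c" by (simp add: c_def)
      have ac: "a \<le> c" "b \<le> c" using cm[of 0 0] cm[of 0 l] l by (auto simp: a_def b_def)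
      have a0: "0 \<le> a" "0 \<le> b" by (auto simp: a_def b_def)
      let ?D = "\<lambda>e. integral (edge_dom l e) (dens M (f e) (g e))"
      show ?thesis
      proof (cases "c \<le> 2 * a")
        case True
        show ?thesis
        proof (cases "a = 0")
          case False
          then have ap: "0 < a" using a0 by simp
          have "b powr q \<le> (2 * a) powr q" using ac True a0 q2 by (intro powr_mono2) auto
          also have "\<dots> = 2 powr q * a powr q" using a0 by (simp add: powr_mult)
          also have "\<dots> \<le> 2 powr 4 * a powr q" using q4 by (intro mult_right_mono powr_mono) auto
          finally have "a powr q + b powr q \<le> 17 * a powr q" by simp
          then have "(a powr q + b powr q) / q \<le> 17 * a powr q / 1" using q2 by (intro frac_le) auto
          also have "\<dots> \<le> 17 * (A powr (q - 2) * a\<^sup>2)" using mono_q[of a] ac cM MM a0 by simp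
          also have "\<dots> = (17 * A powr (q - 2)) * a\<^sup>2" by simp
          also have "\<dots> < ((real N - 2) * (M0 powr (p / 2 - 1) * Psi 1)) * a\<^sup>2"
            using NN ap by (intro mult_strict_right_mono) auto
          also have "\<dots> = (real N - 2) * (M0 powr (p / 2 - 1) * Psi 1 * a\<^sup>2)" by simp
          also have "\<dots> \<le> (real N - 2) * G M a"
          proof (rule mult_left_mono)
            have "M0 powr (p / 2 - 1) * Psi 1 * a\<^sup>2 \<le> M powr (p / 2 - 1) * Psi 1 * a\<^sup>2"
              using MM M0 p2 Psi_1_pos by (intro mult_right_mono powr_mono2) auto
            also have "\<dots> \<le> G M a" by (rule G_ge) (use ac cM a0 M in auto)
            finally show "M0 powr (p / 2 - 1) * Psi 1 * a\<^sup>2 \<le> G M a" .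
          qed (use N in simp)
          finally have "(a powr q + b powr q) / q < (real N - 2) * G M a" .
          moreover have "elin M m + (real N - 2) * G M a - (a powr q + b powr q) / q \<le> En N l f g"
            using En_lower(1)[OF l(1) ad N(2) M Mb ex(1,2) x0] ms by (simp add: a_def b_def)
          ultimately show ?thesis using Emin[OF M] by linarith
        next
          \<comment> \<open>The function vanishes on the loop: there is neither an excess nor a
            vertex term, and strictness has to come from the half-line that carries the
            maximum.\<close>
          case z: True
          then have cz: "c = 0" using True c0 by simp
          have e0: "2 \<le> e0"
          proof (rule ccontr)
            assume "\<not> 2 \<le> e0"
            then show False using cm[of e0 x0] ex(2) x0 M cz by (simp add: edge_dom_def)
          qed
          have d0: "edge_dom l e0 = {0..}" using e0 by (simp add: edge_dom_def)
          have f00: "f e0 0 = 0" using admD(3)[OF ad ex(1)] z by (simp add: a_def)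
          have "2 * G M M < ?D e0" unfolding d0
            by (rule half_line_calibrated_strict[of _ _ _ x0])
              (use admD(1,2)[OF ad ex(1)] M Mb[OF ex(1)] f00 ex(2) x0 d0 in auto)
          moreover have "?D e0 \<le> (\<Sum>e<N + 2. ?D e)"
            by (rule member_le_sum) (use ex(1) adm_dens(3)[OF l(1) ad _ Mb] in auto)
          moreover have "(\<Sum>e<N + 2. ?D e) = (\<Sum>e<N + 2. J (edge_dom l e) (f e) (g e)) + M powr (p - 2) / p * m"
          proof -
            have "(\<Sum>e<N + 2. ?D e) = (\<Sum>e<N + 2. J (edge_dom l e) (f e) (g e) + M powr (p - 2) / p * integral (edge_dom l e) (\<lambda>t. (f e t)\<^sup>2))"
              by (rule sum.cong) (use adm_dens(2)[OF l(1) ad _ Mb] in auto)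
            then show ?thesis unfolding sum.distrib sum_distrib_left[symmetric] using ms by (simp only: mass_def)
          qed
          moreover have "En N l f g = (\<Sum>e<N + 2. J (edge_dom l e) (f e) (g e))"
          proof -
            have "a = 0" "b = 0" using z ac(2) cz a0 by auto
            then show ?thesis unfolding En_def a_def[symmetric] b_def[symmetric] by simp
          qed
          ultimately have "elin M m < En N l f g" using el by linarith
          then show ?thesis using Emin[OF M] by linarith
        qed
      next
        case False
        then have c2a: "2 * a < c" by simp
        then have cp: "0 < c" using a0 by linarith
        have cA: "c \<le> A" using cM MM by simp
        have K0: "0 \<le> integral {0..l} (\<lambda>t. (g e t)\<^sup>2)" if "e < 2" for e
          using Henstock_Kurzweil_Integration.integral_nonneg[OF admD(6)[OF ad, of e]] that by (simp add: edge_dom_def)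
        \<comment> \<open>On edge \<open>e1\<close> the modulus rises from \<open>a < c / 2\<close>
          to \<open>c\<close> within length \<open>l\<close>, which the Hoelder bound turns into
          kinetic energy of order \<open>c\<^sup>2 / l\<close>.\<close>
        have Ke: "c\<^sup>2 / (4 * l) \<le> integral {0..l} (\<lambda>t. (g e1 t)\<^sup>2)"
        proof -
          have eN: "e1 < N + 2" and d: "edge_dom l e1 = {0..l}" using es(1) by (auto simp: edge_dom_def)
          have gi: "(\<lambda>t. (g e1 t)\<^sup>2) integrable_on {0..l}" using admD(6)[OF ad eN] d by simp
          have ps: "prim_on {0..s1} (f e1) (g e1)" by (rule prim_on_subset[OF admD(1)[OF ad eN]]) (use es d in auto)
          have "c / 2 \<le> \<bar>f e1 s1 - f e1 0\<bar>" using es(3) admD(3)[OF ad eN] c2a unfolding a_def by linarith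
          then have "(c / 2)\<^sup>2 \<le> \<bar>f e1 s1 - f e1 0\<bar>\<^sup>2" using cp by (intro power_mono) auto
          also have "\<dots> \<le> (s1 - 0) * integral {0..s1} (\<lambda>t. (g e1 t)\<^sup>2)"
            using prim_on_holder[OF ps] es(2) by simp
          also have "\<dots> \<le> l * integral {0..l} (\<lambda>t. (g e1 t)\<^sup>2)"
          proof (rule mult_mono)
            show "integral {0..s1} (\<lambda>t. (g e1 t)\<^sup>2) \<le> integral {0..l} (\<lambda>t. (g e1 t)\<^sup>2)"
              by (rule integral_subset_le) (use es(2) gi integrable_on_subinterval[OF gi, of 0 s1] in auto)
            show "0 \<le> integral {0..s1} (\<lambda>t. (g e1 t)\<^sup>2)"
              by (rule Henstock_Kurzweil_Integration.integral_nonneg) (use es(2) integrable_on_subinterval[OF gi, of 0 s1] in auto)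
          qed (use es l in auto)
          finally show ?thesis using l(1) by (simp add: power_divide pos_divide_le_eq mult_ac)
        qed
        have loop: "c\<^sup>2 / (8 * l) - 2 * l * c powr p / p \<le> J (edge_dom l 0) (f 0) (g 0) + J (edge_dom l 1) (f 1) (g 1)"
        proof -
          have "e1 = 0 \<or> e1 = 1" using es(1) by auto
          then have "c\<^sup>2 / (4 * l) \<le> integral {0..l} (\<lambda>t. (g 0 t)\<^sup>2) + integral {0..l} (\<lambda>t. (g 1 t)\<^sup>2)"
            using Ke K0[of 0] K0[of 1] by auto
          then have "c\<^sup>2 / (4 * l) / 2 \<le> (integral {0..l} (\<lambda>t. (g 0 t)\<^sup>2) + integral {0..l} (\<lambda>t. (g 1 t)\<^sup>2)) / 2"
            by (rule divide_right_mono) simp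
          moreover have "c\<^sup>2 / (4 * l) / 2 = c\<^sup>2 / (8 * l)" by simp
          ultimately have 1: "c\<^sup>2 / (8 * l) \<le> integral {0..l} (\<lambda>t. (g 0 t)\<^sup>2) / 2 + integral {0..l} (\<lambda>t. (g 1 t)\<^sup>2) / 2"
            by (simp only: add_divide_distrib)
          define Q where "Q = l * c powr p / p"
          have Q: "2 * l * c powr p / p = Q + Q" by (simp add: Q_def)
          have J: "integral {0..l} (\<lambda>t. (g e t)\<^sup>2) / 2 - Q \<le> J (edge_dom l e) (f e) (g e)" if "e < 2" for e
            unfolding Q_def by (rule J_loop_edge_lower[OF l(1) ad that]) (rule cm[OF that])
          have "integral {0..l} (\<lambda>t. (g 0 t)\<^sup>2) / 2 - Q \<le> J (edge_dom l 0) (f 0) (g 0)"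
            "integral {0..l} (\<lambda>t. (g 1 t)\<^sup>2) / 2 - Q \<le> J (edge_dom l 1) (f 1) (g 1)" by (rule J; simp)+
          then show ?thesis unfolding Q using 1 by linarith
        qed
        have lp: "2 * l * c powr p / p \<le> c\<^sup>2 * (2 * A powr (p - 2) / p)"
        proof -
          have "l * c powr p \<le> 1 * (A powr (p - 2) * c\<^sup>2)" using l mono_p[OF c0 cA] by (intro mult_mono) auto
          then have "2 * (l * c powr p) / p \<le> 2 * (A powr (p - 2) * c\<^sup>2) / p" using p2 by (intro divide_right_mono) auto
          then show ?thesis by (simp add: mult_ac)
        qed
        have lq: "(a powr q + b powr q) / q \<le> c\<^sup>2 * (2 * A powr (q - 2) / q)"
        proof -
          have "a powr q \<le> c powr q" "b powr q \<le> c powr q" using ac a0 q2 by (auto intro!: powr_mono2)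
          then have "a powr q + b powr q \<le> 2 * (A powr (q - 2) * c\<^sup>2)" using mono_q[OF c0 cA] by linarith
          then have "(a powr q + b powr q) / q \<le> 2 * (A powr (q - 2) * c\<^sup>2) / q" using q2 by (intro divide_right_mono) auto
          then show ?thesis by (simp add: mult_ac)
        qed
        have "c\<^sup>2 / (8 * l) = c\<^sup>2 * (B + 1)" using l(3) by (metis mult.right_neutral times_divide_eq_right)
        moreover have "c\<^sup>2 * (B + 1) = c\<^sup>2 * (2 * A powr (p - 2) / p) + c\<^sup>2 * (2 * A powr (q - 2) / q) + c\<^sup>2 * ((D + 1) / M0\<^sup>2) + c\<^sup>2"
          unfolding B_def by (simp add: distrib_left)
        ultimately have loop2: "c\<^sup>2 * ((D + 1) / M0\<^sup>2) + c\<^sup>2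
            \<le> J (edge_dom l 0) (f 0) (g 0) + J (edge_dom l 1) (f 1) (g 1) - (a powr q + b powr q) / q"
          using loop lp lq by linarith
        define mh where "mh = (\<Sum>e\<in>{2..<N + 2}. integral (edge_dom l e) (\<lambda>t. (f e t)\<^sup>2))"
        have mh: "mh \<le> m"
        proof -
          have "0 \<le> integral (edge_dom l e) (\<lambda>t. (f e t)\<^sup>2)" if "e < 2" for e
            using Henstock_Kurzweil_Integration.integral_nonneg[OF admD(2)[OF ad, of e]] that by simp
          from this[of 0] this[of 1] show ?thesis using ms unfolding mh_def mass_def sum_edges by simp
        qed
        have half: "(\<Sum>e\<in>{2..<N + 2}. ?D e) = (\<Sum>e\<in>{2..<N + 2}. J (edge_dom l e) (f e) (g e)) + M powr (p - 2) / p * mh"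
        proof -
          have "(\<Sum>e\<in>{2..<N + 2}. ?D e) = (\<Sum>e\<in>{2..<N + 2}. J (edge_dom l e) (f e) (g e) + M powr (p - 2) / p * integral (edge_dom l e) (\<lambda>t. (f e t)\<^sup>2))"
            by (rule sum.cong) (use adm_dens(2)[OF l(1) ad _ Mb] in auto)
          then show ?thesis unfolding sum.distrib sum_distrib_left[symmetric] by (simp only: mh_def)
        qed
        have "M powr (p - 2) / p * mh \<le> M powr (p - 2) / p * m" using mh p2 by (intro mult_left_mono) auto
        then have half2: "(\<Sum>e\<in>{2..<N + 2}. ?D e) - M powr (p - 2) / p * m \<le> (\<Sum>e\<in>{2..<N + 2}. J (edge_dom l e) (f e) (g e))"
          using half by linarith
        have En: "En N l f g = J (edge_dom l 0) (f 0) (g 0) + J (edge_dom l 1) (f 1) (g 1)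
            + (\<Sum>e\<in>{2..<N + 2}. J (edge_dom l e) (f e) (g e)) - (a powr q + b powr q) / q"
          unfolding En_def sum_edges a_def b_def ..
        have Ga: "0 \<le> G M a" using ac cM a0 by (intro G_nonneg) auto
        show ?thesis
        proof (cases "2 \<le> e0")
          \<comment> \<open>The half-lines alone pay for \<open>elin M m\<close>, so what the loop
            retains beyond the vertex terms is a strict gain.\<close>
          case True
          then have mem: "e0 \<in> {2..<N + 2}" "0 \<le> x0" using ex by (auto simp: edge_dom_def)
          have "2 * G M M + (real N - 2) * G M a \<le> (\<Sum>e\<in>{2..<N + 2}. ?D e)"
            using calibrated_half_lines(3)[OF l(1) ad N(2) M Mb mem x0] unfolding a_def .
          moreover have "0 \<le> (real N - 2) * G M a" using Ga N by (intro mult_nonneg_nonneg) auto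
          ultimately have "elin M m \<le> (\<Sum>e\<in>{2..<N + 2}. J (edge_dom l e) (f e) (g e))"
            using half2 el by linarith
          moreover have "0 \<le> c\<^sup>2 * ((D + 1) / M0\<^sup>2)" using D0 by simp
          moreover have "0 < c\<^sup>2" using cp by simp
          ultimately show ?thesis using En loop2 Emin[OF M] by linarith
        next
          \<comment> \<open>The maximum on the loop is at least \<open>M0\<close>, so the kinetic
            energy there outweighs the mass term \<open>D\<close>, and the energy is even
            positive.\<close>
          case False
          have "M \<le> c" using cm[of e0 x0] ex(2) x0 False by (simp add: edge_dom_def)
          then have "M0\<^sup>2 \<le> c\<^sup>2" using MM M0 by (intro power_mono) auto
          then have "M0\<^sup>2 * ((D + 1) / M0\<^sup>2) \<le> c\<^sup>2 * ((D + 1) / M0\<^sup>2)" using D0 by (intro mult_right_mono) auto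
          then have big: "D + 1 \<le> c\<^sup>2 * ((D + 1) / M0\<^sup>2)" using M0 by simp
          have "real N * G M a \<le> (\<Sum>e\<in>{2..<N + 2}. ?D e)"
            using calibrated_half_lines(1)[OF l(1) ad N(2) M Mb] unfolding a_def .
          moreover have "0 \<le> real N * G M a" using Ga by simp
          moreover have "M powr (p - 2) / p * m \<le> D"
          proof -
            have "M powr (p - 2) * m / p \<le> A powr (p - 2) * m / p"
              using MM M m p2 by (intro divide_right_mono mult_right_mono powr_mono2) auto
            then show ?thesis by (simp add: D_def)
          qed
          moreover have "0 \<le> c\<^sup>2" by simp
          ultimately show ?thesis using En loop2 big half2 E by linarith
        qed
      qed
    qed
  qed
  then show thesis using that N(1) l(1) unfolding m_def E_def by blast
qed

section \<open>Translation to ground states and the two graphs\<close>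

lemma ground_state_imp:
  assumes l: "0 < l" and u: "ground_state p q (loop_graph N l) \<mu> u"
  obtains f g where "adm N l f g" "mass N l f = \<mu>"
    "\<And>F H. adm N l F H \<Longrightarrow> mass N l F = \<mu> \<Longrightarrow> En N l f g \<le> En N l F H"
proof -
  have u1: "u \<in> H1_mass (loop_graph N l) \<mu>"
    "ereal (energy p q (loop_graph N l) u) = (INF w \<in> H1_mass (loop_graph N l) \<mu>. ereal (energy p q (loop_graph N l) w))"
    using u by (auto simp: ground_state_def)
  obtain f g where fg: "adm N l f g" "mass N l f = \<mu>" "energy p q (loop_graph N l) u = En N l f g"
    using adm_of_H1[OF l u1(1)] by metis
  have "En N l f g \<le> En N l F H" if FH: "adm N l F H" "mass N l F = \<mu>" for F H
  proof -
    obtain w where w: "w \<in> H1_mass (loop_graph N l) \<mu>" "energy p q (loop_graph N l) w = En N l F H"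
      using H1_of_adm[OF l FH] by metis
    have "ereal (energy p q (loop_graph N l) u) \<le> ereal (energy p q (loop_graph N l) w)"
      unfolding u1(2) by (rule INF_lower[OF w(1)])
    then show ?thesis using fg(3) w(2) by simp
  qed
  with fg(1,2) show thesis by (rule that)
qed

end

lemma loop_graph_admissible:
  assumes "0 < l" "3 \<le> N"
  shows "metric_graph (loop_graph N l)" "noncompact (loop_graph N l)" "3 \<le> card (half_lines (loop_graph N l))"
    "\<exists>v \<in> vertices (loop_graph N l). vertex_degree (loop_graph N l) v = 2"
    "every_point_on_two_half_line_trail (loop_graph N l)"
  using assms metric_graph_loop_graph every_point_loop_graph vertex_degree_loop_graph[of N l]
  by (auto simp: noncompact_def half_lines_loop_graph)

theorem theorem1p7:
  fixes p q :: real
  assumes "2 < p" and "p < 6" and "2 < q" and "q < 4" and "q < p / 2 + 1"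
  shows "(\<exists>G1 :: (nat, nat) mgraph.
            metric_graph G1 \<and> noncompact G1 \<and>
            3 \<le> card (half_lines G1) \<and>
            (\<exists>v \<in> vertices G1. vertex_degree G1 v = 2) \<and>
            every_point_on_two_half_line_trail G1 \<and>
            (\<forall>\<mu> > 0. \<exists>u. ground_state p q G1 \<mu> u)) \<and>
         (\<exists>(G2 :: (nat, nat) mgraph) (m :: real).
            metric_graph G2 \<and> noncompact G2 \<and>
            3 \<le> card (half_lines G2) \<and>
            (\<exists>v \<in> vertices G2. vertex_degree G2 v = 2) \<and>
            every_point_on_two_half_line_trail G2 \<and>
            0 < m \<and> \<not> (\<exists>u. ground_state p q G2 m u))"
proof -
  interpret exponents p q by unfold_locales (fact assms)+
  obtain l1 where l1: "0 < l1" "\<And>\<mu>. 0 < \<mu> \<Longrightarrow> \<exists>u. ground_state p q (loop_graph 3 l1) \<mu> u"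
    using ground_states_all_masses by metis
  obtain N l where N: "3 \<le> N" "0 < l"
    "\<And>f g. adm N l f g \<Longrightarrow> mass N l f = sol_mass 1 \<Longrightarrow> elin 1 (sol_mass 1) < En N l f g"
    using no_ground_state by metis
  have "\<not> ground_state p q (loop_graph N l) (sol_mass 1) u" for u
  proof
    assume "ground_state p q (loop_graph N l) (sol_mass 1) u"
    then obtain f g where fg: "adm N l f g" "mass N l f = sol_mass 1"
      "\<And>F H. adm N l F H \<Longrightarrow> mass N l F = sol_mass 1 \<Longrightarrow> En N l f g \<le> En N l F H"
      using ground_state_imp[OF N(2)] by metis
    \<comment> \<open>A ground state would exceed the energy of the line by \<open>d\<close>; a
      soliton sufficiently far out on a half-line undercuts it.\<close>
    define d where "d = En N l f g - elin 1 (sol_mass 1)"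
    have d: "0 < d" using N(3)[OF fg(1,2)] by (simp add: d_def)
    have "2 \<le> N" using N(1) by simp
    then obtain F H where "adm N l F H" "mass N l F = sol_mass 1" "En N l F H < elin 1 (sol_mass 1) + d"
      using half_line_competitor[OF zero_less_one N(2) _ d] by metis
    then show False using fg(3)[of F H] by (simp add: d_def)
  qed
  moreover have "0 < sol_mass 1" by (rule sol_mass_pos) simp
  ultimately show ?thesis
    using l1(2) loop_graph_admissible[OF l1(1), of 3] loop_graph_admissible[OF N(2,1)] by blast
qed

end
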